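(* Let $\Gamma$ be a subgroup of finite rank of the multiplicative group $\mathbb{G}_m(\overline{\mathbb{Q}})=\overline{\mathbb{Q}}^*$, and let $\Gamma_{\mathrm{sat}}=\{\alpha\in\overline{\mathbb{Q}}^* \mid \alpha^n\in\Gamma \text{ for some } n\in\mathbb{N}\}$. Then for every finite field extension $L/\mathbb{Q}(\Gamma_{\mathrm{sat}})$ the quotient group $L^*/\Gamma_{\mathrm{sat}}$ is a free abelian group.
   Context: $\overline{\mathbb{Q}}$ is a fixed algebraic closure of $\mathbb{Q}$, all algebraic extensions of $\mathbb{Q}$ are taken inside $\overline{\mathbb{Q}}$, and $\mathbb{N}=\{1,2,3,\dots\}$. The rank of an abelian group is the maximal number of ($\mathbb{Z}$-)linearly independent elements in it. For a subgroup $\Gamma$ of $\overline{\mathbb{Q}}^*$, the set $\Gamma_{\mathrm{sat}}$ is its divisible hull in $\overline{\mathbb{Q}}^*$ (since $\mathrm{End}(\mathbb{G}_m)=\mathbb{Z}$, the general saturation $(\mathrm{End}(\mathbb{G}_m)\cdot\Gamma)_{\mathrm{div}}$ coincides with the divisible hull $\Gamma_{\mathrm{div}}$). $\mathbb{Q}(\Gamma_{\mathrm{sat}})$ is the field generated over $\mathbb{Q}$ by all elements of $\Gamma_{\mathrm{sat}}$. *)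

theory Defs
  imports
    "HOL-Algebra.Algebra"
    "HOL-Algebra.Free_Abelian_Groups"
    "HOL-Algebra.Finite_Extensions"
    "HOL-Algebra.Generated_Fields"
    "HOL-Algebra.Multiplicative_Group"
    "HOL-Library.Extended_Nat"
    "HOL-Computational_Algebra.Polynomial"
    Complex_Main
begin

text \<open>The chosen algebraic closure of the rationals is the field of algebraic complex numbers.\<close>

definition Qbar :: "complex ring" where
  "Qbar = \<lparr>carrier = {z. algebraic z}, monoid.mult = (*), one = 1, ring.zero = 0, ring.add = (+)\<rparr>"

definition int_independent :: "('a, 'b) monoid_scheme \<Rightarrow> 'a set \<Rightarrow> bool" where
  "int_independent G A \<longleftrightarrow> finite A \<and> A \<subseteq> carrier G \<and>
     (\<forall>c :: 'a \<Rightarrow> int. (\<Otimes>\<^bsub>G\<^esub>a\<in>A. a [^]\<^bsub>G\<^esub> c a) = \<one>\<^bsub>G\<^esub> \<longrightarrow> (\<forall>a\<in>A. c a = 0))"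

text \<open>The supremum is \<open>\<infinity>\<close> exactly when there are arbitrarily large finite independent sets.\<close>

definition group_rank :: "('a, 'b) monoid_scheme \<Rightarrow> enat" where
  "group_rank G = (SUP A \<in> {A. int_independent G A}. enat (card A))"

definition saturation :: "('a, 'b) monoid_scheme \<Rightarrow> 'a set \<Rightarrow> 'a set" where
  "saturation G H = {x \<in> carrier G. \<exists>n::nat. n \<ge> 1 \<and> x [^]\<^bsub>G\<^esub> n \<in> H}"

text \<open>A basis of a free abelian group can be chosen inside the group itself, so it is no
  restriction that \<open>S\<close> has the same element type as \<open>G\<close>; see \<open>free_abelianI\<close>.\<close>

definition free_abelian :: "('a, 'b) monoid_scheme \<Rightarrow> bool" where
  "free_abelian G \<longleftrightarrow> comm_group G \<and> (\<exists>S :: 'a set. G \<cong> free_Abelian_group S)"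

lemma free_abelianI:
  fixes G :: "('a, 'b) monoid_scheme" and S :: "'c set"
  assumes G: "comm_group G" and iso: "G \<cong> free_Abelian_group S"
  shows "free_abelian G"
proof -
  interpret comm_group G by (fact G)
  obtain h where h: "h \<in> iso (free_Abelian_group S) G"
    using iso_sym[OF iso] unfolding is_iso_def by blast
  have inj: "inj_on h (carrier (free_Abelian_group S))"
    using h by (auto simp: iso_def bij_betw_def)
  have "inj_on (\<lambda>x. h (frag_of x)) S"
  proof (rule inj_onI)
    fix x y assume "x \<in> S" "y \<in> S" "h (frag_of x) = h (frag_of y)"
    then have "frag_of x = frag_of y"
      using inj by (auto simp: free_Abelian_group_def inj_on_def)
    then show "x = y" by (metis Poly_Mapping.keys_single singleton_inject zero_neq_one)
  qed
  then have "S \<approx> (\<lambda>x. h (frag_of x)) ` S"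
    by (simp add: inj_on_image_eqpoll_self eqpoll_sym)
  then have "free_Abelian_group S \<cong> free_Abelian_group ((\<lambda>x. h (frag_of x)) ` S)"
    by (simp add: isomorphic_free_Abelian_groups)
  with iso G show ?thesis
    unfolding free_abelian_def by (blast intro: iso_trans)
qed

end

theory Submission
  imports Defs "Jordan_Normal_Form.Char_Poly"
begin

text \<open>
  Write \<open>M\<close> for the saturation of \<open>\<Gamma>\<close>. The group \<open>L\<^sup>*/M\<close> is countable and torsion-free, so
  by Pontryagin's criterion it is free once the pure closure of every finitely generated subgroup
  has bounded exponent modulo that subgroup. Given a finite set \<open>B\<close> of generators, enlarged by
  generators of \<open>\<Gamma>\<close> up to torsion, choose a number field \<open>F\<close> containing \<open>B\<close> such that \<open>L\<close> lies in
  the span \<open>F[M]\<close>, and let \<open>x \<in> L\<close> have a power in the group \<open>\<langle>B\<rangle>\<close>. Kummer theory gives \<open>x = m y\<close>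
  with \<open>m \<in> M\<close> and \<open>y \<in> F(\<mu>\<^sub>\<infinity>)\<close>. As \<open>F(y)/F\<close> is abelian, Schinzel's argument shows that \<open>y\<^sup>W\<close> is
  a root of unity times an element of \<open>F\<close>, where \<open>W\<close> depends only on the roots of unity in \<open>F\<close>.
  Finally, the elements of \<open>F\<close> with a power in \<open>\<langle>B\<rangle>\<close> have bounded exponent modulo \<open>\<langle>B\<rangle>\<close>: they are
  represented modulo \<open>\<langle>B\<rangle>\<close> by numbers with bounded denominators and conjugates, of which \<open>F\<close>
  contains only finitely many.
\<close>

section \<open>Subrings of the complex numbers and algebraic integers\<close>

text \<open>The obstacle is uniformity. A number field has bounded exponents, but \<open>L\<close>
  has infinite degree over the rationals, and the order of \<open>x\<close> modulo the group
  generated by \<open>B\<close> is not bounded in advance. So \<open>F\<close> has to be chosen from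
  \<open>B\<close> alone, before \<open>x\<close> is known, and every step has to cost an exponent
  that depends on \<open>F\<close> and \<open>B\<close> only. Finite rank of \<open>\<Gamma>\<close>
  allows \<open>F\<close> to contain generators of \<open>\<Gamma>\<close> up to torsion; every
  element of \<open>M\<close> is then a radical over \<open>F\<close>, as Kummer theory requires.
  Finiteness of \<open>L\<close> over the field of \<open>M\<close> allows \<open>F\<close> to
  contain generators of that extension, which is why \<open>L\<close> lies in the span. Splitting
  off \<open>m\<close> is free of charge, since \<open>m\<close> dies in the quotient by
  \<open>M\<close>. The descent from the cyclotomic extension to \<open>F\<close> costs
  \<open>W\<close>, the exponent inside \<open>F\<close> costs \<open>N\<close>, and
  \<open>W * N\<close> serves every \<open>x\<close>. The two constants have one source:
  \<open>W\<close> is the exponent belonging to the empty set of generators, where having a power in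
  the group means being a root of unity. Galois groups are replaced by homomorphisms on all
  algebraic numbers that fix \<open>F\<close>.\<close>

lemma int_subgroup_generator:
  fixes I :: "int set"
  assumes diff: "\<And>d e. d \<in> I \<Longrightarrow> e \<in> I \<Longrightarrow> d - e \<in> I" and m: "int m \<in> I" "m \<ge> 1"
  obtains g :: nat where "g \<ge> 1" "int g \<in> I" "\<And>d. d \<in> I \<longleftrightarrow> int g dvd d"
proof -
  have zero: "0 \<in> I" using diff[OF m(1) m(1)] by simp
  have minus: "- d \<in> I" if "d \<in> I" for d using diff[OF zero that] by simp
  have nat_mult: "d * int n \<in> I" if "d \<in> I" for d n
    using that by (induction n) (use zero diff[OF _ minus] in \<open>auto simp: algebra_simps\<close>)
  have mult: "d * e \<in> I" if "d \<in> I" for d e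
    using nat_mult[OF that] minus[OF nat_mult[OF that]] by (cases e rule: int_cases2) auto
  define g where "g = (LEAST g::nat. g \<ge> 1 \<and> int g \<in> I)"
  have g: "g \<ge> 1" "int g \<in> I"
    using LeastI[of "\<lambda>g. g \<ge> 1 \<and> int g \<in> I" m] m unfolding g_def by auto
  have "int g dvd d" if "d \<in> I" for d
  proof (rule ccontr)
    assume "\<not> int g dvd d"
    then have r: "d mod int g \<noteq> 0" by (simp add: dvd_eq_mod_eq_0)
    have "d mod int g \<ge> 0" "d mod int g < int g" using g(1) by auto
    have "d mod int g = d - int g * (d div int g)" by (simp add: minus_mult_div_eq_mod)
    then have "d mod int g \<in> I" using diff[OF that mult[OF g(2)]] by simp
    then have "nat (d mod int g) \<ge> 1 \<and> int (nat (d mod int g)) \<in> I" using r \<open>d mod int g \<ge> 0\<close> by auto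
    then have "g \<le> nat (d mod int g)" unfolding g_def by (rule Least_le)
    then show False using \<open>d mod int g < int g\<close> \<open>d mod int g \<ge> 0\<close> by linarith
  qed
  moreover have "d \<in> I" if "int g dvd d" for d using that mult[OF g(2)] by (auto elim!: dvdE)
  ultimately show ?thesis using that g by blast
qed

text \<open>Subrings are plain sets under the operations of the type \<open>complex\<close>, so that
  polynomials, sums and the fundamental theorem of algebra apply directly; the HOL-Algebra
  structures are translated only in the last section.\<close>

definition complex_subring :: "complex set \<Rightarrow> bool" where
  "complex_subring K \<longleftrightarrow> 1 \<in> K \<and> (\<forall>x\<in>K. \<forall>y\<in>K. x - y \<in> K \<and> x * y \<in> K)"

definition complex_subfield :: "complex set \<Rightarrow> bool" where
  "complex_subfield K \<longleftrightarrow> complex_subring K \<and> (\<forall>x\<in>K. inverse x \<in> K)"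

lemma complex_subringD:
  assumes "complex_subring K"
  shows "0 \<in> K" "1 \<in> K" "x \<in> K \<Longrightarrow> y \<in> K \<Longrightarrow> x + y \<in> K" "x \<in> K \<Longrightarrow> - x \<in> K"
    "x \<in> K \<Longrightarrow> y \<in> K \<Longrightarrow> x - y \<in> K" "x \<in> K \<Longrightarrow> y \<in> K \<Longrightarrow> x * y \<in> K"
proof -
  have d: "x - y \<in> K" "x * y \<in> K" if "x \<in> K" "y \<in> K" for x y
    using assms that unfolding complex_subring_def by blast+
  show 1: "1 \<in> K" using assms unfolding complex_subring_def by blast
  then show 0: "0 \<in> K" using d(1)[OF 1 1] by simp
  show m: "- x \<in> K" if "x \<in> K" for x using d(1)[OF 0 that] by simp
  show "x \<in> K \<Longrightarrow> y \<in> K \<Longrightarrow> x + y \<in> K" using d(1)[OF _ m, of x y] by simp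
qed (use assms in \<open>auto simp: complex_subring_def\<close>)

lemma complex_subfieldD:
  assumes "complex_subfield K"
  shows "0 \<in> K" "1 \<in> K" "x \<in> K \<Longrightarrow> y \<in> K \<Longrightarrow> x + y \<in> K" "x \<in> K \<Longrightarrow> - x \<in> K"
    "x \<in> K \<Longrightarrow> y \<in> K \<Longrightarrow> x - y \<in> K" "x \<in> K \<Longrightarrow> y \<in> K \<Longrightarrow> x * y \<in> K"
    "x \<in> K \<Longrightarrow> inverse x \<in> K" "x \<in> K \<Longrightarrow> y \<in> K \<Longrightarrow> x / y \<in> K"
proof -
  have "complex_subring K" and i: "\<And>x. x \<in> K \<Longrightarrow> inverse x \<in> K"
    using assms unfolding complex_subfield_def by auto
  note d = complex_subringD[OF this(1)]
  show "0 \<in> K" "1 \<in> K" "x \<in> K \<Longrightarrow> y \<in> K \<Longrightarrow> x + y \<in> K" "x \<in> K \<Longrightarrow> - x \<in> K"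
    "x \<in> K \<Longrightarrow> y \<in> K \<Longrightarrow> x - y \<in> K" "x \<in> K \<Longrightarrow> y \<in> K \<Longrightarrow> x * y \<in> K"
    "x \<in> K \<Longrightarrow> inverse x \<in> K"
    by (fact d i)+
  show "x \<in> K \<Longrightarrow> y \<in> K \<Longrightarrow> x / y \<in> K"
    using d(6)[OF _ i, of x y] by (simp add: divide_inverse)
qed

lemma complex_subfield_imp_subring: "complex_subfield K \<Longrightarrow> complex_subring K"
  by (simp add: complex_subfield_def)

lemma complex_subring_sum:
  assumes "complex_subring K" "\<And>i. i \<in> I \<Longrightarrow> f i \<in> K"
  shows "sum f I \<in> K"
  using assms(2) by (induction I rule: infinite_finite_induct)
    (auto intro!: complex_subringD(1,3)[OF assms(1)])

lemma complex_subring_prod: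
  assumes "complex_subring K" "\<And>i. i \<in> I \<Longrightarrow> f i \<in> K"
  shows "prod f I \<in> K"
  using assms(2) by (induction I rule: infinite_finite_induct)
    (auto intro!: complex_subringD(2,6)[OF assms(1)])

lemma complex_subring_power:
  assumes "complex_subring K" "x \<in> K"
  shows "x ^ n \<in> K"
  by (induction n) (auto intro!: complex_subringD(2,6)[OF assms(1)] assms(2))

lemma complex_subfield_powi:
  assumes "complex_subfield K" "x \<in> K"
  shows "x powi n \<in> K"
  unfolding power_int_def
  using complex_subring_power[OF complex_subfield_imp_subring[OF assms(1)]] assms complex_subfieldD(7)
  by auto

lemma complex_subring_Ints: "complex_subring \<int>"
  by (auto simp: complex_subring_def)

lemma complex_subfield_Rats: "complex_subfield \<rat>"
  by (auto simp: complex_subring_def complex_subfield_def)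

lemma complex_subring_of_int:
  assumes "complex_subring K"
  shows "of_int n \<in> K"
proof -
  have "of_nat k \<in> K" for k
    by (induction k) (auto intro!: complex_subringD(1,2,3)[OF assms])
  then show ?thesis
    by (cases n rule: int_cases2) (auto intro!: complex_subringD(4)[OF assms])
qed

lemma Rats_subset_complex_subfield:
  assumes "complex_subfield K"
  shows "\<rat> \<subseteq> K"
proof
  fix x :: complex assume "x \<in> \<rat>"
  then obtain a b where "x = of_int a / of_int b"
    by (auto elim: Rats_cases')
  then show "x \<in> K"
    using complex_subring_of_int[OF complex_subfield_imp_subring[OF assms]] complex_subfieldD(8)[OF assms]
    by auto
qed

section \<open>Polynomials with coefficients in a subring, and integrality\<close>

definition polys_over :: "complex set \<Rightarrow> complex poly set" where
  "polys_over K = {p. \<forall>i. coeff p i \<in> K}"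

lemma coeff_polys_over: "p \<in> polys_over K \<Longrightarrow> coeff p i \<in> K"
  by (simp add: polys_over_def)

lemma polys_over_mono: "K \<subseteq> K' \<Longrightarrow> polys_over K \<subseteq> polys_over K'"
  by (auto simp: polys_over_def)

lemma polys_over_closed:
  assumes "complex_subring K"
  shows "0 \<in> polys_over K" "1 \<in> polys_over K" "p \<in> polys_over K \<Longrightarrow> q \<in> polys_over K \<Longrightarrow> p + q \<in> polys_over K"
    "p \<in> polys_over K \<Longrightarrow> q \<in> polys_over K \<Longrightarrow> p - q \<in> polys_over K"
    "p \<in> polys_over K \<Longrightarrow> q \<in> polys_over K \<Longrightarrow> p * q \<in> polys_over K"
    "p \<in> polys_over K \<Longrightarrow> - p \<in> polys_over K"
    "c \<in> K \<Longrightarrow> monom c n \<in> polys_over K"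
    "c \<in> K \<Longrightarrow> p \<in> polys_over K \<Longrightarrow> smult c p \<in> polys_over K"
    "c \<in> K \<Longrightarrow> p \<in> polys_over K \<Longrightarrow> pCons c p \<in> polys_over K"
    "p \<in> polys_over K \<Longrightarrow> pderiv p \<in> polys_over K"
  using complex_subringD[OF assms] complex_subring_of_int[OF assms, of "int _"]
  by (auto simp: polys_over_def coeff_mult coeff_pCons coeff_pderiv one_pCons simp del: of_nat_Suc
      intro!: complex_subring_sum[OF assms] split: nat.split)

lemma poly_in_subring:
  assumes "complex_subring K" "p \<in> polys_over K" "x \<in> K"
  shows "poly p x \<in> K"
  unfolding poly_altdef
  by (intro complex_subring_sum complex_subringD(6) complex_subring_power assms coeff_polys_over)

text \<open>Long division divides by the leading coefficient only, so with a monic divisor it stays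
  inside a ring. The integers are needed here as well as fields.\<close>

lemma polys_over_monic_div:
  assumes K: "complex_subring K" and p: "p \<in> polys_over K" "lead_coeff p = 1" and "f \<in> polys_over K"
  shows "\<exists>q\<in>polys_over K. \<exists>r\<in>polys_over K. f = q * p + r \<and> (r = 0 \<or> degree r < degree p)"
  using assms(4)
proof (induction "degree f" arbitrary: f rule: less_induct)
  case less
  note c = polys_over_closed[OF K]
  show ?case
  proof (cases "f = 0 \<or> degree f < degree p")
    case True
    then show ?thesis
      using c(1) less.prems by (intro bexI[of _ 0] bexI[of _ f]) auto
  next
    case False
    define t where "t = monom (lead_coeff f) (degree f - degree p)"
    have [simp]: "p \<noteq> 0" using p by auto
    have t: "t \<in> polys_over K" "t \<noteq> 0"
      using False less.prems by (auto simp: t_def intro!: c(7) coeff_polys_over)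
    define g where "g = f - t * p"
    have g: "g \<in> polys_over K" unfolding g_def by (intro c less.prems t p)
    have dt: "degree (t * p) = degree f"
      using False t by (subst degree_mult_eq) (auto simp: t_def degree_monom_eq)
    have lt: "lead_coeff (t * p) = lead_coeff f"
      using p False by (simp add: lead_coeff_mult) (simp add: t_def degree_monom_eq)
    have "degree g \<le> degree f" "coeff g (degree f) = 0"
      using lt dt degree_diff_le[of f "degree f" "t * p"] by (auto simp: g_def)
    then have "g = 0 \<or> degree g < degree f"
      using eq_zero_or_degree_less by blast
    then obtain q r where qr: "q \<in> polys_over K" "r \<in> polys_over K" "g = q * p + r" "r = 0 \<or> degree r < degree p"
    proof
      assume "g = 0" then show ?thesis using that[of 0 0] c(1) by auto
    next
      assume "degree g < degree f"
      from less.hyps[OF this g] that show ?thesis by blast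
    qed
    then show ?thesis
      using t by (intro bexI[of _ "q + t"] bexI[of _ r] c) (auto simp: g_def algebra_simps)
  qed
qed

text \<open>The remainder of \<open>f\<close> modulo \<open>p\<close> has the same value at
  \<open>x\<close>. Over \<open>\<int>\<close> this gives finite generation of the powers of an
  algebraic integer, over a field the finite degree of an adjunction.\<close>

lemma power_in_monic_span:
  assumes K: "complex_subring K" and p: "p \<in> polys_over K" "lead_coeff p = 1" "poly p x = 0"
    and f: "f \<in> polys_over K"
  shows "\<exists>c. (\<forall>i. c i \<in> K) \<and> poly f x = (\<Sum>i<degree p. c i * x ^ i)"
proof -
  obtain q r where qr: "q \<in> polys_over K" "r \<in> polys_over K" "f = q * p + r" "r = 0 \<or> degree r < degree p"
    using polys_over_monic_div[OF K p(1,2) f] by blast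
  have "poly f x = poly r x" using p by (simp add: qr(3))
  also have "\<dots> = (\<Sum>i<degree p. coeff r i * x ^ i)"
  proof (cases "r = 0")
    case False
    then have "{..degree r} \<subseteq> {..<degree p}" using qr(4) by auto
    then show ?thesis
      unfolding poly_altdef by (intro sum.mono_neutral_left) (auto simp: coeff_eq_0)
  qed simp
  finally show ?thesis using coeff_polys_over[OF qr(2)] by blast
qed

text \<open>The determinant trick: the matrix of multiplication by \<open>x\<close> on the span of
  \<open>e\<close> has the vector of all \<open>e i\<close> as an eigenvector for \<open>x\<close>,
  so its characteristic polynomial vanishes at \<open>x\<close>. The matrix lives over an abstract
  ring mapped by \<open>hom\<close>, since integer matrices give integrality and rational ones give
  a degree bound.\<close>

lemma monic_root_if_module:
  fixes e :: "'i \<Rightarrow> complex" and hom :: "'a::comm_ring_1 \<Rightarrow> complex"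
  assumes hom: "comm_ring_hom hom" and "finite I" and "\<exists>i\<in>I. e i \<noteq> 0"
    and "\<And>i. i \<in> I \<Longrightarrow> \<exists>c. x * e i = (\<Sum>j\<in>I. hom (c j) * e j)"
  obtains p where "lead_coeff p = 1" "degree p = card I" "poly (map_poly hom p) x = 0"
proof -
  interpret comm_ring_hom hom by (fact hom)
  define n where "n = card I"
  obtain h where h: "bij_betw h {..<n} I"
    using ex_bij_betw_nat_finite[OF assms(2)] unfolding n_def atLeast0LessThan by blast
  obtain c :: "'i \<Rightarrow> 'i \<Rightarrow> 'a" where c: "x * e i = (\<Sum>j\<in>I. hom (c i j) * e j)" if "i \<in> I" for i
    using assms(4) by metis
  define M where "M = mat n n (\<lambda>(i, j). c (h i) (h j))"
  define v where "v = vec n (\<lambda>i. e (h i))"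
  have M: "M \<in> carrier_mat n n" by (simp add: M_def)
  let ?M = "map_mat hom M"
  have "eigenvector ?M v x"
    unfolding eigenvector_def
  proof (intro conjI)
    show "v \<in> carrier_vec (dim_row ?M)" using M by (simp add: v_def)
    show "v \<noteq> 0\<^sub>v (dim_row ?M)"
    proof
      assume v0: "v = 0\<^sub>v (dim_row ?M)"
      obtain i where "i \<in> I" "e i \<noteq> 0" using assms(3) by blast
      moreover then obtain k where "k < n" "h k = i"
        using h by (metis bij_betw_iff_bijections lessThan_iff)
      moreover have "v $ k = 0" using v0 \<open>k < n\<close> by (simp add: M_def)
      ultimately show False by (simp add: v_def)
    qed
    show "?M *\<^sub>v v = x \<cdot>\<^sub>v v"
    proof (rule eq_vecI)
      fix i assume "i < dim_vec (x \<cdot>\<^sub>v v)"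
      then have i: "i < n" by (simp add: v_def)
      then have "h i \<in> I" using h by (auto simp: bij_betw_def)
      have "(?M *\<^sub>v v) $ i = (\<Sum>j<n. hom (c (h i) (h j)) * e (h j))"
        using i by (auto simp: M_def v_def scalar_prod_def atLeast0LessThan intro!: sum.cong)
      also have "\<dots> = (\<Sum>j\<in>I. hom (c (h i) j) * e j)"
        by (rule sum.reindex_bij_betw[OF h])
      also have "\<dots> = x * e (h i)" using c[OF \<open>h i \<in> I\<close>] by simp
      finally show "(?M *\<^sub>v v) $ i = (x \<cdot>\<^sub>v v) $ i" using i by (simp add: v_def)
    qed (simp add: M_def v_def)
  qed
  then have "poly (char_poly ?M) x = 0"
    using M by (subst eigenvalue_root_char_poly[symmetric, of _ n]) (auto simp: eigenvalue_def)
  then have "poly (map_poly hom (char_poly M)) x = 0"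
    using char_poly_hom[OF M] by simp
  then show ?thesis
    using degree_monic_char_poly[OF M] by (intro that[of "char_poly M"]) (auto simp: n_def)
qed

lemma algebraic_int_if_module:
  fixes e :: "'i \<Rightarrow> complex"
  assumes "finite I" and "\<exists>i\<in>I. e i \<noteq> 0"
    and "\<And>i. i \<in> I \<Longrightarrow> \<exists>c::'i \<Rightarrow> int. x * e i = (\<Sum>j\<in>I. of_int (c j) * e j)"
  shows "algebraic_int x"
  using monic_root_if_module[OF of_int_hom.comm_ring_hom_axioms assms]
  unfolding algebraic_int_altdef_ipoly by metis

lemma algebraic_int_power_span:
  fixes x :: complex
  assumes "algebraic_int x"
  obtains m where "m > 0" "\<And>a. \<exists>c::nat \<Rightarrow> int. x ^ a = (\<Sum>i<m. of_int (c i) * x ^ i)"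
proof -
  obtain p where p: "lead_coeff p = 1" "\<forall>i. coeff p i \<in> \<int>" "poly p x = 0"
    using assms by (auto elim: algebraic_int.cases)
  show ?thesis
  proof (rule that)
    show "degree p > 0" using p by (auto intro!: Nat.gr0I elim!: degree_eq_zeroE)
    fix a
    obtain c where c: "\<And>i. c i \<in> \<int>" "poly (monom 1 a) x = (\<Sum>i<degree p. c i * x ^ i)"
      using power_in_monic_span[OF complex_subring_Ints, of p x "monom 1 a"] p
        polys_over_closed(7)[OF complex_subring_Ints, of 1 a]
      by (auto simp: polys_over_def)
    \<comment> \<open>An integer among the complex numbers is read back as an \<open>int\<close>
      through the floor of its real part.\<close>
    have "c i = of_int (floor (Re (c i)))" for i using c(1)[of i] by (auto elim!: Ints_cases)
    then show "\<exists>c::nat \<Rightarrow> int. x ^ a = (\<Sum>i<degree p. of_int (c i) * x ^ i)"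
      using c(2) by (intro exI[of _ "\<lambda>i. floor (Re (c i))"]) (simp add: poly_monom)
  qed
qed

text \<open>Finitely many products of powers of \<open>x\<close> and \<open>y\<close> span a module
  over the integers that contains all such products; it is therefore stable under multiplication by
  \<open>x + y\<close> and by \<open>x * y\<close>.\<close>

lemma algebraic_int_plus_times:
  fixes x y :: complex
  assumes "algebraic_int x" "algebraic_int y"
  shows "algebraic_int (x + y)" "algebraic_int (x * y)"
proof -
  obtain m where m: "m > 0" "\<And>a. \<exists>c::nat \<Rightarrow> int. x ^ a = (\<Sum>i<m. of_int (c i) * x ^ i)"
    using algebraic_int_power_span[OF assms(1)] by blast
  obtain k where k: "k > 0" "\<And>a. \<exists>c::nat \<Rightarrow> int. y ^ a = (\<Sum>i<k. of_int (c i) * y ^ i)"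
    using algebraic_int_power_span[OF assms(2)] by blast
  define I where "I = {..<m} \<times> {..<k}"
  define e where "e = (\<lambda>(i, j). x ^ i * y ^ j)"
  have I: "finite I" "\<exists>i\<in>I. e i \<noteq> 0"
    using m k by (auto simp: I_def e_def intro!: bexI[of _ "(0, 0)"])
  have mon: "\<exists>c::nat \<times> nat \<Rightarrow> int. x ^ a * y ^ b = (\<Sum>j\<in>I. of_int (c j) * e j)" for a b
  proof -
    obtain c :: "nat \<Rightarrow> int" where c: "x ^ a = (\<Sum>i<m. of_int (c i) * x ^ i)" using m by blast
    obtain d :: "nat \<Rightarrow> int" where d: "y ^ b = (\<Sum>i<k. of_int (d i) * y ^ i)" using k by blast
    have "x ^ a * y ^ b = (\<Sum>j\<in>I. of_int (c (fst j) * d (snd j)) * e j)"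
      unfolding c d sum_product I_def e_def
      by (simp add: sum.cartesian_product case_prod_unfold algebra_simps)
    then show ?thesis by (intro exI[of _ "\<lambda>j. c (fst j) * d (snd j)"])
  qed
  show "algebraic_int (x + y)"
  proof (rule algebraic_int_if_module[OF I])
    fix i assume "i \<in> I"
    obtain c :: "nat \<times> nat \<Rightarrow> int" where c: "x ^ Suc (fst i) * y ^ snd i = (\<Sum>j\<in>I. of_int (c j) * e j)"
      using mon by blast
    obtain d :: "nat \<times> nat \<Rightarrow> int" where d: "x ^ fst i * y ^ Suc (snd i) = (\<Sum>j\<in>I. of_int (d j) * e j)"
      using mon by blast
    have "(x + y) * e i = x ^ Suc (fst i) * y ^ snd i + x ^ fst i * y ^ Suc (snd i)"
      by (simp add: e_def case_prod_unfold algebra_simps)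
    also have "\<dots> = (\<Sum>j\<in>I. of_int (c j + d j) * e j)"
      unfolding c d by (simp add: sum.distrib algebra_simps)
    finally show "\<exists>c::nat \<times> nat \<Rightarrow> int. (x + y) * e i = (\<Sum>j\<in>I. of_int (c j) * e j)"
      by (intro exI[of _ "\<lambda>j. c j + d j"])
  qed
  show "algebraic_int (x * y)"
  proof (rule algebraic_int_if_module[OF I])
    fix i assume "i \<in> I"
    have "x * y * e i = x ^ Suc (fst i) * y ^ Suc (snd i)"
      by (simp add: e_def case_prod_unfold algebra_simps)
    then show "\<exists>c::nat \<times> nat \<Rightarrow> int. x * y * e i = (\<Sum>j\<in>I. of_int (c j) * e j)"
      using mon by metis
  qed
qed

lemma complex_subring_algebraic_int: "complex_subring {x. algebraic_int x}"
proof -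
  have "algebraic_int (x - y)" if "algebraic_int x" "algebraic_int y" for x y :: complex
    using algebraic_int_plus_times(1)[of x "-y"] that by simp
  then show ?thesis
    by (auto simp: complex_subring_def algebraic_int_plus_times intro: int_imp_algebraic_int)
qed

lemma algebraic_imp_int_multiple:
  fixes x :: complex
  assumes "algebraic x"
  obtains D :: nat where "D \<ge> 1" "algebraic_int (of_nat D * x)"
proof -
  obtain p where p: "\<And>i. coeff p i \<in> \<int>" "p \<noteq> 0" "poly p x = 0"
    using assms unfolding algebraic_def by blast
  define n where "n = degree p"
  define a where "a = lead_coeff p"
  have a: "a \<in> \<int>" "a \<noteq> 0" using p by (auto simp: a_def)
  have n: "n > 0" using p by (auto intro!: Nat.gr0I elim!: degree_eq_zeroE simp: n_def)
  \<comment> \<open>This is \<open>a ^ (n - 1)\<close> times p(X / a): the factor makes it monic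
    with integer coefficients, and it vanishes at \<open>a * x\<close>.\<close>
  define q where "q = monom 1 n + (\<Sum>i<n. monom (coeff p i * a ^ (n - 1 - i)) i)"
  have cq: "coeff q i = (if i = n then 1 else if i < n then coeff p i * a ^ (n - 1 - i) else 0)" for i
    by (auto simp: q_def coeff_sum)
  have dq: "degree q = n"
    by (intro antisym degree_le le_degree) (auto simp: cq)
  have "poly q (a * x) = (\<Sum>i\<le>n. coeff q i * (a * x) ^ i)" by (simp add: poly_altdef dq)
  also have "\<dots> = (\<Sum>i\<le>n. a ^ (n - 1) * (coeff p i * x ^ i))"
  proof (intro sum.cong refl)
    fix i assume "i \<in> {..n}"
    show "coeff q i * (a * x) ^ i = a ^ (n - 1) * (coeff p i * x ^ i)"
    proof (cases "i = n")
      case True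
      have "a ^ n = a ^ (n - 1) * a" using n by (simp add: power_eq_if)
      then show ?thesis using True by (simp add: cq power_mult_distrib a_def n_def)
    next
      case False
      then have "i < n" using \<open>i \<in> {..n}\<close> by simp
      then have "a ^ (n - 1) = a ^ (n - 1 - i) * a ^ i" by (simp flip: power_add)
      then show ?thesis using \<open>i < n\<close> by (simp add: cq power_mult_distrib)
    qed
  qed
  also have "\<dots> = a ^ (n - 1) * poly p x" by (simp add: poly_altdef n_def sum_distrib_left)
  finally have "algebraic_int (a * x)"
    using p a by (intro algebraic_int.intros[of q]) (auto simp: cq dq)
  moreover obtain k where k: "a = of_int k" using a by (auto elim: Ints_cases)
  ultimately have "algebraic_int (of_nat (nat \<bar>k\<bar>) * x)"
    by (cases "k \<ge> 0") (auto simp: algebraic_int_minus_iff)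
  moreover have "nat \<bar>k\<bar> \<ge> 1" using a k by simp
  ultimately show ?thesis by (rule that[rotated])
qed

lemma algebraic_if_int_multiple:
  fixes x :: complex
  assumes "algebraic_int (of_nat D * x)" "D \<ge> 1"
  shows "algebraic x"
proof -
  obtain p where p: "lead_coeff p = 1" "\<forall>i. coeff p i \<in> \<int>" "poly p (of_nat D * x) = 0"
    using assms by (auto elim!: algebraic_int.cases)
  then have "p \<noteq> 0" by auto
  let ?q = "pcompose p [:0, of_nat D:]"
  show ?thesis
  proof (rule algebraicI[of ?q])
    show "coeff ?q i \<in> \<int>" for i
      using p by (intro coeff_pcompose_semiring_closed) (auto simp: coeff_pCons split: nat.splits)
    show "?q \<noteq> 0" using \<open>p \<noteq> 0\<close> assms(2) by (auto simp: pcompose_eq_0_iff)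
    show "poly ?q x = 0" using p by (simp add: poly_pcompose mult.commute)
  qed
qed

text \<open>Closure under ring operations is known for algebraic integers; multiplying by a common
  denominator carries it over.\<close>

lemma complex_subfield_algebraic: "complex_subfield {x. algebraic x}"
proof -
  note ai = complex_subringD[OF complex_subring_algebraic_int, unfolded mem_Collect_eq]
  have "algebraic (x - y) \<and> algebraic (x * y)" if xy: "algebraic x" "algebraic y" for x y :: complex
  proof -
    obtain D where D: "D \<ge> 1" "algebraic_int (of_nat D * x)" using algebraic_imp_int_multiple xy by blast
    obtain E where E: "E \<ge> 1" "algebraic_int (of_nat E * y)" using algebraic_imp_int_multiple xy by blast
    have n: "algebraic_int (of_nat k :: complex)" for k by (simp add: int_imp_algebraic_int)
    have "algebraic_int (of_nat E * (of_nat D * x) - of_nat D * (of_nat E * y))"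
      by (intro ai D E n)
    then have 1: "algebraic_int (of_nat (D * E) * (x - y))" by (simp add: algebra_simps)
    have "algebraic_int ((of_nat D * x) * (of_nat E * y))" by (intro ai D E)
    then have 2: "algebraic_int (of_nat (D * E) * (x * y))" by (simp add: algebra_simps)
    have "D * E \<ge> 1" using D E by simp
    then show ?thesis using algebraic_if_int_multiple[OF 1] algebraic_if_int_multiple[OF 2] by blast
  qed
  then show ?thesis
    by (auto simp: complex_subfield_def complex_subring_def intro: rat_imp_algebraic algebraic_inverse)
qed

section \<open>Embeddings of the algebraic numbers\<close>

text \<open>The inverse of an algebraic number is a rational polynomial in it: an equation with
  constant term \<open>c \<noteq> 0\<close> reads \<open>x * poly q x = - c\<close>. Thus rings of
  polynomial values and spans are fields as soon as they are rings.\<close>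

lemma complex_subfield_if_algebraic:
  assumes K: "complex_subring K" and "\<rat> \<subseteq> K" and alg: "\<And>x. x \<in> K \<Longrightarrow> algebraic x"
  shows "complex_subfield K"
  unfolding complex_subfield_def
proof (intro conjI ballI K)
  fix x assume x: "x \<in> K"
  show "inverse x \<in> K"
  proof (cases "x = 0")
    case False
    obtain r where "coeff r 0 \<noteq> 0" "poly (map_poly of_int r) x = 0"
      using algebraicE'_nonzero[OF alg[OF x] False] by blast
    then obtain p where p: "\<And>i. coeff p i \<in> \<int>" "coeff p 0 \<noteq> 0" "poly p x = 0"
      by (auto simp: coeff_map_poly intro: that[of "map_poly of_int r"])
    obtain c q where cq: "p = pCons c q" by (cases p)
    have q: "q \<in> polys_over \<rat>"
      using p(1)[of "Suc _"] Ints_subset_Rats by (auto simp: cq polys_over_def)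
    have "c \<in> \<rat>" "c \<noteq> 0" using p(1)[of 0] p(2) Ints_subset_Rats by (auto simp: cq)
    have "x * poly q x = - c" using p(3) by (simp add: cq add_eq_0_iff)
    then have "inverse x = - inverse c * poly q x"
      using False \<open>c \<noteq> 0\<close> by (simp add: field_simps)
    moreover have "poly q x \<in> K"
      using poly_in_subring[OF K _ x] polys_over_mono[OF assms(2)] q by blast
    moreover have "- inverse c \<in> K"
      using \<open>c \<in> \<rat>\<close> assms(2) by auto
    ultimately show ?thesis using complex_subringD(6)[OF K, of "- inverse c" "poly q x"] by metis
  qed (use complex_subringD(1)[OF K] in simp)
qed

text \<open>Least degree takes the place of irreducibility: divisibility and the simplicity of roots
  are both derived from it.\<close>

definition is_min_poly :: "complex set \<Rightarrow> complex \<Rightarrow> complex poly \<Rightarrow> bool" where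
  "is_min_poly F a p \<longleftrightarrow> p \<in> polys_over F \<and> lead_coeff p = 1 \<and> poly p a = 0 \<and>
     (\<forall>q\<in>polys_over F. poly q a = 0 \<longrightarrow> q \<noteq> 0 \<longrightarrow> degree p \<le> degree q)"

lemma is_min_poly_exists:
  assumes F: "complex_subfield F" and "q \<in> polys_over F" "q \<noteq> 0" "poly q a = 0"
  obtains p where "is_min_poly F a p"
proof -
  let ?P = "\<lambda>p. p \<in> polys_over F \<and> p \<noteq> 0 \<and> poly p a = 0"
  obtain p where p: "?P p" and least: "\<And>q. ?P q \<Longrightarrow> degree p \<le> degree q"
    using ex_has_least_nat[of ?P q degree] assms by blast
  let ?p = "smult (inverse (lead_coeff p)) p"
  have "?p \<in> polys_over F"
    using p F by (intro polys_over_closed complex_subfield_imp_subring complex_subfieldD(7)) (auto intro: coeff_polys_over)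
  then have "is_min_poly F a ?p"
    using p least by (auto simp: is_min_poly_def)
  then show ?thesis by (rule that)
qed

lemma algebraic_is_min_poly_exists:
  assumes F: "complex_subfield F" and "algebraic a"
  obtains p where "is_min_poly F a p"
proof -
  obtain q where "\<forall>i. coeff q i \<in> \<int>" "q \<noteq> 0" "poly q a = 0"
    using assms(2) unfolding algebraic_def by blast
  moreover from this have "q \<in> polys_over F"
    using Rats_subset_complex_subfield[OF F] Ints_subset_Rats by (auto simp: polys_over_def)
  ultimately show ?thesis using is_min_poly_exists[OF F] that by blast
qed

lemma is_min_poly_degree_pos: "is_min_poly F a p \<Longrightarrow> degree p > 0"
  by (auto simp: is_min_poly_def intro!: Nat.gr0I elim!: degree_eq_zeroE)

lemma is_min_poly_dvd:
  assumes F: "complex_subfield F" and p: "is_min_poly F a p" and q: "q \<in> polys_over F" "poly q a = 0"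
  shows "\<exists>h\<in>polys_over F. q = h * p"
proof -
  note F' = complex_subfield_imp_subring[OF F]
  obtain h r where hr: "h \<in> polys_over F" "r \<in> polys_over F" "q = h * p + r" "r = 0 \<or> degree r < degree p"
    using polys_over_monic_div[OF F', of p q] p q(1) unfolding is_min_poly_def by blast
  have "poly r a = 0" using q(2) p by (simp add: hr(3) is_min_poly_def)
  then have "r = 0" using hr p unfolding is_min_poly_def by (meson not_less)
  then show ?thesis using hr by auto
qed

text \<open>Partial homomorphisms are total functions that are constrained on \<open>D\<close> only;
  on a subfield, zero, negatives and inverses are preserved as a consequence.\<close>

definition hom_on :: "complex set \<Rightarrow> (complex \<Rightarrow> complex) \<Rightarrow> bool" where
  "hom_on D s \<longleftrightarrow> s 1 = 1 \<and> (\<forall>x\<in>D. \<forall>y\<in>D. s (x + y) = s x + s y \<and> s (x * y) = s x * s y)"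

lemma hom_on_simps:
  assumes D: "complex_subfield D" and s: "hom_on D s"
  shows "s 0 = 0" "s 1 = 1" "x \<in> D \<Longrightarrow> y \<in> D \<Longrightarrow> s (x + y) = s x + s y"
    "x \<in> D \<Longrightarrow> y \<in> D \<Longrightarrow> s (x * y) = s x * s y" "x \<in> D \<Longrightarrow> s (- x) = - s x"
    "x \<in> D \<Longrightarrow> y \<in> D \<Longrightarrow> s (x - y) = s x - s y"
    "x \<in> D \<Longrightarrow> s (inverse x) = inverse (s x)" "x \<in> D \<Longrightarrow> y \<in> D \<Longrightarrow> s (x / y) = s x / s y"
    "x \<in> D \<Longrightarrow> s x = 0 \<longleftrightarrow> x = 0" "x \<in> D \<Longrightarrow> s (x ^ n) = s x ^ n"
    "x \<in> D \<Longrightarrow> s (x powi k) = s x powi k"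
proof -
  note d = complex_subfieldD[OF D]
  show one: "s 1 = 1" using s by (simp add: hom_on_def)
  show add: "s (x + y) = s x + s y" if "x \<in> D" "y \<in> D" for x y using s that by (simp add: hom_on_def)
  show mult: "s (x * y) = s x * s y" if "x \<in> D" "y \<in> D" for x y using s that by (simp add: hom_on_def)
  show zero: "s 0 = 0" using add[OF d(1) d(1)] by simp
  show minus: "s (- x) = - s x" if "x \<in> D" for x
    using add[OF that d(4)[OF that]] zero by (simp add: eq_neg_iff_add_eq_0 add.commute)
  show "s (x - y) = s x - s y" if "x \<in> D" "y \<in> D" for x y
    using add[OF that(1) d(4)[OF that(2)]] minus[OF that(2)] by simp
  have inv1: "s x * s (inverse x) = 1" if "x \<in> D" "x \<noteq> 0" for x
    using mult[OF that(1) d(7)[OF that(1)]] one that(2) by simp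
  show inv: "s (inverse x) = inverse (s x)" if "x \<in> D" for x
    using inv1[OF that] zero by (cases "x = 0") (auto intro: inverse_unique[symmetric])
  show "s (x / y) = s x / s y" if "x \<in> D" "y \<in> D" for x y
    using mult[OF that(1) d(7)[OF that(2)]] inv[OF that(2)] by (simp add: divide_inverse)
  show "s x = 0 \<longleftrightarrow> x = 0" if "x \<in> D" for x
    using inv1[OF that] zero by (cases "x = 0") auto
  show pow: "s (x ^ n) = s x ^ n" if "x \<in> D" for x n
    using complex_subring_power[OF complex_subfield_imp_subring[OF D] that] that
    by (induction n) (simp_all add: one mult)
  show "s (x powi k) = s x powi k" if "x \<in> D" for x
    unfolding power_int_def by (simp add: pow that d(7) inv)
qed

lemma hom_on_sum:
  assumes D: "complex_subfield D" and s: "hom_on D s" and "\<And>i. i \<in> I \<Longrightarrow> f i \<in> D"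
  shows "s (sum f I) = (\<Sum>i\<in>I. s (f i))"
  using assms(3)
proof (induction I rule: infinite_finite_induct)
  case (insert i I)
  have "sum f I \<in> D"
    using insert.prems by (intro complex_subring_sum complex_subfield_imp_subring[OF D]) auto
  then show ?case using insert by (simp add: hom_on_simps[OF D s])
qed (simp_all add: hom_on_simps[OF D s])

lemma hom_on_prod:
  assumes D: "complex_subfield D" and s: "hom_on D s" and "\<And>i. i \<in> I \<Longrightarrow> f i \<in> D"
  shows "s (prod f I) = (\<Prod>i\<in>I. s (f i))"
  using assms(3)
proof (induction I rule: infinite_finite_induct)
  case (insert i I)
  have "prod f I \<in> D"
    using insert.prems by (intro complex_subring_prod complex_subfield_imp_subring[OF D]) auto
  then show ?case using insert by (simp add: hom_on_simps[OF D s])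
qed (simp_all add: hom_on_simps[OF D s])

lemma hom_on_Rats:
  assumes D: "complex_subfield D" and s: "hom_on D s" and "x \<in> \<rat>"
  shows "s x = x"
proof -
  note [simp] = hom_on_simps[OF D s]
  note D' = complex_subfield_imp_subring[OF D]
  have nat: "s (of_nat n) = of_nat n" for n
    by (induction n) (use complex_subring_of_int[OF D', of "int _"] complex_subfieldD(2)[OF D] in auto)
  have int: "s (of_int k) = of_int k" for k
    by (cases k rule: int_cases2) (use nat complex_subring_of_int[OF D', of "int _"] in auto)
  obtain a b where "x = of_int a / of_int b" using assms(3) by (auto elim: Rats_cases')
  then show ?thesis using int complex_subring_of_int[OF D'] by simp
qed

lemma map_poly_hom_on:
  assumes D: "complex_subfield D" and s: "hom_on D s" and p: "p \<in> polys_over D"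
  shows "q \<in> polys_over D \<Longrightarrow> map_poly s (p + q) = map_poly s p + map_poly s q"
    "q \<in> polys_over D \<Longrightarrow> map_poly s (p - q) = map_poly s p - map_poly s q"
    "q \<in> polys_over D \<Longrightarrow> map_poly s (p * q) = map_poly s p * map_poly s q"
    "x \<in> D \<Longrightarrow> poly (map_poly s p) (s x) = s (poly p x)"
    "degree (map_poly s p) = degree p" "lead_coeff p = 1 \<Longrightarrow> lead_coeff (map_poly s p) = 1"
proof -
  note [simp] = hom_on_simps[OF D s] coeff_polys_over[OF p]
  note cf = coeff_polys_over
  have m: "x * y \<in> D" if "x \<in> D" "y \<in> D" for x y using complex_subfieldD(6)[OF D] that .
  show "map_poly s (p + q) = map_poly s p + map_poly s q" if "q \<in> polys_over D"
    using cf[OF that] by (intro poly_eqI) (simp add: coeff_map_poly)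
  show "map_poly s (p - q) = map_poly s p - map_poly s q" if "q \<in> polys_over D"
    using cf[OF that] by (intro poly_eqI) (simp add: coeff_map_poly)
  show "map_poly s (p * q) = map_poly s p * map_poly s q" if "q \<in> polys_over D"
    using cf[OF that] by (intro poly_eqI) (simp add: coeff_map_poly coeff_mult hom_on_sum[OF D s] m)
  show deg: "degree (map_poly s p) = degree p"
    by (intro degree_map_poly) auto
  show "lead_coeff p = 1 \<Longrightarrow> lead_coeff (map_poly s p) = 1"
    by (simp add: deg coeff_map_poly)
  show "poly (map_poly s p) (s x) = s (poly p x)" if x: "x \<in> D"
    using complex_subring_power[OF complex_subfield_imp_subring[OF D] x] x
    by (simp add: poly_altdef deg coeff_map_poly hom_on_sum[OF D s] m)
qed

lemma map_poly_fixes: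
  assumes "\<And>x. x \<in> D \<Longrightarrow> s x = x" "s 0 = 0" "p \<in> polys_over D"
  shows "map_poly s p = p"
  using assms by (intro poly_eqI) (auto simp: coeff_map_poly polys_over_def)

text \<open>The simple extension D[a]; for algebraic \<open>a\<close> over a field of algebraic
  numbers it is already the field D(a).\<close>

definition adjoin :: "complex set \<Rightarrow> complex \<Rightarrow> complex set" where
  "adjoin D a = (\<lambda>q. poly q a) ` polys_over D"

lemma adjoin_props:
  assumes D: "complex_subfield D" and alg: "\<And>x. x \<in> D \<Longrightarrow> algebraic x" and a: "algebraic a"
  shows "complex_subfield (adjoin D a)" "D \<subseteq> adjoin D a" "a \<in> adjoin D a"
    "x \<in> adjoin D a \<Longrightarrow> algebraic x"
proof -
  note D' = complex_subfield_imp_subring[OF D]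
  note c = polys_over_closed[OF D']
  show incl: "D \<subseteq> adjoin D a"
  proof
    fix x assume "x \<in> D"
    then show "x \<in> adjoin D a" unfolding adjoin_def by (intro image_eqI[of _ _ "[:x:]"] c) auto
  qed
  show "a \<in> adjoin D a"
    unfolding adjoin_def using complex_subfieldD(1,2)[OF D] by (intro image_eqI[of _ _ "[:0, 1:]"] c) auto
  show alg': "algebraic x" if x: "x \<in> adjoin D a" for x
  proof -
    obtain q where q: "q \<in> polys_over D" "x = poly q a" using x by (auto simp: adjoin_def)
    have "poly q a \<in> {x. algebraic x}"
      by (rule poly_in_subring[OF complex_subfield_imp_subring[OF complex_subfield_algebraic]])
        (use q alg a in \<open>auto simp: polys_over_def\<close>)
    then show ?thesis using q by simp
  qed
  have "complex_subring (adjoin D a)"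
    unfolding complex_subring_def
  proof (intro conjI ballI)
    show "1 \<in> adjoin D a" using incl complex_subfieldD(2)[OF D] by auto
    fix x y assume "x \<in> adjoin D a" "y \<in> adjoin D a"
    then obtain p q where pq: "p \<in> polys_over D" "q \<in> polys_over D" "x = poly p a" "y = poly q a"
      by (auto simp: adjoin_def)
    show "x - y \<in> adjoin D a" unfolding adjoin_def
      by (rule image_eqI[of _ _ "p - q"]) (use pq c in auto)
    show "x * y \<in> adjoin D a" unfolding adjoin_def
      by (rule image_eqI[of _ _ "p * q"]) (use pq c in auto)
  qed
  then show "complex_subfield (adjoin D a)"
    using incl Rats_subset_complex_subfield[OF D] alg' by (intro complex_subfield_if_algebraic) auto
qed

text \<open>Sending the value of \<open>q\<close> at \<open>a\<close> to the value of
  \<open>map_poly s q\<close> at \<open>b\<close> is well defined: two polynomials with the same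
  value at \<open>a\<close> differ by a multiple of \<open>p\<close>, and the image of
  \<open>p\<close> vanishes at \<open>b\<close>.\<close>

lemma hom_on_extend_adjoin:
  assumes D: "complex_subfield D" and s: "hom_on D s"
    and p: "is_min_poly D a p" and b: "poly (map_poly s p) b = 0"
  obtains t where "hom_on (adjoin D a) t" "\<And>x. x \<in> D \<Longrightarrow> t x = s x" "t a = b"
proof -
  note D' = complex_subfield_imp_subring[OF D]
  note c = polys_over_closed[OF D']
  note hs = hom_on_simps[OF D s]
  note mp = map_poly_hom_on[OF D s]
  define t where "t x = poly (map_poly s (SOME q. q \<in> polys_over D \<and> poly q a = x)) b" for x
  have t: "t (poly q a) = poly (map_poly s q) b" if q: "q \<in> polys_over D" for q
  proof -
    define q' where "q' = (SOME r. r \<in> polys_over D \<and> poly r a = poly q a)"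
    have q': "q' \<in> polys_over D" "poly q' a = poly q a"
      using someI[of "\<lambda>r. r \<in> polys_over D \<and> poly r a = poly q a" q] q unfolding q'_def by auto
    have "q - q' \<in> polys_over D" "poly (q - q') a = 0" using q q' c by auto
    then obtain h where h: "h \<in> polys_over D" "q - q' = h * p"
      using is_min_poly_dvd[OF D p] by blast
    have "map_poly s q - map_poly s q' = map_poly s h * map_poly s p"
      using mp(2)[OF q q'(1)] mp(3)[OF h(1), of p] p h(2) by (simp add: is_min_poly_def)
    then have "poly (map_poly s q) b - poly (map_poly s q') b = 0"
      using b by (metis poly_diff poly_mult mult_zero_right)
    then show ?thesis by (simp add: t_def q'_def)
  qed
  show ?thesis
  proof
    show "t x = s x" if "x \<in> D" for x
    proof -
      have "map_poly s [:x:] = [:s x:]"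
        by (rule poly_eqI) (simp add: coeff_map_poly coeff_pCons hs split: nat.split)
      then show ?thesis using t[of "[:x:]"] that c(1,9) by simp
    qed
    then show "hom_on (adjoin D a) t"
      unfolding hom_on_def
    proof (intro conjI ballI)
      fix x y assume "x \<in> adjoin D a" "y \<in> adjoin D a"
      then obtain u v where uv: "u \<in> polys_over D" "v \<in> polys_over D" "x = poly u a" "y = poly v a"
        by (auto simp: adjoin_def)
      show "t (x + y) = t x + t y" using t[OF c(3)[OF uv(1,2)]] t uv mp(1) by simp
      show "t (x * y) = t x * t y" using t[OF c(5)[OF uv(1,2)]] t uv mp(3) by simp
    qed (use hs(2) complex_subfieldD(2)[OF D] in auto)
    show "t a = b"
    proof -
      have "map_poly s [:0, 1:] = [:0, 1:]"
        by (rule poly_eqI) (simp add: coeff_map_poly coeff_pCons hs split: nat.split)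
      then show ?thesis using t[of "[:0, 1:]"] c(1,9) complex_subfieldD(1,2)[OF D] by simp
    qed
  qed
qed

text \<open>Partial homomorphisms are encoded by their graphs, so that unions of chains are immediate.\<close>

definition hom_graph :: "(complex \<times> complex) set \<Rightarrow> bool" where
  "hom_graph R \<longleftrightarrow> (1, 1) \<in> R \<and> (\<forall>x y. (x, y) \<in> R \<longrightarrow> algebraic x \<and> (inverse x, inverse y) \<in> R)
     \<and> (\<forall>y. (0, y) \<in> R \<longrightarrow> y = 0)
     \<and> (\<forall>x y x' y'. (x, y) \<in> R \<longrightarrow> (x', y') \<in> R \<longrightarrow> (x - x', y - y') \<in> R \<and> (x * x', y * y') \<in> R)"

lemma hom_graph_of_hom_on:
  assumes D: "complex_subfield D" "\<And>x. x \<in> D \<Longrightarrow> algebraic x" and s: "hom_on D s"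
  shows "hom_graph ((\<lambda>x. (x, s x)) ` D)"
proof -
  note h = hom_on_simps[OF D(1) s] and c = complex_subfieldD[OF D(1)]
  have eq: "(x, y) \<in> (\<lambda>x. (x, s x)) ` D \<longleftrightarrow> x \<in> D \<and> y = s x" for x y by auto
  show ?thesis
    unfolding hom_graph_def eq by (simp add: D(2) h c)
qed

lemma hom_on_of_hom_graph:
  assumes R: "hom_graph R"
  obtains s where "complex_subfield (Domain R)" "hom_on (Domain R) s" "R = (\<lambda>x. (x, s x)) ` Domain R"
proof -
  have one: "(1, 1) \<in> R" and zero: "\<And>y. (0, y) \<in> R \<Longrightarrow> y = 0"
    and inv: "\<And>x y. (x, y) \<in> R \<Longrightarrow> (inverse x, inverse y) \<in> R"
    and diff: "\<And>x y x' y'. (x, y) \<in> R \<Longrightarrow> (x', y') \<in> R \<Longrightarrow> (x - x', y - y') \<in> R"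
    and mult: "\<And>x y x' y'. (x, y) \<in> R \<Longrightarrow> (x', y') \<in> R \<Longrightarrow> (x * x', y * y') \<in> R"
    using R unfolding hom_graph_def by blast+
  \<comment> \<open>The clause on pairs \<open>(0, y)\<close> is what makes the relation
    single-valued: it applies to the difference of the two pairs.\<close>
  have fn: "y = z" if "(x, y) \<in> R" "(x, z) \<in> R" for x y z
    using zero[of "y - z"] diff[OF that] by simp
  obtain s where s: "\<And>x. x \<in> Domain R \<Longrightarrow> (x, s x) \<in> R"
    using bchoice[of "Domain R" "\<lambda>x y. (x, y) \<in> R"] by blast
  then have s_eq: "s x = y" if "(x, y) \<in> R" for x y using fn that by blast
  have add: "(x + x', y + y') \<in> R" if "(x, y) \<in> R" "(x', y') \<in> R" for x y x' y'
    using diff[OF that(1) diff[OF diff[OF one one] that(2)]] by simp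
  show ?thesis
  proof
    show "complex_subfield (Domain R)"
      unfolding complex_subfield_def complex_subring_def
    proof (intro conjI ballI)
      show "1 \<in> Domain R" using one by (rule DomainI)
      fix x assume x: "x \<in> Domain R"
      show "inverse x \<in> Domain R" using inv[OF s[OF x]] by (rule DomainI)
      fix y assume y: "y \<in> Domain R"
      show "x - y \<in> Domain R" using diff[OF s[OF x] s[OF y]] by (rule DomainI)
      show "x * y \<in> Domain R" using mult[OF s[OF x] s[OF y]] by (rule DomainI)
    qed
    show "hom_on (Domain R) s"
      unfolding hom_on_def using s_eq[OF one] s_eq[OF add[OF s s]] s_eq[OF mult[OF s s]] by blast
    show "R = (\<lambda>x. (x, s x)) ` Domain R"
      using s s_eq by force
  qed
qed

text \<open>By Zorn's lemma there is a maximal extension. If \<open>a\<close> were outside its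
  domain, the image of the minimal polynomial of \<open>a\<close> would still have a complex root,
  and sending \<open>a\<close> to it would extend the map further.\<close>

theorem hom_on_extend_algebraic:
  assumes D: "complex_subfield D" "\<And>x. x \<in> D \<Longrightarrow> algebraic x" and s: "hom_on D s"
  obtains t where "hom_on {x. algebraic x} t" "\<And>x. x \<in> D \<Longrightarrow> t x = s x"
proof -
  define R0 where "R0 = (\<lambda>x. (x, s x)) ` D"
  define A where "A = {R. hom_graph R \<and> R0 \<subseteq> R}"
  have "R0 \<in> A" using hom_graph_of_hom_on[OF assms] by (simp add: A_def R0_def)
  moreover have "\<Union>C \<in> A" if C: "C \<noteq> {}" "subset.chain A C" for C
  proof -
    have CA: "C \<subseteq> A" and ch: "\<And>U V. U \<in> C \<Longrightarrow> V \<in> C \<Longrightarrow> U \<subseteq> V \<or> V \<subseteq> U"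
      using C(2) by (auto simp: subset_chain_def)
    have two: "\<exists>U\<in>C. u \<in> U \<and> v \<in> U" if "u \<in> \<Union>C" "v \<in> \<Union>C" for u v
      using that ch by blast
    obtain U0 where "U0 \<in> C" using C(1) by blast
    have g: "hom_graph U" if "U \<in> C" for U using CA that by (auto simp: A_def)
    have "hom_graph (\<Union>C)"
      unfolding hom_graph_def
    proof (intro conjI allI impI)
      show "(1, 1) \<in> \<Union>C" using g[OF \<open>U0 \<in> C\<close>] \<open>U0 \<in> C\<close> by (auto simp: hom_graph_def)
    next
      fix x y assume "(x, y) \<in> \<Union>C"
      then show "algebraic x" "(inverse x, inverse y) \<in> \<Union>C" using g unfolding hom_graph_def by blast+
    next
      fix y assume "(0, y) \<in> \<Union>C"
      then show "y = 0" using g unfolding hom_graph_def by blast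
    next
      fix x y x' y' assume "(x, y) \<in> \<Union>C" "(x', y') \<in> \<Union>C"
      then obtain U where "U \<in> C" "(x, y) \<in> U" "(x', y') \<in> U" using two by blast
      then show "(x - x', y - y') \<in> \<Union>C" "(x * x', y * y') \<in> \<Union>C"
        using g unfolding hom_graph_def by blast+
    qed
    moreover have "R0 \<subseteq> \<Union>C" using CA \<open>U0 \<in> C\<close> by (auto simp: A_def)
    ultimately show ?thesis by (simp add: A_def)
  qed
  ultimately obtain M where M: "M \<in> A" and max: "\<And>U. U \<in> A \<Longrightarrow> M \<subseteq> U \<Longrightarrow> U = M"
    using subset_Zorn_nonempty[of A] by blast
  obtain t where t: "complex_subfield (Domain M)" "hom_on (Domain M) t" "M = (\<lambda>x. (x, t x)) ` Domain M"
    using hom_on_of_hom_graph[of M] M by (auto simp: A_def)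
  have alg: "algebraic x" if "x \<in> Domain M" for x using M that by (auto simp: A_def hom_graph_def)
  have "a \<in> Domain M" if a: "algebraic a" for a
  proof -
    obtain p where p: "is_min_poly (Domain M) a p" using algebraic_is_min_poly_exists[OF t(1) a] .
    then have pM: "p \<in> polys_over (Domain M)" by (simp add: is_min_poly_def)
    have "degree (map_poly t p) > 0"
      using is_min_poly_degree_pos[OF p] map_poly_hom_on(5)[OF t(1,2) pM] by simp
    then obtain b where b: "poly (map_poly t p) b = 0"
      using fundamental_theorem_of_algebra[of "map_poly t p"] constant_degree[of "map_poly t p"] by auto
    obtain u where u: "hom_on (adjoin (Domain M) a) u" "\<And>x. x \<in> Domain M \<Longrightarrow> u x = t x"
      using hom_on_extend_adjoin[OF t(1,2) p b] by blast
    have adj: "complex_subfield (adjoin (Domain M) a)" "Domain M \<subseteq> adjoin (Domain M) a"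
        "a \<in> adjoin (Domain M) a" "\<And>x. x \<in> adjoin (Domain M) a \<Longrightarrow> algebraic x"
      using adjoin_props[OF t(1) _ a] alg by blast+
    define U where "U = (\<lambda>x. (x, u x)) ` adjoin (Domain M) a"
    have "hom_graph U" unfolding U_def using hom_graph_of_hom_on[OF adj(1) _ u(1)] adj(4) by blast
    moreover have "M \<subseteq> U"
    proof
      fix z assume "z \<in> M"
      then obtain x where "x \<in> Domain M" "z = (x, t x)" using t(3) by blast
      then show "z \<in> U" unfolding U_def using adj(2) u(2) by (intro image_eqI[of _ _ x]) auto
    qed
    ultimately have "U = M" using max M by (auto simp: A_def)
    then show ?thesis using adj(3) by (auto simp: U_def)
  qed
  then have dom: "Domain M = {x. algebraic x}" using alg by auto
  show ?thesis
  proof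
    show "hom_on {x. algebraic x} t" using t(2) dom by simp
    show "t x = s x" if "x \<in> D" for x
    proof -
      have "(x, s x) \<in> M" using M that by (auto simp: A_def R0_def)
      then show ?thesis by (subst (asm) t(3)) auto
    qed
  qed
qed

text \<open>These maps play the role of the absolute Galois group of \<open>F\<close>. That they map
  algebraic numbers to algebraic numbers, so that they can be composed, is derived in
  \<open>embeddings_algebraic\<close>.\<close>

definition embeddings :: "complex set \<Rightarrow> (complex \<Rightarrow> complex) set" where
  "embeddings F = {s. hom_on {x. algebraic x} s \<and> (\<forall>x\<in>F. s x = x)}"

lemma embeddings_mono: "F \<subseteq> F' \<Longrightarrow> embeddings F' \<subseteq> embeddings F"
  by (auto simp: embeddings_def)

lemmas algebraic_closed = complex_subfieldD[OF complex_subfield_algebraic, unfolded mem_Collect_eq]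

lemma embeddings_simps:
  assumes "s \<in> embeddings F"
  shows "s 0 = 0" "s 1 = 1" "algebraic x \<Longrightarrow> algebraic y \<Longrightarrow> s (x + y) = s x + s y"
    "algebraic x \<Longrightarrow> algebraic y \<Longrightarrow> s (x * y) = s x * s y" "algebraic x \<Longrightarrow> s (- x) = - s x"
    "algebraic x \<Longrightarrow> algebraic y \<Longrightarrow> s (x - y) = s x - s y"
    "algebraic x \<Longrightarrow> s (inverse x) = inverse (s x)"
    "algebraic x \<Longrightarrow> algebraic y \<Longrightarrow> s (x / y) = s x / s y"
    "algebraic x \<Longrightarrow> s x = 0 \<longleftrightarrow> x = 0" "algebraic x \<Longrightarrow> s (x ^ n) = s x ^ n"
    "algebraic x \<Longrightarrow> s (x powi k) = s x powi k" "x \<in> F \<Longrightarrow> s x = x" "x \<in> \<rat> \<Longrightarrow> s x = x"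
  using assms hom_on_simps[OF complex_subfield_algebraic, of s] hom_on_Rats[OF complex_subfield_algebraic, of s]
  by (auto simp: embeddings_def)

lemma embeddings_root:
  assumes F: "complex_subfield F" "\<And>x. x \<in> F \<Longrightarrow> algebraic x" and s: "s \<in> embeddings F"
    and p: "p \<in> polys_over F" and x: "algebraic x" "poly p x = 0"
  shows "poly p (s x) = 0"
proof -
  have s': "hom_on {x. algebraic x} s" using s by (simp add: embeddings_def)
  have "p \<in> polys_over {x. algebraic x}" using p F(2) by (auto simp: polys_over_def)
  from map_poly_hom_on(4)[OF complex_subfield_algebraic s' this, of x] x
  have "poly (map_poly s p) (s x) = 0" by (simp add: embeddings_simps(1)[OF s])
  moreover have "map_poly s p = p"
    by (rule map_poly_fixes[OF _ _ p]) (use embeddings_simps[OF s] in auto)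
  ultimately show ?thesis by simp
qed

lemma embeddings_algebraic:
  assumes s: "s \<in> embeddings F" and x: "algebraic x"
  shows "algebraic (s x)"
proof -
  obtain p where p: "\<forall>i. coeff p i \<in> \<int>" "p \<noteq> 0" "poly p x = 0"
    using x unfolding algebraic_def by blast
  have "s \<in> embeddings \<rat>" using s embeddings_simps(13)[OF s] by (auto simp: embeddings_def)
  moreover have "p \<in> polys_over \<rat>" using p(1) Ints_subset_Rats by (auto simp: polys_over_def)
  ultimately have "poly p (s x) = 0"
    using embeddings_root[OF complex_subfield_Rats rat_imp_algebraic _ _ x p(3)] by blast
  then show ?thesis using p algebraic_def by blast
qed

lemma embeddings_transitive:
  assumes F: "complex_subfield F" "\<And>x. x \<in> F \<Longrightarrow> algebraic x"
    and a: "algebraic a" and p: "is_min_poly F a p" and b: "poly p b = 0"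
  obtains s where "s \<in> embeddings F" "s a = b"
proof -
  have id: "hom_on F id" by (simp add: hom_on_def)
  have "poly (map_poly id p) b = 0" using b by (simp add: map_poly_id)
  then obtain t where t: "hom_on (adjoin F a) t" "\<And>x. x \<in> F \<Longrightarrow> t x = id x" "t a = b"
    using hom_on_extend_adjoin[OF F(1) id p] by blast
  have adj: "complex_subfield (adjoin F a)" "F \<subseteq> adjoin F a"
      "a \<in> adjoin F a" "\<And>x. x \<in> adjoin F a \<Longrightarrow> algebraic x"
    using adjoin_props[OF F(1) _ a] F(2) by blast+
  obtain u where u: "hom_on {x. algebraic x} u" "\<And>x. x \<in> adjoin F a \<Longrightarrow> u x = t x"
    using hom_on_extend_algebraic[OF adj(1) _ t(1)] adj(4) by blast
  show ?thesis
    by (rule that[of u]) (use u t adj in \<open>auto simp: embeddings_def\<close>)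
qed

text \<open>Any root \<open>b\<close> of the cofactor \<open>q\<close> is the image of
  \<open>a\<close> under some embedding, hence equals \<open>a\<close>, and \<open>a\<close> is a
  double root of \<open>p\<close>. Then the derivative vanishes at \<open>a\<close> and has smaller
  degree, against minimality; so \<open>q\<close> is constant and \<open>p\<close> is
  linear.\<close>

theorem fixed_by_embeddings:
  assumes F: "complex_subfield F" "\<And>x. x \<in> F \<Longrightarrow> algebraic x"
    and a: "algebraic a" and inv: "\<And>s. s \<in> embeddings F \<Longrightarrow> s a = a"
  shows "a \<in> F"
proof -
  note F' = complex_subfield_imp_subring[OF F(1)]
  obtain p where p: "is_min_poly F a p" using algebraic_is_min_poly_exists[OF F(1) a] .
  then have p': "p \<in> polys_over F" "lead_coeff p = 1" "poly p a = 0" by (auto simp: is_min_poly_def)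
  then obtain q where q: "p = [:- a, 1:] * q" by (auto simp: poly_eq_0_iff_dvd)
  have "q \<noteq> 0" using p'(2) q by auto
  have dp: "degree p = Suc (degree q)"
    using \<open>q \<noteq> 0\<close> unfolding q by (subst degree_mult_eq) auto
  have "degree q = 0"
  proof (rule ccontr)
    assume "degree q \<noteq> 0"
    then obtain b where b: "poly q b = 0"
      using fundamental_theorem_of_algebra[of q] constant_degree[of q] by auto
    then obtain s where "s \<in> embeddings F" "s a = b"
      using embeddings_transitive[OF F a p, of b] by (auto simp: q)
    then have "b = a" using inv by metis
    then have "poly (pderiv p) a = 0"
      unfolding q pderiv_mult using b by (simp add: pderiv_pCons)
    moreover have "pderiv p \<noteq> 0" using dp by (simp add: pderiv_eq_0_iff)
    moreover have "pderiv p \<in> polys_over F" by (rule polys_over_closed(10)[OF F' p'(1)])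
    ultimately have "degree p \<le> degree (pderiv p)" using p unfolding is_min_poly_def by blast
    then show False using dp by (simp add: degree_pderiv)
  qed
  then obtain c where c: "q = [:c:]" by (auto elim: degree_eq_zeroE)
  have "c = 1" using p'(2) dp \<open>degree q = 0\<close> by (simp add: q c)
  then have "- a \<in> F" using coeff_polys_over[OF p'(1), of 0] by (simp add: q c)
  then show ?thesis using complex_subfieldD(4)[OF F(1), of "- a"] by simp
qed

section \<open>Saturation in number fields\<close>

text \<open>The multiplicative group generated by a finite set of nonzero numbers, written with one
  exponent vector so that exponents can be reduced all at once. For the empty set it is the trivial
  group.\<close>

definition mult_gen :: "complex set \<Rightarrow> complex set" where
  "mult_gen B = range (\<lambda>k::complex \<Rightarrow> int. \<Prod>b\<in>B. b powi k b)"

lemma mult_gen_closed: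
  assumes "finite B" "0 \<notin> B"
  shows "1 \<in> mult_gen B" "x \<in> mult_gen B \<Longrightarrow> y \<in> mult_gen B \<Longrightarrow> x * y \<in> mult_gen B"
    "x \<in> mult_gen B \<Longrightarrow> x powi n \<in> mult_gen B" "x \<in> mult_gen B \<Longrightarrow> x ^ m \<in> mult_gen B"
    "x \<in> mult_gen B \<Longrightarrow> inverse x \<in> mult_gen B" "x \<in> mult_gen B \<Longrightarrow> x \<noteq> 0"
    "x \<in> mult_gen B \<Longrightarrow> y \<in> mult_gen B \<Longrightarrow> x / y \<in> mult_gen B"
    "b \<in> B \<Longrightarrow> b \<in> mult_gen B"
proof -
  have nz: "b \<noteq> 0" if "b \<in> B" for b using that assms by auto
  show "1 \<in> mult_gen B" unfolding mult_gen_def by (rule range_eqI[of _ _ "\<lambda>_. 0"]) simp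
  show m: "x * y \<in> mult_gen B" if xy: "x \<in> mult_gen B" "y \<in> mult_gen B" for x y
  proof -
    obtain k l where kl: "x = (\<Prod>b\<in>B. b powi k b)" "y = (\<Prod>b\<in>B. b powi l b)"
      using xy unfolding mult_gen_def by blast
    have "x * y = (\<Prod>b\<in>B. b powi (k b + l b))"
      unfolding kl prod.distrib[symmetric] using nz by (intro prod.cong) (auto simp: power_int_add)
    then show ?thesis unfolding mult_gen_def by (intro range_eqI[of _ _ "\<lambda>b. k b + l b"])
  qed
  show p: "x powi n \<in> mult_gen B" if x: "x \<in> mult_gen B" for x n
  proof -
    obtain k where k: "x = (\<Prod>b\<in>B. b powi k b)" using x unfolding mult_gen_def by blast
    have "x powi n = (\<Prod>b\<in>B. b powi (k b * n))"
      unfolding k using assms(1) by (induction B rule: finite_induct) (auto simp: power_int_mult_distrib power_int_mult)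
    then show ?thesis unfolding mult_gen_def by (intro range_eqI[of _ _ "\<lambda>b. k b * n"])
  qed
  show "x ^ m \<in> mult_gen B" if "x \<in> mult_gen B" for x m using p[OF that, of "int m"] by simp
  show i: "inverse x \<in> mult_gen B" if "x \<in> mult_gen B" for x using p[OF that, of "-1"] by (simp add: power_int_minus)
  show "x \<in> mult_gen B \<Longrightarrow> x \<noteq> 0" using nz assms(1) by (auto simp: mult_gen_def)
  show "x / y \<in> mult_gen B" if "x \<in> mult_gen B" "y \<in> mult_gen B"
    using m[OF that(1) i[OF that(2)]] by (simp add: divide_inverse)
  show "b \<in> mult_gen B" if "b \<in> B"
  proof -
    have "(\<Prod>c\<in>B. c powi (if c = b then 1 else 0)) = (\<Prod>c\<in>B. if c = b then c else 1)"
      by (intro prod.cong) auto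
    also have "\<dots> = b" using assms(1) that by (simp add: prod.delta)
    finally have "b = (\<Prod>c\<in>B. c powi (if c = b then 1 else 0))" by (rule sym)
    then show ?thesis unfolding mult_gen_def by (rule range_eqI[of _ _ "\<lambda>c. if c = b then 1 else 0"])
  qed
qed

lemma mult_gen_mono:
  assumes "B \<subseteq> B'" "finite B'"
  shows "mult_gen B \<subseteq> mult_gen B'"
proof
  fix x assume "x \<in> mult_gen B"
  then obtain k where k: "x = (\<Prod>b\<in>B. b powi k b)" by (auto simp: mult_gen_def)
  have "x = (\<Prod>b\<in>B'. b powi (if b \<in> B then k b else 0))"
    unfolding k using assms by (intro prod.mono_neutral_cong_left) auto
  then show "x \<in> mult_gen B'" unfolding mult_gen_def by (intro range_eqI[of _ _ "\<lambda>b. if b \<in> B then k b else 0"])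
qed

lemma mult_gen_subset_subfield:
  assumes "complex_subfield F" "B \<subseteq> F"
  shows "mult_gen B \<subseteq> F"
  using assms by (auto simp: mult_gen_def intro!: complex_subring_prod complex_subfield_imp_subring complex_subfield_powi)

section \<open>Number fields and finiteness of numbers with bounded denominators and
  conjugates\<close>

definition number_field :: "complex set \<Rightarrow> bool" where
  "number_field F \<longleftrightarrow> complex_subfield F \<and>
     (\<exists>E. finite E \<and> E \<subseteq> F \<and> (\<forall>x\<in>F. \<exists>c. (\<forall>e. c e \<in> \<rat>) \<and> x = (\<Sum>e\<in>E. c e * e)))"

lemma number_field_subfield: "number_field F \<Longrightarrow> complex_subfield F"
  by (simp add: number_field_def)

text \<open>Multiplication by any \<open>x\<close> in \<open>F\<close> is given by a rational matrix
  on the same spanning set \<open>E\<close>, so the size of \<open>E\<close> bounds all degrees at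
  once.\<close>

lemma number_field_bounded_degree:
  assumes "number_field F"
  obtains d where "\<And>x. x \<in> F \<Longrightarrow> \<exists>p\<in>polys_over \<rat>. p \<noteq> 0 \<and> poly p x = 0 \<and> degree p \<le> d"
proof -
  obtain E where E: "complex_subfield F" "finite E" "E \<subseteq> F"
    "\<And>x. x \<in> F \<Longrightarrow> \<exists>c. (\<forall>e. c e \<in> \<rat>) \<and> x = (\<Sum>e\<in>E. c e * e)"
    using assms unfolding number_field_def by blast
  have nz: "\<exists>e\<in>E. e \<noteq> 0"
    using E(4)[OF complex_subfieldD(2)[OF E(1)]] by (metis (no_types, lifting) mult_zero_right sum.neutral zero_neq_one)
  show ?thesis
  proof
    fix x assume x: "x \<in> F"
    have "\<exists>c. x * e = (\<Sum>j\<in>E. of_rat (c j) * j)" if "e \<in> E" for e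
    proof -
      have "x * e \<in> F" using x E that complex_subfieldD(6)[OF E(1)] by blast
      then obtain c where c: "\<forall>e. c e \<in> \<rat>" "x * e = (\<Sum>e\<in>E. c e * e)" using E(4) by blast
      have "\<forall>e. \<exists>r. c e = of_rat r" using c(1) by (metis Rats_cases)
      then obtain r where "\<And>e. c e = of_rat (r e)" by metis
      then show ?thesis using c(2) by (intro exI[of _ r]) simp
    qed
    then obtain p where p: "lead_coeff p = 1" "degree p = card E" "poly (map_poly of_rat p) x = 0"
      using monic_root_if_module[OF of_rat_hom.comm_ring_hom_axioms E(2), of "\<lambda>e. e" x] nz by metis
    show "\<exists>p\<in>polys_over \<rat>. p \<noteq> 0 \<and> poly p x = 0 \<and> degree p \<le> card E"
    proof (intro bexI conjI)
      show "map_poly of_rat p \<noteq> (0 :: complex poly)" using p(1) by (auto simp: map_poly_eq_0_iff)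
      show "degree (map_poly of_rat p :: complex poly) \<le> card E" using p(2) degree_map_poly_le[of of_rat p] by simp
    qed (use p in \<open>auto simp: polys_over_def coeff_map_poly\<close>)
  qed
qed

lemma number_field_algebraic:
  assumes "number_field F" "x \<in> F"
  shows "algebraic x"
proof -
  obtain p where "p \<in> polys_over \<rat>" "p \<noteq> 0" "poly p x = 0"
    using number_field_bounded_degree[OF assms(1)] assms(2) by metis
  then show ?thesis by (auto simp: polys_over_def intro: algebraicI')
qed

lemma number_field_Rats: "number_field \<rat>"
  unfolding number_field_def
proof (intro conjI complex_subfield_Rats exI[of _ "{1}"] ballI)
  fix x :: complex assume "x \<in> \<rat>"
  then show "\<exists>c. (\<forall>e. c e \<in> \<rat>) \<and> x = (\<Sum>e\<in>{1}. c e * e)" by (intro exI[of _ "\<lambda>_. x"]) auto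
qed auto

lemma number_field_adjoin:
  assumes F: "number_field F" and a: "algebraic a"
  shows "number_field (adjoin F a)"
proof -
  obtain E where E: "complex_subfield F" "finite E" "E \<subseteq> F"
    "\<And>x. x \<in> F \<Longrightarrow> \<exists>c. (\<forall>e. c e \<in> \<rat>) \<and> x = (\<Sum>e\<in>E. c e * e)"
    using F unfolding number_field_def by blast
  have adj: "complex_subfield (adjoin F a)" "F \<subseteq> adjoin F a" "a \<in> adjoin F a"
    using adjoin_props[OF E(1) number_field_algebraic[OF F] a] by blast+
  note adj' = complex_subfield_imp_subring[OF adj(1)]
  obtain p where p: "is_min_poly F a p" using algebraic_is_min_poly_exists[OF E(1) a] .
  define m where "m = degree p"
  define g where "g = (\<lambda>(e, i). e * a ^ i)"
  define I where "I = E \<times> {..<m}"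
  show ?thesis
    unfolding number_field_def
  proof (intro conjI adj(1) exI[of _ "g ` I"] ballI)
    show "finite (g ` I)" using E(2) by (simp add: I_def)
    show "g ` I \<subseteq> adjoin F a"
      using E(3) adj by (auto simp: g_def I_def intro!: complex_subringD(6)[OF adj'] complex_subring_power[OF adj'])
    fix x assume "x \<in> adjoin F a"
    then obtain q where "q \<in> polys_over F" "x = poly q a" by (auto simp: adjoin_def)
    then obtain c where c: "\<And>i. c i \<in> F" "x = (\<Sum>i<m. c i * a ^ i)"
      using power_in_monic_span[OF complex_subfield_imp_subring[OF E(1)], of p a q] p
      unfolding is_min_poly_def m_def by blast
    have "\<forall>i. \<exists>d. (\<forall>e. d e \<in> \<rat>) \<and> c i = (\<Sum>e\<in>E. d e * e)" using E(4) c(1) by blast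
    then obtain d where d: "\<And>i e. d i e \<in> \<rat>" "\<And>i. c i = (\<Sum>e\<in>E. d i e * e)" by metis
    have "x = (\<Sum>i<m. \<Sum>e\<in>E. d i e * g (e, i))"
      unfolding c(2) d(2) by (simp add: sum_distrib_right g_def mult.assoc)
    also have "\<dots> = (\<Sum>(e, i)\<in>I. d i e * g (e, i))"
      unfolding I_def by (subst sum.swap) (simp add: sum.cartesian_product)
    \<comment> \<open>Different pairs may give the same product \<open>e * a ^ i\<close>, while
      spanning families are sets; coefficients of equal products are therefore collected.\<close>
    also have "\<dots> = (\<Sum>y\<in>g ` I. \<Sum>z\<in>{z \<in> I. g z = y}. d (snd z) (fst z) * g z)"
      using E(2) by (subst sum.image_gen[of I _ g]) (auto simp: I_def case_prod_unfold)
    also have "\<dots> = (\<Sum>y\<in>g ` I. (\<Sum>z\<in>{z \<in> I. g z = y}. d (snd z) (fst z)) * y)"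
      by (intro sum.cong refl) (auto simp: sum_distrib_right intro!: sum.cong)
    finally show "\<exists>c. (\<forall>e. c e \<in> \<rat>) \<and> x = (\<Sum>e\<in>g ` I. c e * e)"
      by (intro exI[of _ "\<lambda>y. \<Sum>z\<in>{z \<in> I. g z = y}. d (snd z) (fst z)"])
        (auto intro!: complex_subring_sum complex_subfield_imp_subring complex_subfield_Rats d(1))
  qed
qed

lemma number_field_containing:
  assumes "finite A" "\<And>x. x \<in> A \<Longrightarrow> algebraic x"
  obtains F where "number_field F" "A \<subseteq> F"
proof -
  from assms have "\<exists>F. number_field F \<and> A \<subseteq> F"
  proof (induction A rule: finite_induct)
    case empty
    then show ?case using number_field_Rats by auto
  next
    case (insert a A)
    then obtain F where F: "number_field F" "A \<subseteq> F" by auto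
    have a: "algebraic a" using insert.prems by auto
    have "F \<subseteq> adjoin F a" "a \<in> adjoin F a"
      using adjoin_props[OF number_field_subfield[OF F(1)] number_field_algebraic[OF F(1)] a] by blast+
    then show ?case using number_field_adjoin[OF F(1) a] F(2) by (intro exI[of _ "adjoin F a"]) auto
  qed
  then show ?thesis using that by blast
qed

text \<open>Roots are split off one at a time. Multiplication by \<open>[:- a, 1:]\<close> turns
  coefficients into \<open>l - a * coeff q i\<close>, which keeps them integral and enlarges the
  bound by a factor of at most \<open>1 + C\<close>.\<close>

lemma monic_coeff_bound:
  fixes p :: "complex poly"
  assumes "lead_coeff p = 1" "\<And>z. poly p z = 0 \<Longrightarrow> algebraic_int z \<and> norm z \<le> C" "C \<ge> 0"
  shows "algebraic_int (coeff p i) \<and> norm (coeff p i) \<le> (1 + C) ^ degree p"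
  using assms(1,2)
proof (induction "degree p" arbitrary: p i)
  case 0
  then obtain c where "p = [:c:]" by (metis degree_eq_zeroE)
  then show ?case using 0 by (auto simp: coeff_pCons split: nat.split)
next
  case (Suc n)
  then obtain a where a: "poly p a = 0"
    using fundamental_theorem_of_algebra[of p] constant_degree[of p] by auto
  then obtain q where q: "p = [:- a, 1:] * q" by (auto simp: poly_eq_0_iff_dvd)
  have "q \<noteq> 0" using Suc.prems(1) q by auto
  then have dp: "degree p = Suc (degree q)" unfolding q by (subst degree_mult_eq) auto
  have "lead_coeff q = 1" using Suc.prems(1) unfolding q lead_coeff_mult by simp
  then have IH: "algebraic_int (coeff q i)" "norm (coeff q i) \<le> (1 + C) ^ n" for i
    using Suc.hyps(1)[of q i] Suc.hyps(2) dp Suc.prems(2) by (auto simp: q)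
  have a': "algebraic_int a" "norm a \<le> C" using Suc.prems(2)[OF a] by auto
  \<comment> \<open>The coefficient of \<open>q\<close> with index \<open>i - 1\<close>, read as 0
    for \<open>i = 0\<close>, where truncated subtraction would give a wrong value.\<close>
  define l where "l = (case i of 0 \<Rightarrow> 0 | Suc j \<Rightarrow> coeff q j)"
  have l: "algebraic_int l" "norm l \<le> (1 + C) ^ n" using IH assms(3) by (auto simp: l_def split: nat.split)
  have eq: "coeff p i = l - a * coeff q i"
    by (simp add: q l_def coeff_pCons split: nat.split)
  have "norm (coeff p i) \<le> norm l + norm a * norm (coeff q i)"
    unfolding eq by (metis norm_mult norm_triangle_ineq4)
  also have "\<dots> \<le> (1 + C) ^ n + C * (1 + C) ^ n"
    using l IH a' assms(3) by (intro add_mono mult_mono) auto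
  also have "\<dots> = (1 + C) ^ degree p" using Suc.hyps(2) by (simp flip: Suc.hyps(2) add: algebra_simps)
  finally show ?case
    using complex_subringD(5,6)[OF complex_subring_algebraic_int] l IH a' by (simp add: eq)
qed

lemma finite_polys_bounded:
  fixes S :: "complex set"
  assumes "finite S"
  shows "finite {p. degree p \<le> d \<and> (\<forall>i. coeff p i \<in> S)}"
proof (rule finite_subset)
  show "{p. degree p \<le> d \<and> (\<forall>i. coeff p i \<in> S)} \<subseteq> (\<lambda>f. \<Sum>i\<le>d. monom (f i) i) ` PiE {..d} (\<lambda>_. S)"
  proof
    fix p assume "p \<in> {p. degree p \<le> d \<and> (\<forall>i. coeff p i \<in> S)}"
    then show "p \<in> (\<lambda>f. \<Sum>i\<le>d. monom (f i) i) ` PiE {..d} (\<lambda>_. S)"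
      by (intro image_eqI[of _ _ "restrict (coeff p) {..d}"]) (auto simp: poly_as_sum_of_monoms')
  qed
  show "finite ((\<lambda>f. \<Sum>i\<le>d. monom (f i) i) ` PiE {..d} (\<lambda>_. S))"
    using assms by (intro finite_imageI finite_PiE) auto
qed

lemma finite_bounded_Ints: "finite {z::complex. z \<in> \<int> \<and> norm z \<le> C}"
proof (rule finite_subset)
  show "{z::complex. z \<in> \<int> \<and> norm z \<le> C} \<subseteq> of_int ` {- \<lceil>C\<rceil>..\<lceil>C\<rceil>}"
  proof
    fix z :: complex assume "z \<in> {z. z \<in> \<int> \<and> norm z \<le> C}"
    then obtain k where k: "z = of_int k" "norm z \<le> C" by (auto elim: Ints_cases)
    then have "\<bar>real_of_int k\<bar> \<le> C" by simp
    then have "real_of_int \<bar>k\<bar> \<le> of_int \<lceil>C\<rceil>" using le_of_int_ceiling[of C] by linarith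
    then have "\<bar>k\<bar> \<le> \<lceil>C\<rceil>" by linarith
    then show "z \<in> of_int ` {- \<lceil>C\<rceil>..\<lceil>C\<rceil>}" using k by (intro image_eqI[of _ _ k]) (auto simp: abs_le_iff)
  qed
qed auto

lemma embeddings_algebraic_int:
  assumes "s \<in> embeddings \<rat>" "algebraic_int x"
  shows "algebraic_int (s x)"
proof -
  obtain p where p: "lead_coeff p = 1" "\<forall>i. coeff p i \<in> \<int>" "poly p x = 0"
    using assms(2) by (auto elim: algebraic_int.cases)
  have "p \<in> polys_over \<rat>" using p(2) Ints_subset_Rats by (auto simp: polys_over_def)
  then have "poly p (s x) = 0"
    using embeddings_root[OF complex_subfield_Rats rat_imp_algebraic assms(1) _ algebraic_int_imp_algebraic[OF assms(2)] p(3)]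
    by blast
  then show ?thesis using p by (auto intro: algebraic_int.intros)
qed

text \<open>A Northcott-type finiteness: all roots of the rational minimal polynomial are conjugates
  of \<open>u\<close>, hence integral and bounded. Its coefficients are then rational algebraic
  integers, that is integers, in a bounded range, which leaves finitely many polynomials.\<close>

theorem finite_algebraic_int_bounded_conjugates:
  "finite {u. algebraic_int u \<and> (\<exists>q\<in>polys_over \<rat>. q \<noteq> 0 \<and> poly q u = 0 \<and> degree q \<le> d)
     \<and> (\<forall>s\<in>embeddings \<rat>. norm (s u) \<le> C)}" (is "finite ?U")
proof -
  \<comment> \<open>\<open>monic_coeff_bound\<close> and the monotonicity of powers ask for a
    nonnegative bound, while \<open>C\<close> is arbitrary.\<close>
  define C' where "C' = max C 0"
  define S where "S = {z::complex. z \<in> \<int> \<and> norm z \<le> (1 + C') ^ d}"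
  define P where "P = {p. degree p \<le> d \<and> (\<forall>i. coeff p i \<in> S)} - {0}"
  have "finite P" unfolding P_def S_def by (intro finite_Diff finite_polys_bounded finite_bounded_Ints)
  moreover have "?U \<subseteq> (\<Union>p\<in>P. {z. poly p z = 0})"
  proof
    fix u assume "u \<in> ?U"
    then obtain q where u: "algebraic_int u" "\<And>s. s \<in> embeddings \<rat> \<Longrightarrow> norm (s u) \<le> C"
      and q: "q \<in> polys_over \<rat>" "q \<noteq> 0" "poly q u = 0" "degree q \<le> d" by blast
    obtain p where p: "is_min_poly \<rat> u p" using is_min_poly_exists[OF complex_subfield_Rats q(1-3)] .
    then have p': "p \<in> polys_over \<rat>" "lead_coeff p = 1" "poly p u = 0" "degree p \<le> d"
      using q unfolding is_min_poly_def by auto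
    have "algebraic_int z \<and> norm z \<le> C'" if z: "poly p z = 0" for z
    proof -
      obtain s where "s \<in> embeddings \<rat>" "s u = z"
        using embeddings_transitive[OF complex_subfield_Rats rat_imp_algebraic algebraic_int_imp_algebraic[OF u(1)] p z]
        by blast
      then show ?thesis using embeddings_algebraic_int u by (fastforce simp: C'_def)
    qed
    then have *: "algebraic_int (coeff p i) \<and> norm (coeff p i) \<le> (1 + C') ^ degree p" for i
      using monic_coeff_bound[OF p'(2), of C'] by (simp add: C'_def)
    have "(1 + C') ^ degree p \<le> (1 + C') ^ d" using p'(4) by (intro power_increasing) (auto simp: C'_def)
    then have "norm (coeff p i) \<le> (1 + C') ^ d" for i
      using *[of i] by linarith
    moreover have "coeff p i \<in> \<int>" for i
      using *[of i] coeff_polys_over[OF p'(1)] by (blast intro: rational_algebraic_int_is_int)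
    ultimately have "coeff p i \<in> S" for i
      by (simp add: S_def)
    moreover have "p \<noteq> 0" using p'(2) by auto
    ultimately show "u \<in> (\<Union>p\<in>P. {z. poly p z = 0})" using p'(3,4) by (auto simp: P_def)
  qed
  moreover have "finite {z. poly p z = 0}" if "p \<in> P" for p
    using that by (intro poly_roots_finite) (auto simp: P_def)
  ultimately show ?thesis using finite_subset[of ?U] by (meson finite_UN_I)
qed

text \<open>The conjugates are roots of one polynomial. The bound is made at least 1 so that its
  powers grow with the exponent when it is used.\<close>

lemma conjugates_bounded:
  assumes "algebraic b"
  obtains C :: real where "C \<ge> 1" "\<And>s. s \<in> embeddings \<rat> \<Longrightarrow> norm (s b) \<le> C"
proof -
  obtain p where p: "is_min_poly \<rat> b p" using algebraic_is_min_poly_exists[OF complex_subfield_Rats assms] .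
  then have p': "p \<in> polys_over \<rat>" "p \<noteq> 0" "poly p b = 0" by (auto simp: is_min_poly_def)
  have "finite {z. poly p z = 0}" using p'(2) by (rule poly_roots_finite)
  then obtain C where C: "\<And>z. poly p z = 0 \<Longrightarrow> norm z \<le> C"
    using bdd_above_finite[of "norm ` {z. poly p z = 0}"] unfolding bdd_above_def by auto
  show ?thesis
  proof
    show "max C 1 \<ge> 1" by simp
    show "norm (s b) \<le> max C 1" if "s \<in> embeddings \<rat>" for s
      using C embeddings_root[OF complex_subfield_Rats rat_imp_algebraic that p'(1) assms p'(3)]
      by (simp add: le_max_iff_disj)
  qed
qed

text \<open>Reducing the exponents of \<open>f ^ n\<close> modulo \<open>n\<close> changes
  \<open>f\<close> by a factor \<open>g\<close> of the group into \<open>t\<close>, whose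
  \<open>n\<close>-th power is a product of \<open>b ^ r b\<close> with \<open>r b < n\<close>.
  After extraction of \<open>n\<close>-th roots, denominators and conjugates of \<open>t\<close> are
  bounded independently of \<open>f\<close> and \<open>n\<close>. So \<open>t\<close> lies in the
  finite set \<open>T\<close>, and a common multiple of the exponents of its elements serves every
  \<open>f\<close>.\<close>

theorem number_field_saturation_exponent:
  assumes F: "number_field F" and B: "finite B" "B \<subseteq> F" "0 \<notin> B"
  obtains N :: nat where "N \<ge> 1" "\<And>f n. f \<in> F \<Longrightarrow> n \<ge> 1 \<Longrightarrow> f ^ n \<in> mult_gen B \<Longrightarrow> f ^ N \<in> mult_gen B"
proof -
  note F' = number_field_subfield[OF F]
  note mg = mult_gen_closed[OF B(1,3)]
  have alg: "algebraic b" if "b \<in> B" for b using number_field_algebraic[OF F] B that by auto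
  have "\<forall>b\<in>B. \<exists>D::nat. D \<ge> 1 \<and> algebraic_int (of_nat D * b)"
    using alg algebraic_imp_int_multiple by metis
  then obtain D :: "complex \<Rightarrow> nat" where D: "\<And>b. b \<in> B \<Longrightarrow> D b \<ge> 1" "\<And>b. b \<in> B \<Longrightarrow> algebraic_int (of_nat (D b) * b)"
    by metis
  have "\<forall>b\<in>B. \<exists>C::real. C \<ge> 1 \<and> (\<forall>s\<in>embeddings \<rat>. norm (s b) \<le> C)"
    using alg conjugates_bounded by metis
  then obtain C :: "complex \<Rightarrow> real" where C: "\<And>b. b \<in> B \<Longrightarrow> C b \<ge> 1"
    "\<And>b s. b \<in> B \<Longrightarrow> s \<in> embeddings \<rat> \<Longrightarrow> norm (s b) \<le> C b"
    by metis
  obtain d where d: "\<And>x. x \<in> F \<Longrightarrow> \<exists>p\<in>polys_over \<rat>. p \<noteq> 0 \<and> poly p x = 0 \<and> degree p \<le> d"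
    using number_field_bounded_degree[OF F] by metis
  \<comment> \<open>A denominator for all \<open>t\<close> at once: in \<open>(DD * t) ^ n\<close>
    each \<open>b\<close> occurs \<open>r b < n\<close> times and is met by \<open>n\<close> factors
    \<open>D b\<close>.\<close>
  define DD :: complex where "DD = (\<Prod>b\<in>B. of_nat (D b))"
  have "D b \<noteq> 0" if "b \<in> B" for b using D(1)[OF that] by simp
  then have DD: "DD \<noteq> 0" "DD \<in> \<rat>"
    using B(1) by (auto simp: DD_def intro!: complex_subring_prod complex_subfield_imp_subring complex_subfield_Rats)
  \<comment> \<open>The bound for the conjugates of \<open>DD * t\<close>; its \<open>n\<close>-th
    power dominates their \<open>n\<close>-th powers because \<open>r b < n\<close> and
    \<open>C b \<ge> 1\<close>.\<close>
  define CC where "CC = (\<Prod>b\<in>B. real (D b) * C b)"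
  define U where "U = {u. algebraic_int u \<and> (\<exists>q\<in>polys_over \<rat>. q \<noteq> 0 \<and> poly q u = 0 \<and> degree q \<le> d)
     \<and> (\<forall>s\<in>embeddings \<rat>. norm (s u) \<le> CC)}"
  define T where "T = {t. DD * t \<in> U \<and> (\<exists>n\<ge>1. t ^ n \<in> mult_gen B)}"
  have "finite ((\<lambda>u. u / DD) ` U)"
    unfolding U_def by (intro finite_imageI finite_algebraic_int_bounded_conjugates)
  moreover have "T \<subseteq> (\<lambda>u. u / DD) ` U"
    using DD(1) by (auto simp: T_def intro!: image_eqI[of _ _ "DD * _"])
  ultimately have "finite T" using finite_subset by blast
  obtain nn where nn: "\<And>t. t \<in> T \<Longrightarrow> nn t \<ge> (1::nat)" "\<And>t. t \<in> T \<Longrightarrow> t ^ nn t \<in> mult_gen B"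
  proof -
    have "\<forall>t\<in>T. \<exists>n. n \<ge> 1 \<and> t ^ n \<in> mult_gen B" by (auto simp: T_def)
    from bchoice[OF this] show ?thesis using that by blast
  qed
  define N where "N = (\<Prod>t\<in>T. nn t)"
  have "N \<ge> 1" using nn(1) by (auto simp: N_def Suc_le_eq intro!: prod_pos)
  show ?thesis
  proof (rule that[OF \<open>N \<ge> 1\<close>])
    fix f n assume f: "f \<in> F" and n: "n \<ge> (1::nat)" and fn: "f ^ n \<in> mult_gen B"
    obtain k where k: "f ^ n = (\<Prod>b\<in>B. b powi k b)" using fn by (auto simp: mult_gen_def)
    \<comment> \<open>The quotients of the exponents by \<open>n\<close> form an element of the
      group whose \<open>n\<close>-th power divides out; the remainders stay in
      \<open>t ^ n\<close>.\<close>
    define g where "g = (\<Prod>b\<in>B. b powi (k b div int n))"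
    define r where "r b = nat (k b mod int n)" for b
    have r: "r b < n" "k b mod int n = int (r b)" for b using n by (auto simp: r_def nat_less_iff)
    have g: "g \<in> mult_gen B" by (auto simp: g_def mult_gen_def)
    have gF: "g \<in> F" using g mult_gen_subset_subfield[OF F' B(2)] by auto
    define t where "t = f / g"
    have tF: "t \<in> F" using complex_subfieldD(8)[OF F' f gF] by (simp add: t_def)
    have "f ^ n = g ^ n * (\<Prod>b\<in>B. b ^ r b)"
    proof -
      have "b powi k b = (b powi (k b div int n)) ^ n * b ^ r b" if "b \<in> B" for b
      proof -
        have "b \<noteq> 0" using that B by auto
        have "b powi k b = b powi (k b div int n * int n + k b mod int n)" by simp
        also have "\<dots> = b powi (k b div int n * int n) * b powi int (r b)"
          using \<open>b \<noteq> 0\<close> by (simp add: power_int_add r(2))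
        finally show ?thesis by (simp add: power_int_mult)
      qed
      then have "f ^ n = (\<Prod>b\<in>B. (b powi (k b div int n)) ^ n * b ^ r b)" unfolding k by (intro prod.cong) auto
      then show ?thesis by (simp add: prod.distrib g_def prod_power_distrib)
    qed
    then have tn: "t ^ n = (\<Prod>b\<in>B. b ^ r b)"
      using mg(6)[OF g] by (simp add: t_def power_divide)
    define u where "u = DD * t"
    have un: "u ^ n = (\<Prod>b\<in>B. of_nat (D b) ^ n * b ^ r b)"
      by (simp add: u_def power_mult_distrib tn DD_def prod.distrib prod_power_distrib)
    have "algebraic_int (u ^ n)"
    proof -
      have "u ^ n = (\<Prod>b\<in>B. of_nat (D b) ^ (n - r b) * (of_nat (D b) * b) ^ r b)"
        unfolding un
      proof (intro prod.cong refl)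
        fix b
        have "(of_nat (D b) :: complex) ^ n = of_nat (D b) ^ (n - r b) * of_nat (D b) ^ r b"
          using r(1)[of b] by (simp flip: power_add)
        then show "of_nat (D b) ^ n * b ^ r b = of_nat (D b) ^ (n - r b) * (of_nat (D b) * b) ^ r b"
          by (simp add: power_mult_distrib)
      qed
      moreover have "of_nat (D b) ^ (n - r b) * (of_nat (D b) * b) ^ r b \<in> {x. algebraic_int x}" if "b \<in> B" for b
        using D(2)[OF that] int_imp_algebraic_int[of "of_nat (D b)"]
        by (rule_tac complex_subringD(6)[OF complex_subring_algebraic_int];
            rule_tac complex_subring_power[OF complex_subring_algebraic_int]) auto
      ultimately show ?thesis
        using complex_subring_prod[OF complex_subring_algebraic_int, of B] by simp
    qed
    then have u1: "algebraic_int u"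
      by (rule algebraic_int_root[of _ "monom 1 n"]) (use n in \<open>simp_all add: poly_monom degree_monom_eq\<close>)
    have uF: "u \<in> F"
      using DD(2) Rats_subset_complex_subfield[OF F'] tF complex_subfieldD(6)[OF F'] by (auto simp: u_def)
    have u2: "norm (s u) \<le> CC" if s: "s \<in> embeddings \<rat>" for s
    proof -
      note es = embeddings_simps[OF s]
      have au: "algebraic u" using u1 by blast
      have "algebraic (of_nat (D b) ^ n * b ^ r b)" if "b \<in> B" for b
        using alg[OF that] complex_subring_power[OF complex_subfield_imp_subring[OF complex_subfield_algebraic]]
        by (intro algebraic_closed(6)) (auto intro: rat_imp_algebraic)
      then have "s (u ^ n) = (\<Prod>b\<in>B. s (of_nat (D b) ^ n * b ^ r b))"
        using s unfolding un by (intro hom_on_prod[OF complex_subfield_algebraic]) (auto simp: embeddings_def)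
      also have "\<dots> = (\<Prod>b\<in>B. of_nat (D b) ^ n * s b ^ r b)"
      proof (intro prod.cong refl)
        fix b assume "b \<in> B"
        have "algebraic (b ^ r b)" using alg[OF \<open>b \<in> B\<close>] complex_subring_power[OF complex_subfield_imp_subring[OF complex_subfield_algebraic]] by auto
        moreover have "of_nat (D b) ^ n \<in> (\<rat> :: complex set)" by simp
        ultimately show "s (of_nat (D b) ^ n * b ^ r b) = of_nat (D b) ^ n * s b ^ r b"
          using es(4,10,13) alg[OF \<open>b \<in> B\<close>] rat_imp_algebraic by metis
      qed
      finally have eq: "s (u ^ n) = (\<Prod>b\<in>B. of_nat (D b) ^ n * s b ^ r b)" .
      have "norm (s u) ^ n = norm (s (u ^ n))" by (simp add: es(10)[OF au] norm_power)
      also have "\<dots> = (\<Prod>b\<in>B. real (D b) ^ n * norm (s b) ^ r b)"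
        unfolding eq prod_norm[symmetric] by (simp add: norm_mult norm_power)
      also have "\<dots> \<le> (\<Prod>b\<in>B. (real (D b) * C b) ^ n)"
      proof (intro prod_mono conjI)
        fix b assume b: "b \<in> B"
        have "norm (s b) ^ r b \<le> C b ^ r b" using C(2)[OF b s] by (intro power_mono) auto
        also have "\<dots> \<le> C b ^ n" using r(1)[of b] C(1)[OF b] by (intro power_increasing) auto
        finally show "real (D b) ^ n * norm (s b) ^ r b \<le> (real (D b) * C b) ^ n"
          unfolding power_mult_distrib by (intro mult_left_mono) auto
      qed auto
      also have "\<dots> = CC ^ n" by (simp add: CC_def prod_power_distrib)
      finally have "norm (s u) ^ n \<le> CC ^ n" .
      moreover have "CC \<ge> 0" unfolding CC_def using C(1) by (intro prod_nonneg mult_nonneg_nonneg) (auto intro: order_trans[of 0 1])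
      ultimately show ?thesis using n by (metis power_mono_iff norm_ge_zero not_one_le_zero gr0I)
    qed
    have "u \<in> U" using u1 u2 d[OF uF] by (auto simp: U_def)
    moreover have "t ^ n \<in> mult_gen B" using fn mg(4,7) g by (simp add: t_def power_divide)
    ultimately have "t \<in> T" using n by (auto simp: T_def u_def)
    then have "nn t dvd N" unfolding N_def using \<open>finite T\<close> by (intro dvd_prodI)
    then obtain j where "N = nn t * j" by blast
    then have "t ^ N \<in> mult_gen B" using mg(4)[OF nn(2)[OF \<open>t \<in> T\<close>], of j] by (simp add: power_mult)
    moreover have "f = t * g" using mg(6)[OF g] by (simp add: t_def)
    ultimately show "f ^ N \<in> mult_gen B" using mg(2,4) g by (simp add: power_mult_distrib)
  qed
qed

section \<open>Kummer theory\<close>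

text \<open>Combinations are lists of pairs: equal terms may be repeated, and the length of the list
  is the quantity minimised in the Kummer argument.\<close>

definition mspan :: "complex set \<Rightarrow> complex set \<Rightarrow> complex set" where
  "mspan F M = {\<Sum>(c, m)\<leftarrow>xs. c * m |xs. set xs \<subseteq> F \<times> M}"

lemma mspanI: "set xs \<subseteq> F \<times> M \<Longrightarrow> x = (\<Sum>(c, m)\<leftarrow>xs. c * m) \<Longrightarrow> x \<in> mspan F M"
  by (auto simp: mspan_def)

lemma mspan_induct [consumes 1, case_names zero add]:
  assumes "x \<in> mspan F M" "P 0" "\<And>c m x. c \<in> F \<Longrightarrow> m \<in> M \<Longrightarrow> x \<in> mspan F M \<Longrightarrow> P x \<Longrightarrow> P (c * m + x)"
  shows "P x"
proof -
  obtain xs where xs: "x = (\<Sum>(c, m)\<leftarrow>xs. c * m)" "set xs \<subseteq> F \<times> M"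
    using assms(1) by (auto simp: mspan_def)
  from xs(2) have "P (\<Sum>(c, m)\<leftarrow>xs. c * m)"
  proof (induction xs)
    case (Cons z xs)
    obtain c m where z: "z = (c, m)" by (cases z)
    show ?case using Cons assms(3)[of c m "\<Sum>(c, m)\<leftarrow>xs. c * m"] mspanI[of xs F M] by (simp add: z)
  qed (use assms(2) in simp)
  then show ?thesis using xs by simp
qed

lemma mspan_zero: "0 \<in> mspan F M"
  by (rule mspanI[of "[]"]) auto

lemma mspan_add:
  assumes "x \<in> mspan F M" "y \<in> mspan F M"
  shows "x + y \<in> mspan F M"
proof -
  obtain xs ys where "x = (\<Sum>(c, m)\<leftarrow>xs. c * m)" "set xs \<subseteq> F \<times> M" "y = (\<Sum>(c, m)\<leftarrow>ys. c * m)" "set ys \<subseteq> F \<times> M"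
    using assms unfolding mspan_def by blast
  then show ?thesis by (intro mspanI[of "xs @ ys"]) auto
qed

lemma mspan_base:
  assumes "c \<in> F" "m \<in> M"
  shows "c * m \<in> mspan F M"
  using assms by (intro mspanI[of "[(c, m)]"]) auto

text \<open>Closure of \<open>M\<close> under products makes the span a ring, and a ring of
  algebraic numbers containing the rationals is a field. With \<open>M = unity_roots\<close> it is
  the field obtained from \<open>F\<close> by adjoining all roots of unity.\<close>

lemma mspan_complex_subfield:
  assumes F: "complex_subfield F" "\<And>x. x \<in> F \<Longrightarrow> algebraic x"
    and M: "1 \<in> M" "\<And>x y. x \<in> M \<Longrightarrow> y \<in> M \<Longrightarrow> x * y \<in> M" "\<And>x. x \<in> M \<Longrightarrow> algebraic x"
  shows "complex_subfield (mspan F M)" "x \<in> mspan F M \<Longrightarrow> algebraic x" "F \<subseteq> mspan F M" "M \<subseteq> mspan F M"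
proof -
  note f = complex_subfieldD[OF F(1)]
  show 1: "F \<subseteq> mspan F M" using mspan_base[of _ F 1 M] M(1) by auto
  show "M \<subseteq> mspan F M" using mspan_base[of 1 F _ M] f(2) by auto
  show alg: "algebraic x" if "x \<in> mspan F M" for x
    using that
  proof (induction rule: mspan_induct)
    case (add c m x)
    then show ?case using algebraic_closed(3)[OF algebraic_closed(6)[OF F(2) M(3)]] by blast
  qed simp
  have smult: "c * m * x \<in> mspan F M" if "x \<in> mspan F M" "c \<in> F" "m \<in> M" for c m x
    using that(1)
  proof (induction rule: mspan_induct)
    case (add d n x)
    have "(c * d) * (m * n) + c * m * x \<in> mspan F M"
      using mspan_add[OF mspan_base[OF f(6) M(2)]] add that(2,3) by blast
    then show ?case by (simp add: algebra_simps)
  qed (simp add: mspan_zero)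
  have mult: "x * y \<in> mspan F M" if "x \<in> mspan F M" "y \<in> mspan F M" for x y
    using that(1)
  proof (induction rule: mspan_induct)
    case (add d n x)
    have "d * n * y + x * y \<in> mspan F M"
      using add that(2) by (intro mspan_add smult)
    then show ?case by (simp add: algebra_simps)
  qed (simp add: mspan_zero)
  have "-1 \<in> mspan F M" using 1 f(2,4) by blast
  then have "x - y \<in> mspan F M" if "x \<in> mspan F M" "y \<in> mspan F M" for x y
    using mspan_add[OF that(1) mult[OF _ that(2), of "-1"]] by simp
  moreover have "1 \<in> mspan F M" using 1 f(2) by blast
  ultimately have "complex_subring (mspan F M)"
    using mult by (simp add: complex_subring_def)
  then show "complex_subfield (mspan F M)"
    using 1 Rats_subset_complex_subfield[OF F(1)] alg by (intro complex_subfield_if_algebraic) auto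
qed

section \<open>Roots of unity and the action of embeddings on radicals\<close>

definition unity_roots :: "complex set" where
  "unity_roots = {z. \<exists>n\<ge>1. z ^ n = 1}"

lemma algebraic_if_power:
  fixes x :: complex
  assumes "algebraic (x ^ n)" "n \<ge> 1"
  shows "algebraic x"
  by (rule algebraic_root[OF assms(1), of "monom 1 n"])
    (use assms(2) in \<open>simp_all add: poly_monom degree_monom_eq\<close>)

lemma unity_rootsI: "z ^ n = 1 \<Longrightarrow> n \<ge> 1 \<Longrightarrow> z \<in> unity_roots"
  by (auto simp: unity_roots_def)

lemma unity_roots_closed:
  "1 \<in> unity_roots" "x \<in> unity_roots \<Longrightarrow> y \<in> unity_roots \<Longrightarrow> x * y \<in> unity_roots"
  "x \<in> unity_roots \<Longrightarrow> inverse x \<in> unity_roots" "x \<in> unity_roots \<Longrightarrow> x \<noteq> 0"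
  "x \<in> unity_roots \<Longrightarrow> algebraic x" "x \<in> unity_roots \<Longrightarrow> x powi k \<in> unity_roots"
proof -
  show "1 \<in> unity_roots" by (auto simp: unity_roots_def)
  show "x * y \<in> unity_roots" if "x \<in> unity_roots" "y \<in> unity_roots"
  proof -
    obtain n m where nm: "n \<ge> (1::nat)" "x ^ n = 1" "m \<ge> (1::nat)" "y ^ m = 1"
      using \<open>x \<in> unity_roots\<close> \<open>y \<in> unity_roots\<close> unfolding unity_roots_def by blast
    have "x ^ (n * m) = 1" "y ^ (m * n) = 1" by (simp_all add: power_mult nm)
    then have "(x * y) ^ (n * m) = 1" by (simp add: power_mult_distrib mult.commute)
    then show ?thesis using nm unfolding unity_roots_def by (intro CollectI exI[of _ "n * m"]) auto
  qed
  show inv: "inverse x \<in> unity_roots" if "x \<in> unity_roots" for x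
    using that by (auto simp: unity_roots_def power_inverse)
  show "x \<in> unity_roots \<Longrightarrow> x \<noteq> 0" by (auto simp: unity_roots_def power_0_left)
  show "algebraic x" if "x \<in> unity_roots"
  proof -
    obtain n where n: "n \<ge> (1::nat)" "x ^ n = 1" using \<open>x \<in> unity_roots\<close> unfolding unity_roots_def by blast
    then show ?thesis using algebraic_if_power[of x n] rat_imp_algebraic[of 1] by simp
  qed
  have pow: "x ^ j \<in> unity_roots" if "x \<in> unity_roots" for x j
  proof -
    obtain n where n: "n \<ge> (1::nat)" "x ^ n = 1" using \<open>x \<in> unity_roots\<close> unfolding unity_roots_def by blast
    have "(x ^ j) ^ n = (x ^ n) ^ j" by (simp flip: power_mult add: mult.commute)
    then show ?thesis using n unfolding unity_roots_def by auto
  qed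
  show "x \<in> unity_roots \<Longrightarrow> x powi k \<in> unity_roots"
    unfolding power_int_def by (simp add: pow inv)
qed

lemma embeddings_ratio_unity_root:
  assumes s: "s \<in> embeddings F" and x: "x \<noteq> 0" "algebraic x" "x ^ n \<in> F" "n \<ge> 1"
  shows "(s x / x) ^ n = 1" "s x / x \<in> unity_roots"
proof -
  have "s x ^ n = x ^ n" using embeddings_simps(10,12)[OF s] x by metis
  then show "(s x / x) ^ n = 1" using x by (simp add: power_divide)
  then show "s x / x \<in> unity_roots" using x(4) by (auto simp: unity_roots_def)
qed

text \<open>A shortest expression of \<open>x\<close> as a combination of elements of \<open>M\<close> consists of a single
  term: otherwise an embedding that fixes the roots of unity, but moves \<open>x\<close> and the leading
  radical differently, could be used to shorten it.\<close>

theorem kummer_decomposition: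
  assumes F: "complex_subfield F" "\<And>x. x \<in> F \<Longrightarrow> algebraic x"
    and M: "0 \<notin> M" "\<And>m. m \<in> M \<Longrightarrow> \<exists>n\<ge>1. m ^ n \<in> F"
    and x: "x \<noteq> 0" "x \<in> mspan F M" "x ^ n \<in> F" "n \<ge> 1"
  obtains m where "m \<in> M" "x / m \<in> mspan F unity_roots"
proof -
  \<comment> \<open>Over \<open>F1\<close> every ratio \<open>s m / m\<close> is a scalar, so an
    embedding over \<open>F1\<close> maps a combination of elements of \<open>M\<close> to another
    one with the same radicals.\<close>
  define F1 where "F1 = mspan F unity_roots"
  have F1: "complex_subfield F1" "\<And>x. x \<in> F1 \<Longrightarrow> algebraic x" "F \<subseteq> F1" "unity_roots \<subseteq> F1"
    using mspan_complex_subfield[OF F(1) _ unity_roots_closed(1,2,5)] F(2) unfolding F1_def by blast+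
  note f1 = complex_subfieldD[OF F1(1)]
  have Malg: "algebraic m" if "m \<in> M" for m
    using M(2)[OF that] F(2) algebraic_if_power by blast
  have xalg: "algebraic x" using x(3,4) F(2) algebraic_if_power by blast
  let ?P = "\<lambda>xs. set xs \<subseteq> F1 \<times> M \<and> x = (\<Sum>(c, m)\<leftarrow>xs. c * m)"
  have "\<exists>xs. ?P xs" using x(2) F1(3) unfolding mspan_def by blast
  then obtain xs where xs: "?P xs" and least: "\<And>ys. ?P ys \<Longrightarrow> length xs \<le> length ys"
    using ex_has_least_nat[of ?P _ length] by blast
  obtain z ys where z: "xs = z # ys" using xs x(1) by (cases xs) auto
  obtain c1 m1 where "z = (c1, m1)" by (cases z)
  with z xs have m1: "c1 \<in> F1" "m1 \<in> M" "xs = (c1, m1) # ys" "set ys \<subseteq> F1 \<times> M" by auto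
  have "s (x / m1) = x / m1" if s: "s \<in> embeddings F1" for s
  proof (rule ccontr)
    note es = embeddings_simps[OF s]
    have sF: "s \<in> embeddings F" using s embeddings_mono[OF F1(3)] by auto
    have ratio: "s m / m \<in> F1" if m: "m \<in> M" for m
    proof -
      obtain k where "k \<ge> 1" "m ^ k \<in> F" using M(2)[OF m] by blast
      moreover have "m \<noteq> 0" using m M(1) by auto
      ultimately show ?thesis
        using embeddings_ratio_unity_root(2)[OF sF _ Malg[OF m]] F1(4) by blast
    qed
    define ch where "ch m = s m / m" for m
    have chM: "ch m \<in> F1" if "m \<in> M" for m using ratio[OF that] by (simp add: ch_def)
    have ch0: "ch x \<in> F1"
      using embeddings_ratio_unity_root(2)[OF sF x(1) xalg x(3,4)] F1(4) by (auto simp: ch_def)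
    assume "s (x / m1) \<noteq> x / m1"
    \<comment> \<open>Moving \<open>x / m1\<close> means that \<open>s\<close> multiplies
      \<open>x\<close> and \<open>m1\<close> by different roots of unity.\<close>
    then have ne: "ch x - ch m1 \<noteq> 0"
      using es(8)[OF xalg Malg[OF m1(2)]] x(1) M(1) m1(2) es(9)[OF Malg[OF m1(2)]]
      by (auto simp: ch_def field_simps)
    have sum_alg: "algebraic (\<Sum>(c, m)\<leftarrow>zs. c * m)" if "set zs \<subseteq> F1 \<times> M" for zs
      using that
    proof (induction zs)
      case (Cons w zs)
      then have "algebraic (fst w * snd w)" by (intro algebraic_closed(6) F1(2) Malg) auto
      then show ?case using Cons algebraic_closed(3)[of "fst w * snd w"] by (simp add: case_prod_unfold)
    qed simp
    have s_sum: "s (\<Sum>(c, m)\<leftarrow>zs. c * m) = (\<Sum>(c, m)\<leftarrow>zs. c * (ch m * m))" if "set zs \<subseteq> F1 \<times> M" for zs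
      using that
    proof (induction zs)
      case (Cons w zs)
      obtain c m where w: "w = (c, m)" by (cases w)
      have cm: "c \<in> F1" "m \<in> M" "m \<noteq> 0" using Cons.prems M(1) by (auto simp: w)
      have "s (c * m) = c * (ch m * m)"
        using es(4)[OF F1(2)[OF cm(1)] Malg[OF cm(2)]] es(12)[OF cm(1)] cm(3) by (simp add: ch_def)
      moreover have "algebraic (c * m)" using cm F1(2) Malg by (intro algebraic_closed(6)) auto
      ultimately show ?case
        using Cons es(3)[of "c * m" "\<Sum>(c, m)\<leftarrow>zs. c * m"] sum_alg[of zs] by (simp add: w)
    qed (simp add: es)
    \<comment> \<open>Computing \<open>s x - ch m1 * x\<close> termwise kills the term of
      \<open>m1\<close>, while the whole is \<open>D * x\<close>; division by \<open>D\<close> gives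
      an expression with one term fewer.\<close>
    define D where "D = ch x - ch m1"
    define zs where "zs = map (\<lambda>(c, m). (c * (ch m - ch m1) / D, m)) ys"
    have "(ch x - ch m1) * x = (\<Sum>(c, m)\<leftarrow>xs. c * (ch m * m)) - ch m1 * (\<Sum>(c, m)\<leftarrow>xs. c * m)"
      using s_sum[of xs] xs x(1) by (simp add: algebra_simps ch_def)
    also have "\<dots> = (\<Sum>(c, m)\<leftarrow>ys. c * (ch m * m)) - ch m1 * (\<Sum>(c, m)\<leftarrow>ys. c * m)"
      by (simp add: m1(3) algebra_simps)
    also have "\<dots> = (\<Sum>(c, m)\<leftarrow>ys. c * (ch m - ch m1) * m)"
      by (induction ys) (auto simp: algebra_simps)
    also have "\<dots> = D * (\<Sum>(c, m)\<leftarrow>zs. c * m)"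
      unfolding zs_def using ne by (induction ys) (auto simp: D_def field_simps)
    finally have "x = (\<Sum>(c, m)\<leftarrow>zs. c * m)" using ne by (simp add: D_def)
    moreover have "set zs \<subseteq> F1 \<times> M"
    proof
      fix w assume "w \<in> set zs"
      then obtain c m where cm: "(c, m) \<in> set ys" "w = (c * (ch m - ch m1) / D, m)"
        by (auto simp: zs_def)
      then have "c \<in> F1" "m \<in> M" using m1(4) by auto
      then have "c * (ch m - ch m1) / D \<in> F1"
        unfolding D_def using chM m1(2) ch0 by (intro f1(8) f1(6) f1(5)) auto
      then show "w \<in> F1 \<times> M" using cm \<open>m \<in> M\<close> by simp
    qed
    ultimately have "length xs \<le> length zs" using least by blast
    then show False by (simp add: m1(3) zs_def)
  qed
  moreover have "algebraic (x / m1)" by (rule algebraic_closed(8)[OF xalg Malg[OF m1(2)]])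
  ultimately have "x / m1 \<in> F1" using fixed_by_embeddings[OF F1(1)] F1(2) by blast
  then show ?thesis using that m1(2) by (simp add: F1_def)
qed

lemma nth_root_unity_generator:
  assumes "m \<ge> (1::nat)"
  obtains \<zeta> :: complex where "\<zeta> ^ m = 1" "\<And>z. z ^ m = 1 \<Longrightarrow> \<exists>j. z = \<zeta> ^ j" "\<And>j. \<zeta> ^ j = 1 \<Longrightarrow> m dvd j"
proof -
  define \<zeta> where "\<zeta> = cis (2 * pi / real m)"
  have pow: "\<zeta> ^ j = cis (2 * pi * real j / real m)" for j
    by (simp add: \<zeta>_def DeMoivre algebra_simps)
  have bij: "bij_betw (\<lambda>j. \<zeta> ^ j) {..<m} {z. z ^ m = 1}"
    using bij_betw_roots_unity[of m] assms unfolding pow by simp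
  show ?thesis
  proof
    show m: "\<zeta> ^ m = 1" using assms by (simp add: pow)
    show "\<exists>j. z = \<zeta> ^ j" if "z ^ m = 1" for z
      using bij that unfolding bij_betw_def by blast
    show "m dvd j" if "\<zeta> ^ j = 1" for j
    proof -
      have "\<zeta> ^ j = \<zeta> ^ (m * (j div m) + j mod m)" by simp
      also have "\<dots> = \<zeta> ^ (j mod m)" unfolding power_add power_mult m by simp
      finally have "\<zeta> ^ (j mod m) = \<zeta> ^ 0" using that by simp
      then have "j mod m = 0"
        using inj_onD[OF bij_betw_imp_inj_on[OF bij], of "j mod m" 0] assms by simp
      then show ?thesis by auto
    qed
  qed
qed

text \<open>The image of a generator of the cyclic group of \<open>m\<close>-th roots of unity is a
  power of it, and the same exponent then works for the whole group.\<close>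

lemma embeddings_unity_power:
  assumes s: "s \<in> embeddings F" and m: "m \<ge> (1::nat)"
  obtains k where "k \<ge> (1::nat)" "\<And>z. z ^ m = 1 \<Longrightarrow> s z = z ^ k"
proof -
  note es = embeddings_simps[OF s]
  obtain \<zeta> :: complex where \<zeta>: "\<zeta> ^ m = 1" "\<And>z. z ^ m = 1 \<Longrightarrow> \<exists>j. z = \<zeta> ^ j"
    using nth_root_unity_generator[OF m] by metis
  have alg: "algebraic z" if "z ^ m = 1" for z :: complex
    by (rule unity_roots_closed(5)[OF unity_rootsI[OF that m]])
  have "s \<zeta> ^ m = 1" using es(10)[OF alg[OF \<zeta>(1)]] es(2) \<zeta>(1) by metis
  then obtain k where k: "s \<zeta> = \<zeta> ^ k" using \<zeta>(2) by blast
  show ?thesis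
  proof
    \<comment> \<open>The exponent found first may be 0; adding \<open>m\<close> makes it positive
      without effect on \<open>m\<close>-th roots of unity.\<close>
    show "k + m \<ge> 1" using m by simp
    fix z :: complex assume z: "z ^ m = 1"
    then obtain j where j: "z = \<zeta> ^ j" using \<zeta>(2) by blast
    have "s z = z ^ k" using es(10)[OF alg[OF \<zeta>(1)], of j] by (simp add: j k flip: power_mult add: mult.commute)
    then show "s z = z ^ (k + m)" using z by (simp add: power_add)
  qed
qed

text \<open>Adjoining roots of unity is an abelian extension: on the roots of a given order two
  embeddings are power maps, with exponents \<open>k\<close> and \<open>l\<close>, and either
  composite raises to the power \<open>k * l\<close>. Coefficients in \<open>F\<close> are
  fixed.\<close>

lemma embeddings_commute:
  assumes F: "complex_subfield F" "\<And>x. x \<in> F \<Longrightarrow> algebraic x"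
    and s: "s \<in> embeddings F" and t: "t \<in> embeddings F" and y: "y \<in> mspan F unity_roots"
  shows "s (t y) = t (s y)"
  using y
proof (induction rule: mspan_induct)
  case (add c m x)
  obtain n where n: "n \<ge> (1::nat)" "m ^ n = 1" using add(2) by (auto simp: unity_roots_def)
  obtain k where k: "\<And>z. z ^ n = 1 \<Longrightarrow> s z = z ^ k" using embeddings_unity_power[OF s n(1)] by blast
  obtain l where l: "\<And>z. z ^ n = 1 \<Longrightarrow> t z = z ^ l" using embeddings_unity_power[OF t n(1)] by blast
  have alg: "algebraic c" "algebraic m" "algebraic x"
    using F(2) add mspan_complex_subfield(2)[OF F(1) _ unity_roots_closed(1,2,5)] unity_roots_closed(5) by blast+
  have pw: "(m ^ i) ^ n = 1" for i using n(2) by (metis mult.commute power_mult power_one)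
  have "s (t m) = m ^ (k * l)" using k[OF pw, of l] l[OF n(2)] by (simp flip: power_mult add: mult.commute)
  moreover have "t (s m) = m ^ (k * l)" using l[OF pw, of k] k[OF n(2)] by (simp flip: power_mult)
  ultimately have m: "s (t m) = t (s m)" by simp
  have cm: "algebraic (c * m)" using alg by (intro algebraic_closed(6))
  note al = alg cm embeddings_algebraic[OF s] embeddings_algebraic[OF t]
  have "s (t (c * m + x)) = c * s (t m) + s (t x)"
    using add(1) al embeddings_simps(3,4,12)[OF s] embeddings_simps(3,4,12)[OF t] algebraic_closed(6) by simp
  moreover have "t (s (c * m + x)) = c * t (s m) + t (s x)"
    using add(1) al embeddings_simps(3,4,12)[OF s] embeddings_simps(3,4,12)[OF t] algebraic_closed(6) by simp
  ultimately show ?case using m add.IH by simp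
qed (simp add: embeddings_simps(1)[OF s] embeddings_simps(1)[OF t])

text \<open>The exponents \<open>d\<close> for which \<open>y\<^sup>d\<close> is a root of unity times an element of \<open>F\<close> form an
  ideal of the integers. It contains \<open>k - 1\<close> whenever some embedding over \<open>F\<close> raises the \<open>m\<close>-th
  roots of unity to the power \<open>k\<close>. Hence the roots of unity whose order is the generator \<open>g\<close> of
  this ideal lie in \<open>F\<close>.\<close>

theorem schinzel_exponent:
  assumes F: "complex_subfield F" "\<And>x. x \<in> F \<Longrightarrow> algebraic x"
    and W: "\<And>f n. f \<in> F \<Longrightarrow> n \<ge> (1::nat) \<Longrightarrow> f ^ n = 1 \<Longrightarrow> f ^ W = 1"
    and y: "y \<in> mspan F unity_roots" "y \<noteq> 0" "y ^ m \<in> F" "m \<ge> 1"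
  obtains \<eta> where "\<eta> \<in> unity_roots" "y ^ W / \<eta> \<in> F"
proof -
  note f = complex_subfieldD[OF F(1)] and u = unity_roots_closed
  have yalg: "algebraic y" using y(3,4) F(2) algebraic_if_power by blast
  define I where "I = {d::int. \<exists>\<eta>\<in>unity_roots. y powi d / \<eta> \<in> F}"
  have diff: "d - e \<in> I" if "d \<in> I" "e \<in> I" for d e
  proof -
    obtain \<eta> \<theta> where h: "\<eta> \<in> unity_roots" "y powi d / \<eta> \<in> F" "\<theta> \<in> unity_roots" "y powi e / \<theta> \<in> F"
      using \<open>d \<in> I\<close> \<open>e \<in> I\<close> unfolding I_def by blast
    have "(y powi d / \<eta>) / (y powi e / \<theta>) \<in> F" by (rule f(8)[OF h(2,4)])
    then have "y powi (d - e) / (\<eta> * inverse \<theta>) \<in> F"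
      using y(2) by (simp add: power_int_diff field_simps)
    moreover have "\<eta> * inverse \<theta> \<in> unity_roots" using h u by blast
    ultimately show ?thesis by (auto simp: I_def)
  qed
  have mI: "int m \<in> I" unfolding I_def using y(3) u(1) by (intro CollectI bexI[of _ 1]) auto
  obtain g where g: "g \<ge> 1" and gI: "\<And>d. d \<in> I \<longleftrightarrow> int g dvd d"
    using int_subgroup_generator[OF diff mI y(4)] by blast
  obtain \<zeta> :: complex where \<zeta>: "\<zeta> ^ m = 1" "\<And>j. \<zeta> ^ j = 1 \<Longrightarrow> m dvd j"
    using nth_root_unity_generator[OF y(4)] by metis
  have "g dvd m" using gI mI by simp
  then obtain q where q: "m = g * q" by blast
  \<comment> \<open>With \<open>m = g * q\<close> and \<open>\<zeta>\<close> of order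
    \<open>m\<close>, this root of unity has order \<open>g\<close>. Once it is known to lie in
    \<open>F\<close>, the exponent \<open>W\<close> kills it, which forces \<open>g dvd W\<close>
    and hence \<open>W\<close> into the ideal.\<close>
  define w where "w = \<zeta> ^ q"
  have wg: "w ^ g = 1" by (simp add: w_def \<zeta>(1) mult.commute flip: power_mult q)
  have wm: "w ^ m = 1" by (simp add: q power_mult wg)
  have walg: "algebraic w" by (rule u(5)[OF unity_rootsI[OF wg g]])
  have "t w = w" if t: "t \<in> embeddings F" for t
  proof -
    obtain k where k: "k \<ge> 1" "\<And>z. z ^ m = 1 \<Longrightarrow> t z = z ^ k" using embeddings_unity_power[OF t y(4)] by blast
    \<comment> \<open>If \<open>s\<close> multiplies \<open>y\<close> by \<open>z\<close>, it
      multiplies \<open>y ^ k\<close> by \<open>z ^ k\<close>. It commutes with \<open>t\<close>, so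
      it multiplies \<open>t y\<close> by \<open>t z\<close>, which is \<open>z ^ k\<close> too.
      Hence \<open>v\<close> is fixed by every \<open>s\<close> and lies in
      \<open>F\<close>.\<close>
    define v where "v = y ^ k / t y"
    have ty: "t y \<noteq> 0" "algebraic (t y)" "algebraic (y ^ k)"
      using embeddings_simps(9)[OF t yalg] y(2) embeddings_algebraic[OF t yalg]
        complex_subring_power[OF complex_subfield_imp_subring[OF complex_subfield_algebraic], of y k] yalg by auto
    have "v \<in> F"
    proof (rule fixed_by_embeddings[OF F])
      show "algebraic v" unfolding v_def by (rule algebraic_closed(8)[OF ty(3,2)])
      fix s assume s: "s \<in> embeddings F"
      define z where "z = s y / y"
      have z: "z ^ m = 1" "s y = z * y"
        using embeddings_ratio_unity_root(1)[OF s y(2) yalg y(3,4)] y(2) by (auto simp: z_def)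
      have zalg: "algebraic z" "z \<noteq> 0" using u(4,5)[OF unity_rootsI[OF z(1) y(4)]] by auto
      have "s v = s y ^ k / s (t y)"
        unfolding v_def using embeddings_simps(8)[OF s ty(3,2)] embeddings_simps(10)[OF s yalg] by simp
      also have "s (t y) = t (s y)" by (rule embeddings_commute[OF F s t y(1)])
      also have "\<dots> = z ^ k * t y"
        unfolding z(2) using embeddings_simps(4)[OF t zalg(1) yalg] k(2)[OF z(1)] by simp
      also have "s y ^ k / \<dots> = v" unfolding z(2) v_def using zalg(2) by (simp add: power_mult_distrib)
      finally show "s v = v" .
    qed
    \<comment> \<open>The same \<open>v\<close> is the power of \<open>y\<close> with exponent
      \<open>k - 1\<close> divided by the root of unity \<open>t y / y\<close>; this is membership
      of \<open>k - 1\<close> in \<open>I\<close>.\<close>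
    moreover have "y powi (int k - 1) / (t y / y) = v" (is "?l = v")
      using y(2) k(1) ty(1) by (simp add: v_def power_int_diff)
    moreover have "t y / y \<in> unity_roots" by (rule embeddings_ratio_unity_root(2)[OF t y(2) yalg y(3,4)])
    ultimately have "int k - 1 \<in> I"
      unfolding I_def by (intro CollectI bexI[of _ "t y / y"]) (simp_all only:)
    then have "int g dvd int k - 1" using gI by blast
    then have "int g dvd int (k - 1)" using k(1) by (simp add: of_nat_diff)
    then obtain j where j: "k - 1 = g * j" by (metis int_dvd_int_iff dvdE)
    have "t w = w ^ (k - 1) * w" using k(2)[OF wm] k(1) by (simp flip: power_Suc2)
    moreover have "w ^ (k - 1) = 1" by (simp only: j power_mult wg power_one)
    ultimately show "t w = w" by simp
  qed
  then have "w \<in> F" using fixed_by_embeddings[OF F walg] by blast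
  then have "w ^ W = 1" using W g wg by blast
  then have "m dvd q * W" using \<zeta>(2) by (simp add: w_def flip: power_mult)
  then have "g dvd W" using q y(4) by (auto simp: mult.commute[of g])
  then have "int W \<in> I" using gI by simp
  then show ?thesis using that by (auto simp: I_def)
qed

text \<open>Three reductions are chained: \<open>x = m * y\<close> by Kummer theory,
  \<open>y ^ W = \<eta> * f\<close> with \<open>f\<close> in \<open>F\<close> by Schinzel's
  argument, and \<open>f ^ N\<close> in the group by the exponent for number fields. The last
  applies because \<open>x\<close>, \<open>m\<close> and \<open>\<eta>\<close> all have powers in
  the group, hence so does \<open>f\<close>. The factor \<open>(m ^ W * \<eta>) ^ N\<close> stays in
  \<open>M\<close>.\<close>

theorem radical_saturation_exponent:
  assumes F: "number_field F" and B: "finite B" "B \<subseteq> F" "0 \<notin> B"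
    and M: "unity_roots \<subseteq> M" "\<And>x y. x \<in> M \<Longrightarrow> y \<in> M \<Longrightarrow> x * y \<in> M" "\<And>x. x \<in> M \<Longrightarrow> x \<noteq> 0"
    and rad: "\<And>x. x \<in> M \<Longrightarrow> \<exists>n\<ge>1. x ^ n \<in> mult_gen B"
  obtains N :: nat where "N \<ge> 1"
    "\<And>x n. x \<in> mspan F M \<Longrightarrow> n \<ge> 1 \<Longrightarrow> x ^ n \<in> mult_gen B \<Longrightarrow> \<exists>m\<in>M. x ^ N / m \<in> mult_gen B"
proof -
  note F' = number_field_subfield[OF F]
  note mg = mult_gen_closed[OF B(1,3)]
  have BF: "mult_gen B \<subseteq> F" by (rule mult_gen_subset_subfield[OF F' B(2)])
  \<comment> \<open>As \<open>mult_gen {}\<close> is the trivial group, \<open>W\<close> annihilates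
    the roots of unity of \<open>F\<close>.\<close>
  obtain W where W: "W \<ge> 1" "\<And>f n. f \<in> F \<Longrightarrow> n \<ge> 1 \<Longrightarrow> f ^ n \<in> mult_gen {} \<Longrightarrow> f ^ W \<in> mult_gen {}"
    using number_field_saturation_exponent[OF F, of "{}"] by auto
  have W': "f ^ W = 1" if "f \<in> F" "n \<ge> 1" "f ^ n = 1" for f n
    using W(2)[OF that(1,2)] that(3) by (auto simp: mult_gen_def)
  obtain N where N: "N \<ge> 1" "\<And>f n. f \<in> F \<Longrightarrow> n \<ge> 1 \<Longrightarrow> f ^ n \<in> mult_gen B \<Longrightarrow> f ^ N \<in> mult_gen B"
    using number_field_saturation_exponent[OF F B] by blast
  have Mpow: "x ^ j \<in> M" if "x \<in> M" for x j
    using that M unity_roots_closed(1) by (induction j) auto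
  show ?thesis
  proof
    show "W * N \<ge> 1" using W(1) N(1) by simp
    fix x n assume x: "x \<in> mspan F M" "n \<ge> (1::nat)" "x ^ n \<in> mult_gen B"
    have xn: "x ^ n \<in> F" using x(3) BF by auto
    have x0: "x \<noteq> 0" using mg(6)[OF x(3)] x(2) by (auto simp: power_0_left)
    have "0 \<notin> M" using M(3) by auto
    have radF: "\<exists>n\<ge>1. m ^ n \<in> F" if "m \<in> M" for m using rad[OF that] BF by blast
    obtain m where m: "m \<in> M" "x / m \<in> mspan F unity_roots"
      using kummer_decomposition[OF F' number_field_algebraic[OF F] \<open>0 \<notin> M\<close> radF x0 x(1) xn x(2)] by blast
    obtain j where j: "j \<ge> 1" "m ^ j \<in> mult_gen B" using rad[OF m(1)] by blast
    define y where "y = x / m"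
    have m0: "m \<noteq> 0" using M(3)[OF m(1)] .
    have yp: "y ^ (n * j) \<in> mult_gen B"
    proof -
      have "y ^ (n * j) = (x ^ n) ^ j / (m ^ j) ^ n"
        by (simp add: y_def power_divide power_mult[symmetric] mult.commute)
      then show ?thesis using mg(4,7) x(3) j(2) by simp
    qed
    obtain \<eta> where e: "\<eta> \<in> unity_roots" "y ^ W / \<eta> \<in> F"
    proof (rule schinzel_exponent[where F = F and W = W and y = y and m = "n * j"])
      show "y \<in> mspan F unity_roots" "y \<noteq> 0" "y ^ (n * j) \<in> F" "1 \<le> n * j"
        using m x0 m0 yp BF x(2) j(1) by (auto simp: y_def)
    qed (use F' number_field_algebraic[OF F] W' in blast)+
    define f where "f = y ^ W / \<eta>"
    have eta: "\<eta> \<noteq> 0" "\<eta> \<in> M" using unity_roots_closed(4)[OF e(1)] e(1) M(1) by auto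
    obtain i where i: "i \<ge> 1" "\<eta> ^ i \<in> mult_gen B" using rad[OF eta(2)] by blast
    have "f ^ (n * j * i) = ((y ^ (n * j)) ^ W) ^ i / (\<eta> ^ i) ^ (n * j)"
      by (simp add: f_def power_divide power_mult[symmetric] mult_ac)
    then have "f ^ (n * j * i) \<in> mult_gen B" using mg(4,7) yp i(2) by simp
    moreover have "n * j * i \<ge> 1" using x(2) j(1) i(1) by simp
    ultimately have fN: "f ^ N \<in> mult_gen B" using N(2)[of f "n * j * i"] e(2) unfolding f_def by blast
    have "f = x ^ W / (m ^ W * \<eta>)" by (simp add: f_def y_def power_divide)
    then have "x ^ (W * N) / (m ^ W * \<eta>) ^ N = f ^ N" by (simp only: power_mult power_divide)
    moreover have "(m ^ W * \<eta>) ^ N \<in> M" using Mpow M(2) m(1) eta(2) by simp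
    ultimately show "\<exists>m\<in>M. x ^ (W * N) / m \<in> mult_gen B" using fN by metis
  qed
qed

section \<open>Countable free abelian groups\<close>

context comm_group
begin

lemma subgroup_saturation:
  assumes H: "subgroup H G"
  shows "subgroup (saturation G H) G"
proof (rule subgroupI)
  show "saturation G H \<subseteq> carrier G" by (auto simp: saturation_def)
  show "saturation G H \<noteq> {}"
    using subgroup.one_closed[OF H] by (auto simp: saturation_def intro!: exI[of _ "\<one>"] exI[of _ "1::nat"])
next
  fix x assume "x \<in> saturation G H"
  then obtain n where n: "x \<in> carrier G" "n \<ge> (1::nat)" "x [^] n \<in> H" by (auto simp: saturation_def)
  then show "inv x \<in> saturation G H"
    using subgroup.m_inv_closed[OF H n(3)] by (auto simp: saturation_def nat_pow_inv)
next
  fix x y assume "x \<in> saturation G H" "y \<in> saturation G H"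
  then obtain n m where n: "x \<in> carrier G" "n \<ge> (1::nat)" "x [^] n \<in> H"
    and m: "y \<in> carrier G" "m \<ge> (1::nat)" "y [^] m \<in> H" by (auto simp: saturation_def)
  have "(x \<otimes> y) [^] (n * m) = (x [^] n) [^] m \<otimes> (y [^] m) [^] n"
    using n m by (simp add: nat_pow_distrib nat_pow_pow mult.commute)
  also have "\<dots> \<in> H"
    using n m H by (metis subgroup.m_closed subgroup_int_pow_closed int_pow_int)
  finally show "x \<otimes> y \<in> saturation G H" using n m by (auto simp: saturation_def intro!: exI[of _ "n * m"])
qed

lemma subgroup_subset_saturation:
  assumes "subgroup H G"
  shows "H \<subseteq> saturation G H"
  using subgroup.subset[OF assms] by (auto simp: saturation_def intro!: exI[of _ "1::nat"])

lemma saturation_pure: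
  assumes "x \<in> carrier G" "n \<ge> (1::nat)" "x [^] n \<in> saturation G H"
  shows "x \<in> saturation G H"
proof -
  obtain m where "m \<ge> (1::nat)" "(x [^] n) [^] m \<in> H" using assms(3) by (auto simp: saturation_def)
  then show ?thesis using assms by (auto simp: saturation_def nat_pow_pow intro!: exI[of _ "n * m"])
qed

lemma generate_insert_decompose:
  assumes "a \<in> carrier G" "A \<subseteq> carrier G" "x \<in> generate G (insert a A)"
  shows "\<exists>h\<in>generate G A. \<exists>m::int. x = h \<otimes> a [^] m"
proof -
  let ?H = "{h \<otimes> a [^] m |h m. h \<in> generate G A \<and> (m::int) \<in> UNIV}"
  have gA: "subgroup (generate G A) G" using assms(2) by (rule generate_is_subgroup)
  note gc = subgroup.mem_carrier[OF gA]
  have "subgroup ?H G"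
  proof (rule subgroupI)
    show "?H \<subseteq> carrier G" using gc assms(1) by auto
    show "?H \<noteq> {}" using subgroup.one_closed[OF gA] by auto
  next
    fix x assume "x \<in> ?H"
    then obtain h m where h: "x = h \<otimes> a [^] (m::int)" "h \<in> generate G A" by blast
    have "inv x = inv h \<otimes> a [^] (- m)"
      using h gc assms(1) by (simp add: inv_mult int_pow_neg)
    then show "inv x \<in> ?H" using subgroup.m_inv_closed[OF gA h(2)] by blast
  next
    fix x y assume "x \<in> ?H" "y \<in> ?H"
    then obtain h m h' m' where h: "x = h \<otimes> a [^] (m::int)" "h \<in> generate G A"
      "y = h' \<otimes> a [^] (m'::int)" "h' \<in> generate G A" by blast
    have "x \<otimes> y = (h \<otimes> h') \<otimes> a [^] (m + m')"
      using h gc assms(1) by (simp add: int_pow_mult m_ac)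
    then show "x \<otimes> y \<in> ?H" using subgroup.m_closed[OF gA h(2,4)] by blast
  qed
  moreover have "insert a A \<subseteq> ?H"
  proof
    fix y assume "y \<in> insert a A"
    then consider "y = a" | "y \<in> A" by blast
    then show "y \<in> ?H"
    proof cases
      case 1
      then have "y = \<one> \<otimes> a [^] (1::int)" using assms(1) by (simp add: int_pow_1)
      then show ?thesis using subgroup.one_closed[OF gA] by blast
    next
      case 2
      then have "y = y \<otimes> a [^] (0::int)" using assms by auto
      then show ?thesis using 2 generate.incl[of y A G] by blast
    qed
  qed
  ultimately have "generate G (insert a A) \<subseteq> ?H" using generate_subgroup_incl by blast
  then show ?thesis using assms(3) by blast
qed

text \<open>The quotient of \<open>Q\<close> by the pure subgroup \<open>P\<close> has rank one, and
  the uniform \<open>N\<close> lets it be measured by integers: the exponent of \<open>a\<close> in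
  \<open>x [^] N\<close>. These exponents form a group generated by some \<open>g\<close>, and
  \<open>b\<close> is an element with exponent \<open>g\<close>. Without a common \<open>N\<close>
  the quotient could resemble the rational numbers.\<close>

lemma pure_rank_one_complement:
  assumes P: "subgroup P G" "\<And>x n. x \<in> carrier G \<Longrightarrow> n \<ge> (1::nat) \<Longrightarrow> x [^] n \<in> P \<Longrightarrow> x \<in> P"
    and Q: "subgroup Q G" "P \<subseteq> Q" and a: "a \<in> Q" "a \<notin> P" and N: "N \<ge> (1::nat)"
    and dec: "\<And>x. x \<in> Q \<Longrightarrow> \<exists>p\<in>P. \<exists>m::int. x [^] N = p \<otimes> a [^] m"
  obtains b where "b \<in> Q" "\<And>x. x \<in> Q \<Longrightarrow> \<exists>p\<in>P. \<exists>j::int. x = p \<otimes> b [^] j"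
    "\<And>j::int. b [^] j \<in> P \<Longrightarrow> j = 0"
proof -
  note Pc = subgroup.mem_carrier[OF P(1)] and Qc = subgroup.mem_carrier[OF Q(1)]
  note Pm = subgroup.m_closed[OF P(1)] and Pi = subgroup.m_inv_closed[OF P(1)]
  note Qm = subgroup.m_closed[OF Q(1)] and Qi = subgroup.m_inv_closed[OF Q(1)]
  define I where "I = {m::int. \<exists>x\<in>Q. \<exists>p\<in>P. x [^] N = p \<otimes> a [^] m}"
  have ac: "a \<in> carrier G" using Qc a by blast
  have "d - e \<in> I" if "d \<in> I" "e \<in> I" for d e
  proof -
    obtain x p y q where h: "x \<in> Q" "p \<in> P" "x [^] N = p \<otimes> a [^] d" "y \<in> Q" "q \<in> P" "y [^] N = q \<otimes> a [^] e"
      using \<open>d \<in> I\<close> \<open>e \<in> I\<close> unfolding I_def by blast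
    have c: "x \<in> carrier G" "y \<in> carrier G" "p \<in> carrier G" "q \<in> carrier G" using h Pc Qc by auto
    have "(x \<otimes> inv y) [^] N = x [^] N \<otimes> inv (y [^] N)"
      using c by (simp add: nat_pow_distrib nat_pow_inv)
    also have "\<dots> = (p \<otimes> inv q) \<otimes> a [^] (d - e)"
      using c ac by (simp add: h inv_mult int_pow_diff m_ac)
    finally show ?thesis using h Pm Pi Qm Qi unfolding I_def by blast
  qed
  moreover have "int N \<in> I"
    unfolding I_def using a(1) ac subgroup.one_closed[OF P(1)]
    by (intro CollectI bexI[of _ a] bexI[of _ "\<one>"]) (auto simp: int_pow_int)
  ultimately obtain g where g: "g \<ge> (1::nat)" "int g \<in> I" and gI: "\<And>d. d \<in> I \<longleftrightarrow> int g dvd d"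
    using int_subgroup_generator[of I N] N by blast
  obtain b p where b: "b \<in> Q" "p \<in> P" "b [^] N = p \<otimes> a [^] int g" using g(2) unfolding I_def by blast
  have bc: "b \<in> carrier G" "p \<in> carrier G" using b Pc Qc by auto
  have bpow: "(b [^] j) [^] N = p [^] j \<otimes> a [^] (int g * j)" for j :: int
  proof -
    have "(b [^] j) [^] N = (b [^] N) [^] j"
      using bc by (simp flip: int_pow_int add: int_pow_pow mult.commute)
    also have "\<dots> = p [^] j \<otimes> a [^] (int g * j)"
      using bc ac unfolding b(3) by (simp add: int_pow_distrib int_pow_pow)
    finally show ?thesis .
  qed
  show ?thesis
  proof (rule that[OF b(1)])
    fix x assume x: "x \<in> Q"
    then have xc: "x \<in> carrier G" by (rule Qc)
    obtain q m where q: "q \<in> P" "x [^] N = q \<otimes> a [^] (m::int)" using dec[OF x] by blast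
    then have "m \<in> I" unfolding I_def using x by blast
    then obtain j where j: "m = int g * j" using gI by (auto elim: dvdE)
    have qc: "q \<in> carrier G" using q Pc by blast
    have pj: "p [^] j \<in> P" by (rule subgroup_int_pow_closed[OF P(1) b(2)])
    \<comment> \<open>Subtracting the right multiple of \<open>b\<close> cancels the power of
      \<open>a\<close>; what remains has its \<open>N\<close>-th power in \<open>P\<close> and lies
      in \<open>P\<close> by purity.\<close>
    have "(x \<otimes> inv (b [^] j)) [^] N = x [^] N \<otimes> inv ((b [^] j) [^] N)"
      using xc bc by (simp add: nat_pow_distrib nat_pow_inv)
    also have "\<dots> = (q \<otimes> inv (p [^] j)) \<otimes> (a [^] m \<otimes> inv (a [^] m))"
      unfolding q(2) bpow j using qc bc ac by (simp add: inv_mult m_ac)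
    also have "\<dots> = q \<otimes> inv (p [^] j)" using qc bc ac by simp
    also have "\<dots> \<in> P" using Pm[OF q(1) Pi[OF pj]] .
    finally have "x \<otimes> inv (b [^] j) \<in> P" using P(2)[OF _ N] xc bc by simp
    moreover have "x = (x \<otimes> inv (b [^] j)) \<otimes> b [^] j" using xc bc by (simp add: m_assoc)
    ultimately show "\<exists>p\<in>P. \<exists>j::int. x = p \<otimes> b [^] j" by blast
  next
    fix j :: int assume "b [^] j \<in> P"
    then have "(b [^] j) [^] N \<in> P" using subgroup_int_pow_closed[OF P(1), of "b [^] j" "int N"] by (simp add: int_pow_int)
    then have "p [^] j \<otimes> a [^] (int g * j) \<in> P" by (simp add: bpow)
    then have "inv (p [^] j) \<otimes> (p [^] j \<otimes> a [^] (int g * j)) \<in> P"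
      using Pm Pi subgroup_int_pow_closed[OF P(1) b(2)] by blast
    \<comment> \<open>For \<open>j \<noteq> 0\<close> a positive power of \<open>a\<close> would lie
      in \<open>P\<close>, and purity would put \<open>a\<close> itself there.\<close>
    then have *: "a [^] (int g * j) \<in> P" using bc ac by (simp add: m_assoc[symmetric])
    show "j = 0"
    proof (rule ccontr)
      assume "j \<noteq> 0"
      define k where "k = nat \<bar>int g * j\<bar>"
      have "k \<ge> 1" using \<open>j \<noteq> 0\<close> g(1) by (simp add: k_def Suc_le_eq)
      moreover have "a [^] k \<in> P"
      proof (cases "int g * j \<ge> 0")
        case True
        then have "a [^] k = a [^] (int g * j)" by (simp add: k_def flip: int_pow_int)
        then show ?thesis using * by simp
      next
        case False
        then have "a [^] k = inv (a [^] (int g * j))" using ac by (simp add: k_def flip: int_pow_int int_pow_neg)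
        then show ?thesis using Pi[OF *] by simp
      qed
      ultimately show False using P(2)[OF ac] a(2) by blast
    qed
  qed
qed

text \<open>Pontryagin's criterion. The group is exhausted by the pure closures \<open>P k\<close> of the first \<open>k\<close>
  elements of an enumeration, and \<open>P k\<close> has a cyclic complement in \<open>P (Suc k)\<close>.\<close>

theorem free_if_bounded_saturation:
  assumes cnt: "countable (carrier G)"
    and torsion_free: "\<And>x n. x \<in> carrier G \<Longrightarrow> n \<ge> (1::nat) \<Longrightarrow> x [^] n = \<one> \<Longrightarrow> x = \<one>"
    and bounded: "\<And>A. finite A \<Longrightarrow> A \<subseteq> carrier G \<Longrightarrow>
      \<exists>N\<ge>1. \<forall>x\<in>saturation G (generate G A). x [^] (N::nat) \<in> generate G A"
  shows "free_abelian G"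
proof -
  define g where "g = from_nat_into (carrier G)"
  have range_g: "range g = carrier G"
    unfolding g_def by (rule range_from_nat_into) (use cnt in auto)
  then have gc: "g k \<in> carrier G" for k by blast
  define H where "H k = generate G (g ` {..<k})" for k
  define P where "P k = saturation G (H k)" for k
  have gi: "g ` T \<subseteq> carrier G" for T using gc by blast
  have H: "subgroup (H k) G" for k unfolding H_def by (rule generate_is_subgroup[OF gi])
  have P: "subgroup (P k) G" for k unfolding P_def by (rule subgroup_saturation[OF H])
  note Pc = subgroup.mem_carrier[OF P]
  have pure: "x \<in> P k" if "x \<in> carrier G" "n \<ge> (1::nat)" "x [^] n \<in> P k" for x n k
    using saturation_pure that unfolding P_def by blast
  have mono: "P k \<subseteq> P l" if "k \<le> l" for k l
  proof -
    have "H k \<subseteq> H l" unfolding H_def using that by (intro mono_generate image_mono) auto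
    then show ?thesis unfolding P_def saturation_def by blast
  qed
  have gP: "g k \<in> P (Suc k)" for k
    using subgroup_subset_saturation[OF H, of "Suc k"] generate.incl[of "g k" "g ` {..<Suc k}" G]
    by (auto simp: P_def H_def)
  \<comment> \<open>The pure closure of the trivial group is the torsion subgroup; this is where
    torsion-freeness enters.\<close>
  have P0: "P 0 = {\<one>}"
    using torsion_free subgroup.one_closed[OF P, of 0]
    by (auto simp: P_def saturation_def H_def generate_empty)
  \<comment> \<open>The indices at which the chain grows; each contributes one basis element, and at
    any other \<open>k\<close> the closures \<open>P k\<close> and \<open>P (Suc k)\<close>
    agree.\<close>
  define S where "S = {k. g k \<notin> P k}"
  have "\<exists>b\<in>P (Suc k). (\<forall>x\<in>P (Suc k). \<exists>p\<in>P k. \<exists>j::int. x = p \<otimes> b [^] j) \<and> (\<forall>j::int. b [^] j \<in> P k \<longrightarrow> j = 0)"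
    if k: "k \<in> S" for k
  proof -
    obtain N where N: "N \<ge> 1" "\<And>x. x \<in> P (Suc k) \<Longrightarrow> x [^] (N::nat) \<in> H (Suc k)"
      using bounded[OF _ gi, of "{..<Suc k}"] unfolding P_def H_def by blast
    have dec: "\<exists>p\<in>P k. \<exists>m::int. x [^] N = p \<otimes> g k [^] m" if "x \<in> P (Suc k)" for x
    proof -
      have "x [^] N \<in> generate G (insert (g k) (g ` {..<k}))"
        using N(2)[OF that] by (simp add: H_def lessThan_Suc)
      then have "\<exists>h\<in>H k. \<exists>m::int. x [^] N = h \<otimes> g k [^] m"
        unfolding H_def by (rule generate_insert_decompose[OF gc gi])
      then show ?thesis using subgroup_subset_saturation[OF H, of k] unfolding P_def by blast
    qed
    have "g k \<notin> P k" using k by (simp add: S_def)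
    show ?thesis
    proof (rule pure_rank_one_complement[of "P k" "P (Suc k)" "g k" N])
      show "x \<in> P k" if "x \<in> carrier G" "n \<ge> (1::nat)" "x [^] n \<in> P k" for x n
        using pure that by blast
      show "P k \<subseteq> P (Suc k)" by (rule mono) simp
    qed (use P gP \<open>g k \<notin> P k\<close> N(1) dec in blast)+
  qed
  then obtain b where b: "\<And>k. k \<in> S \<Longrightarrow> b k \<in> P (Suc k)"
    "\<And>k x. k \<in> S \<Longrightarrow> x \<in> P (Suc k) \<Longrightarrow> \<exists>p\<in>P k. \<exists>j::int. x = p \<otimes> b k [^] j"
    "\<And>k j. k \<in> S \<Longrightarrow> b k [^] (j::int) \<in> P k \<Longrightarrow> j = 0"
    by metis
  let ?A = "free_Abelian_group S"
  have "b ` S \<subseteq> carrier G" using b(1) Pc by blast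
  then obtain \<phi> where \<phi>: "\<phi> \<in> hom ?A G" "\<And>k. k \<in> S \<Longrightarrow> \<phi> (frag_of k) = b k"
    using free_Abelian_group_universal by blast
  interpret hom: group_hom ?A G \<phi>
    by (simp add: group_hom_def group_hom_axioms_def \<phi>(1))
  have cyc: "\<phi> (frag_cmul j (frag_of k)) = b k [^] j" if "k \<in> S" for j k
    using hom.hom_int_pow[of "frag_of k" j] int_pow_free_Abelian_group[of "frag_of k" S j] \<phi>(2)[OF that] that by simp
  have img: "subgroup (\<phi> ` carrier ?A) G" by (rule hom.img_is_subgroup)
  have "P k \<subseteq> \<phi> ` carrier ?A" for k
  proof (induction k)
    case 0
    then show ?case using P0 subgroup.one_closed[OF img] by simp
  next
    case (Suc k)
    show ?case
    proof (cases "k \<in> S")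
      case True
      show ?thesis
      proof
        fix x assume "x \<in> P (Suc k)"
        then obtain p j where p: "p \<in> P k" "x = p \<otimes> b k [^] (j::int)" using b(2)[OF True] by blast
        have "b k [^] j \<in> \<phi> ` carrier ?A"
          using cyc[OF True, of j] keys_cmul[of j "frag_of k"] True
          by (intro image_eqI[of _ _ "frag_cmul j (frag_of k)"]) auto
        then show "x \<in> \<phi> ` carrier ?A" using p Suc.IH subgroup.m_closed[OF img] by blast
      qed
    next
      case False
      have "g ` {..<Suc k} \<subseteq> P k"
      proof
        fix y assume "y \<in> g ` {..<Suc k}"
        then obtain i where i: "y = g i" "i \<le> k" by auto
        then show "y \<in> P k" using False gP[of i] mono[of "Suc i" k] by (cases "i = k") (auto simp: S_def)
      qed
      then have "H (Suc k) \<subseteq> P k" unfolding H_def by (rule generate_subgroup_incl[OF _ P])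
      then have "P (Suc k) \<subseteq> P k" using pure by (auto simp: P_def[of "Suc k"] saturation_def)
      then show ?thesis using Suc.IH by blast
    qed
  qed
  then have "g k \<in> \<phi> ` carrier ?A" for k using gP[of k] by (rule subsetD)
  then have "carrier G \<subseteq> \<phi> ` carrier ?A" unfolding range_g[symmetric] by (rule image_subsetI)
  then have surj: "\<phi> ` carrier ?A = carrier G" using subgroup.subset[OF img] by blast
  have below: "\<phi> c \<in> P k" if "Poly_Mapping.keys c \<subseteq> S \<inter> {..<k}" for c k
  proof (rule free_Abelian_group_induct[OF that])
    show "\<phi> 0 \<in> P k" using hom.hom_one subgroup.one_closed[OF P] by simp
  next
    fix x y assume xy: "Poly_Mapping.keys x \<subseteq> S \<inter> {..<k}" "Poly_Mapping.keys y \<subseteq> S \<inter> {..<k}"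
      "\<phi> x \<in> P k" "\<phi> y \<in> P k"
    have "\<phi> (x - y) = \<phi> x \<otimes> inv \<phi> y"
      using hom.hom_mult[of x "- y"] hom.hom_inv[of y] xy(1,2) by simp
    then show "\<phi> (x - y) \<in> P k"
      using subgroup.m_closed[OF P xy(3) subgroup.m_inv_closed[OF P xy(4)]] by simp
  next
    fix i assume "i \<in> S \<inter> {..<k}"
    then show "\<phi> (frag_of i) \<in> P k" using b(1)[of i] \<phi>(2)[of i] mono[of "Suc i" k] by auto
  qed
  have "c = 0" if c: "c \<in> carrier ?A" "\<phi> c = \<one>" for c
  proof (rule ccontr)
    assume "c \<noteq> 0"
    then have ne: "Poly_Mapping.keys c \<noteq> {}" by simp
    \<comment> \<open>The largest index of a relation: all other terms land in \<open>P k\<close>,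
      so the term of \<open>b k\<close> does too, and independence of \<open>b k\<close> modulo
      \<open>P k\<close> makes its coefficient vanish.\<close>
    define k where "k = Max (Poly_Mapping.keys c)"
    have k: "k \<in> Poly_Mapping.keys c" "\<And>i. i \<in> Poly_Mapping.keys c \<Longrightarrow> i \<le> k"
      using ne by (auto simp: k_def)
    have kS: "k \<in> S" using k c by auto
    define j where "j = poly_mapping.lookup c k"
    define c' where "c' = c - frag_cmul j (frag_of k)"
    have keys: "Poly_Mapping.keys c' \<subseteq> S \<inter> {..<k}"
    proof
      fix i assume i: "i \<in> Poly_Mapping.keys c'"
      have l: "poly_mapping.lookup c' i = poly_mapping.lookup c i - (if i = k then j else 0)"
        by (simp add: c'_def lookup_minus lookup_single when_def)
      then have "i \<noteq> k" using i by (auto simp: in_keys_iff j_def)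
      then have "i \<in> Poly_Mapping.keys c" using i l by (simp add: in_keys_iff)
      then show "i \<in> S \<inter> {..<k}" using k(2)[of i] \<open>i \<noteq> k\<close> c(1) by auto
    qed
    have "c = c' + frag_cmul j (frag_of k)" by (simp add: c'_def)
    moreover have "Poly_Mapping.keys (frag_cmul j (frag_of k)) \<subseteq> S" using keys_cmul[of j "frag_of k"] kS by auto
    ultimately have "\<one> = \<phi> c' \<otimes> b k [^] j"
      using hom.hom_mult[of c' "frag_cmul j (frag_of k)"] keys c(2) cyc[OF kS] by simp
    moreover have "\<phi> c' \<in> P k" by (rule below[OF keys])
    moreover have "b k \<in> carrier G" using b(1)[OF kS] Pc by blast
    ultimately have "b k [^] j = inv \<phi> c'"
      using Pc by (metis inv_equality inv_inv int_pow_closed inv_closed m_comm)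
    then have "b k [^] j \<in> P k" using \<open>\<phi> c' \<in> P k\<close> subgroup.m_inv_closed[OF P] by simp
    then have "j = 0" using b(3)[OF kS] by blast
    then show False using k(1) by (simp add: j_def in_keys_iff)
  qed
  then have "inj_on \<phi> (carrier ?A)"
    using hom.inj_on_one_iff by auto
  then have "\<phi> \<in> iso ?A G" using \<phi>(1) surj by (auto simp: iso_def bij_betw_def)
  then have "?A \<cong> G" by (auto simp: is_iso_def)
  then have "G \<cong> ?A" by (rule group.iso_sym[OF group_free_Abelian_group])
  then show ?thesis using free_abelianI comm_group_axioms by blast
qed

end

section \<open>The multiplicative group of a finite extension\<close>

text \<open>One interface for the groups of \<open>Qbar\<close>, of \<open>\<Gamma>\<close> and of
  \<open>L\<close>, through which their operations become those of the type
  \<open>complex\<close>.\<close>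

definition complex_mult_group :: "(complex, 'b) monoid_scheme \<Rightarrow> bool" where
  "complex_mult_group G \<longleftrightarrow> comm_group G \<and> monoid.mult G = (*) \<and> one G = 1"

lemma complex_mult_group_simps:
  assumes G: "complex_mult_group G"
  shows "comm_group G" "monoid.mult G = (*)" "one G = 1" "x \<in> carrier G \<Longrightarrow> x \<noteq> 0"
    "x \<in> carrier G \<Longrightarrow> inv\<^bsub>G\<^esub> x = inverse x" "x [^]\<^bsub>G\<^esub> (n::nat) = x ^ n"
    "x \<in> carrier G \<Longrightarrow> x [^]\<^bsub>G\<^esub> (k::int) = x powi k"
    "finite A \<Longrightarrow> f \<in> A \<rightarrow> carrier G \<Longrightarrow> finprod G f A = prod f A"
proof -
  show G': "comm_group G" "monoid.mult G = (*)" "one G = 1" using G by (auto simp: complex_mult_group_def)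
  interpret comm_group G by (fact G')
  note eq [simp] = G'(2,3)
  show nz: "x \<noteq> 0" if "x \<in> carrier G" for x
    using r_inv[OF that] by auto
  show inv: "inv\<^bsub>G\<^esub> x = inverse x" if "x \<in> carrier G" for x
    using r_inv[OF that] by (simp add: inverse_unique)
  show pow: "x [^]\<^bsub>G\<^esub> n = x ^ n" for x and n :: nat
    by (induction n) simp_all
  show "x [^]\<^bsub>G\<^esub> k = x powi k" if x: "x \<in> carrier G" for k :: int
  proof -
    have "inv\<^bsub>G\<^esub> (x ^ n) = inverse (x ^ n)" for n using inv[OF nat_pow_closed[OF x, of n]] pow by simp
    then show ?thesis
      by (cases k rule: int_cases2) (use x in \<open>simp_all add: int_pow_int int_pow_neg pow power_int_minus\<close>)
  qed
  show "finprod G f A = prod f A" if "finite A" "f \<in> A \<rightarrow> carrier G"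
    using that by (induction A rule: finite_induct) (auto simp: Pi_iff finprod_insert)
qed

lemma generate_eq_mult_gen:
  assumes G: "complex_mult_group G" and A: "finite A" "A \<subseteq> carrier G"
  shows "generate G A = mult_gen A"
proof -
  note g = complex_mult_group_simps[OF G]
  interpret comm_group G by (rule g(1))
  have A0: "0 \<notin> A" using A g(4) by auto
  note mg = mult_gen_closed[OF A(1) A0]
  have gen: "subgroup (generate G A) G" by (rule generate_is_subgroup[OF A(2)])
  have sub: "mult_gen A \<subseteq> generate G A"
  proof
    fix x assume "x \<in> mult_gen A"
    then obtain k where k: "x = (\<Prod>a\<in>A. a powi k a)" by (auto simp: mult_gen_def)
    have pw: "a powi k a \<in> generate G A" if "a \<in> A" for a
      using subgroup_int_pow_closed[OF gen generate.incl[OF that]] g(7)[of a] A that by (metis subsetD)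
    have "(\<Prod>a\<in>B. a powi k a) \<in> generate G A" if "B \<subseteq> A" "finite B" for B
      using that(2,1)
    proof (induction B rule: finite_induct)
      case empty
      then show ?case using subgroup.one_closed[OF gen] g(3) by simp
    next
      case (insert a B)
      then show ?case using subgroup.m_closed[OF gen pw[of a]] g(2) by simp
    qed
    then show "x \<in> generate G A" using A(1) k by blast
  qed
  moreover have "generate G A \<subseteq> mult_gen A"
  proof (rule generate_subgroup_incl)
    show "A \<subseteq> mult_gen A" using mg(8) by blast
    show "subgroup (mult_gen A) G"
    proof (rule subgroupI)
      show carr: "mult_gen A \<subseteq> carrier G" using sub subgroup.subset[OF gen] by blast
      show "mult_gen A \<noteq> {}" using mg(1) by blast
      show "inv\<^bsub>G\<^esub> x \<in> mult_gen A" if "x \<in> mult_gen A" for x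
        using mg(5)[OF that] g(5)[of x] carr that by auto
      show "x \<otimes>\<^bsub>G\<^esub> y \<in> mult_gen A" if "x \<in> mult_gen A" "y \<in> mult_gen A" for x y
        using mg(2)[OF that] g(2) by simp
    qed
  qed
  ultimately show ?thesis by blast
qed

text \<open>Finite rank provides an independent set \<open>A\<close> of greatest cardinality. Adding
  another \<open>x\<close> creates a relation; it involves \<open>x\<close> with nonzero exponent
  since \<open>A\<close> is independent, and so exhibits a power of \<open>x\<close> in the group
  generated by \<open>A\<close>.\<close>

lemma finite_rank_generators:
  assumes G: "complex_mult_group G" and rank: "group_rank G < \<infinity>"
  obtains A where "finite A" "A \<subseteq> carrier G" "\<And>x. x \<in> carrier G \<Longrightarrow> \<exists>n\<ge>1. x ^ n \<in> mult_gen A"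
proof -
  note g = complex_mult_group_simps[OF G]
  interpret comm_group G by (rule g(1))
  obtain r where r: "group_rank G = enat r" using rank by (cases "group_rank G") auto
  have bound: "card A \<le> r" if "int_independent G A" for A
  proof -
    have "enat (card A) \<le> group_rank G"
      unfolding group_rank_def using that by (intro SUP_upper) auto
    then show ?thesis using r by simp
  qed
  have "int_independent G {}" by (simp add: int_independent_def)
  then obtain A where A: "int_independent G A" and max: "\<And>B. int_independent G B \<Longrightarrow> card B \<le> card A"
    using ex_has_greatest_nat[of "int_independent G" "{}" card "Suc r"] bound by (metis less_Suc_eq_le)
  have fin: "finite A" "A \<subseteq> carrier G" using A by (auto simp: int_independent_def)
  have prod_eq: "(\<Otimes>\<^bsub>G\<^esub>a\<in>B. a [^]\<^bsub>G\<^esub> c a) = (\<Prod>a\<in>B. a powi c a)"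
    if "finite B" "B \<subseteq> carrier G" for B and c :: "complex \<Rightarrow> int"
  proof -
    have "(\<Otimes>\<^bsub>G\<^esub>a\<in>B. a [^]\<^bsub>G\<^esub> c a) = (\<Prod>a\<in>B. a [^]\<^bsub>G\<^esub> c a)"
      using that by (intro g(8)) auto
    also have "\<dots> = (\<Prod>a\<in>B. a powi c a)"
      using that g(7) by (intro prod.cong) auto
    finally show ?thesis .
  qed
  have mg: "0 \<notin> A" using fin g(4) by auto
  show ?thesis
  proof (rule that[OF fin])
    fix x assume x: "x \<in> carrier G"
    show "\<exists>n\<ge>1. x ^ n \<in> mult_gen A"
    proof (cases "x \<in> A")
      case True
      then show ?thesis using mult_gen_closed(8)[OF fin(1) mg] by (intro exI[of _ 1]) simp
    next
      case False
      have xA: "finite (insert x A)" "insert x A \<subseteq> carrier G" using fin x by auto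
      have "\<not> int_independent G (insert x A)" using max[of "insert x A"] fin False by auto
      then obtain c :: "complex \<Rightarrow> int" where c: "(\<Prod>a\<in>insert x A. a powi c a) = 1" "\<exists>a\<in>insert x A. c a \<noteq> 0"
        using xA prod_eq[OF xA] g(3) unfolding int_independent_def by metis
      have eq: "x powi c x * (\<Prod>a\<in>A. a powi c a) = 1" using c(1) fin False by simp
      have "c x \<noteq> 0"
      proof
        assume "c x = 0"
        then have "(\<Prod>a\<in>A. a powi c a) = 1" using eq by simp
        then have "\<forall>a\<in>A. c a = 0"
          using A prod_eq[OF fin, of c] g(3) unfolding int_independent_def by metis
        then show False using c(2) \<open>c x = 0\<close> by auto
      qed
      have P: "(\<Prod>a\<in>A. a powi c a) \<in> mult_gen A" by (auto simp: mult_gen_def)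
      have "x powi c x = inverse (\<Prod>a\<in>A. a powi c a)" using eq by (metis inverse_unique mult.commute)
      then have m: "x powi c x \<in> mult_gen A" using mult_gen_closed(5)[OF fin(1) mg P] by simp
      have "x powi \<bar>c x\<bar> \<in> mult_gen A"
        using m mult_gen_closed(5)[OF fin(1) mg m] by (cases "c x \<ge> 0") (simp_all add: power_int_minus)
      moreover have "x powi \<bar>c x\<bar> = x ^ nat \<bar>c x\<bar>" by (simp add: power_int_def)
      ultimately show ?thesis using \<open>c x \<noteq> 0\<close> by (intro exI[of _ "nat \<bar>c x\<bar>"]) auto
    qed
  qed
qed

lemma countable_algebraic: "countable {x::complex. algebraic x}"
proof -
  \<comment> \<open>Integer polynomials are enumerated by coefficient lists; the zero polynomial,
    for which every number is a root, gets the empty set.\<close>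
  define R :: "int list \<Rightarrow> complex set" where
    "R xs = (if map_poly of_int (Poly xs) = (0::complex poly) then {} else {x. poly (map_poly of_int (Poly xs)) x = 0})" for xs
  have "{x::complex. algebraic x} \<subseteq> (\<Union>xs. R xs)"
  proof
    fix x :: complex assume "x \<in> {x. algebraic x}"
    then obtain p :: "int poly" where p: "p \<noteq> 0" "poly (map_poly of_int p) x = 0"
      by (auto elim: algebraicE')
    then have "map_poly of_int p \<noteq> (0 :: complex poly)" by (auto simp: map_poly_eq_0_iff)
    then show "x \<in> (\<Union>xs. R xs)"
      using p by (intro UN_I[of "coeffs p"]) (auto simp: R_def)
  qed
  moreover have "finite (R xs)" for xs
    unfolding R_def by (simp add: poly_roots_finite)
  then have "countable (\<Union>xs. R xs)"
    by (simp add: countable_finite)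
  ultimately show ?thesis by (rule countable_subset)
qed

section \<open>Translation between the structure \<open>Qbar\<close> and the type
  \<open>complex\<close>, and the main theorem\<close>

lemma Qbar_simps [simp]:
  "carrier Qbar = {z. algebraic z}" "x \<otimes>\<^bsub>Qbar\<^esub> y = x * y" "x \<oplus>\<^bsub>Qbar\<^esub> y = x + y"
  "\<one>\<^bsub>Qbar\<^esub> = 1" "\<zero>\<^bsub>Qbar\<^esub> = 0"
  by (simp_all add: Qbar_def)

lemma field_Qbar: "field Qbar"
proof (rule cring.cring_fieldI2)
  show "cring Qbar"
  proof (rule cringI)
    show "abelian_group Qbar"
    proof (rule abelian_groupI)
      fix x assume "x \<in> carrier Qbar"
      then show "\<exists>y\<in>carrier Qbar. y \<oplus>\<^bsub>Qbar\<^esub> x = \<zero>\<^bsub>Qbar\<^esub>" by (intro bexI[of _ "- x"]) auto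
    qed (auto intro: algebraic_closed)
    show "comm_monoid Qbar" by (rule comm_monoidI) (auto intro: algebraic_closed)
  qed (auto simp: algebra_simps)
  show "\<zero>\<^bsub>Qbar\<^esub> \<noteq> \<one>\<^bsub>Qbar\<^esub>" by simp
  show "\<exists>b\<in>carrier Qbar. a \<otimes>\<^bsub>Qbar\<^esub> b = \<one>\<^bsub>Qbar\<^esub>" if "a \<in> carrier Qbar" "a \<noteq> \<zero>\<^bsub>Qbar\<^esub>" for a
    using that by (intro bexI[of _ "inverse a"]) auto
qed

lemma Qbar_inverses:
  assumes "algebraic x"
  shows "\<ominus>\<^bsub>Qbar\<^esub> x = - x" "x \<noteq> 0 \<Longrightarrow> inv\<^bsub>Qbar\<^esub> x = inverse x"
proof -
  interpret Q: field Qbar by (rule field_Qbar)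
  show "\<ominus>\<^bsub>Qbar\<^esub> x = - x" using Q.minus_equality[of "- x" x] assms by simp
  show "inv\<^bsub>Qbar\<^esub> x = inverse x" if "x \<noteq> 0"
    using Q.inv_unique'[of x "inverse x"] assms that algebraic_closed(7)[OF assms] by simp
qed

lemma subfield_Qbar:
  assumes "subfield L Qbar"
  shows "complex_subfield L" "x \<in> L \<Longrightarrow> algebraic x"
proof -
  interpret Q: field Qbar by (rule field_Qbar)
  show alg: "algebraic x" if "x \<in> L" for x using subfieldE(3)[OF assms] that by auto
  note r = subringE[OF subfieldE(1)[OF assms]]
  have minus: "- x \<in> L" if "x \<in> L" for x using r(5)[OF that] Qbar_inverses(1)[OF alg[OF that]] by simp
  have add: "x + y \<in> L" if "x \<in> L" "y \<in> L" for x y using r(7)[OF that] by simp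
  have "x - y \<in> L" if "x \<in> L" "y \<in> L" for x y using add[OF that(1) minus[OF that(2)]] by simp
  moreover have "x * y \<in> L" if "x \<in> L" "y \<in> L" for x y using r(6)[OF that] by simp
  moreover have "inverse x \<in> L" if "x \<in> L" for x
    using Q.subfield_m_inv(1)[OF assms, of x] Qbar_inverses(2)[OF alg[OF that]] that r(2) by (cases "x = 0") auto
  ultimately show "complex_subfield L"
    using r(3) by (simp add: complex_subfield_def complex_subring_def)
qed

lemma generate_field_Qbar_minimal:
  assumes "H \<subseteq> T" "complex_subfield T" "\<And>x. x \<in> T \<Longrightarrow> algebraic x"
  shows "generate_field Qbar H \<subseteq> T"
proof
  note t = complex_subfieldD[OF assms(2)]
  fix x assume "x \<in> generate_field Qbar H"
  then show "x \<in> T"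
    by (induction rule: generate_field.induct)
      (use assms t Qbar_inverses in \<open>auto simp: subset_iff\<close>)
qed

text \<open>Finite dimension is built up by adding lines, and \<open>A\<close> collects the vectors
  that span them. The conclusion is phrased for all fields \<open>T\<close>, since it is applied to
  the span of \<open>M\<close> over a number field containing \<open>A\<close>.\<close>

lemma finite_dimension_Qbar_generators:
  assumes "ring.finite_dimension Qbar K L"
  obtains A where "finite A" "\<And>x. x \<in> A \<Longrightarrow> algebraic x"
    "\<And>T. complex_subfield T \<Longrightarrow> K \<subseteq> T \<Longrightarrow> A \<subseteq> T \<Longrightarrow> L \<subseteq> T"
proof -
  interpret Q: field Qbar by (rule field_Qbar)
  obtain n where "Q.dimension n K L" using assms by (auto simp: Q.finite_dimension_def)
  then have "\<exists>A. finite A \<and> (\<forall>x\<in>A. algebraic x) \<and> (\<forall>T. complex_subfield T \<longrightarrow> K \<subseteq> T \<longrightarrow> A \<subseteq> T \<longrightarrow> L \<subseteq> T)"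
  proof (induction rule: Q.dimension.induct)
    case (zero_dim K)
    show ?case by (intro exI[of _ "{}"]) (auto intro: complex_subfieldD(1))
  next
    case (Suc_dim v E n K)
    then obtain A where A: "finite A" "\<forall>x\<in>A. algebraic x"
      "\<And>T. complex_subfield T \<Longrightarrow> K \<subseteq> T \<Longrightarrow> A \<subseteq> T \<Longrightarrow> E \<subseteq> T" by blast
    show ?case
    proof (intro exI[of _ "insert v A"] conjI allI impI)
      show "finite (insert v A)" "\<forall>x\<in>insert v A. algebraic x" using A Suc_dim.hyps(1) by auto
      fix T assume T: "complex_subfield T" "K \<subseteq> T" "insert v A \<subseteq> T"
      then have "E \<subseteq> T" using A(3) by blast
      moreover have "Q.line_extension K v E = {k * v + e |k e. k \<in> K \<and> e \<in> E}"
        unfolding Q.line_extension_def set_add_def' r_coset_def by auto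
      ultimately show "Q.line_extension K v E \<subseteq> T"
        using T(2,3) by (auto intro!: complex_subfieldD(3,6)[OF T(1)])
    qed
  qed
  then show ?thesis using that by blast
qed

lemma complex_mult_group_subfield:
  assumes "subfield L Qbar"
  shows "complex_mult_group (Multiplicative_Group.mult_of (Qbar\<lparr>carrier := L\<rparr>))"
proof -
  note c = complex_subfieldD[OF subfield_Qbar(1)[OF assms]]
  have "comm_group (Multiplicative_Group.mult_of (Qbar\<lparr>carrier := L\<rparr>))"
  proof (rule comm_groupI)
    fix x assume "x \<in> carrier (Multiplicative_Group.mult_of (Qbar\<lparr>carrier := L\<rparr>))"
    then show "\<exists>y\<in>carrier (Multiplicative_Group.mult_of (Qbar\<lparr>carrier := L\<rparr>)).
        y \<otimes>\<^bsub>Multiplicative_Group.mult_of (Qbar\<lparr>carrier := L\<rparr>)\<^esub> x = \<one>\<^bsub>Multiplicative_Group.mult_of (Qbar\<lparr>carrier := L\<rparr>)\<^esub>"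
      using c(7) by (intro bexI[of _ "inverse x"]) auto
  qed (auto simp: c)
  then show ?thesis by (auto simp: complex_mult_group_def fun_eq_iff)
qed

lemma mult_gen_Un:
  assumes "finite A" "finite B"
  shows "mult_gen (A \<union> B) \<subseteq> {u * v |u v. u \<in> mult_gen A \<and> v \<in> mult_gen B}"
proof
  fix x assume "x \<in> mult_gen (A \<union> B)"
  then obtain k where k: "x = (\<Prod>b\<in>A \<union> B. b powi k b)" by (auto simp: mult_gen_def)
  have "x = (\<Prod>b\<in>A. b powi k b) * (\<Prod>b\<in>B - A. b powi k b)"
    unfolding k using assms by (subst prod.union_disjoint[symmetric]) auto
  moreover have "(\<Prod>b\<in>A. b powi k b) \<in> mult_gen A" "(\<Prod>b\<in>B - A. b powi k b) \<in> mult_gen (B - A)"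
    by (auto simp: mult_gen_def)
  ultimately show "x \<in> {u * v |u v. u \<in> mult_gen A \<and> v \<in> mult_gen B}"
    using mult_gen_mono[of "B - A" B] assms by blast
qed

theorem theorem1p3:
  fixes \<Gamma> L :: "complex set"
  assumes "subgroup \<Gamma> (Multiplicative_Group.mult_of Qbar)"
    and "group_rank ((Multiplicative_Group.mult_of Qbar)\<lparr>carrier := \<Gamma>\<rparr>) < \<infinity>"
    and "subfield L Qbar"
    and "generate_field Qbar (\<rat> \<union> saturation (Multiplicative_Group.mult_of Qbar) \<Gamma>) \<subseteq> L"
    and "ring.finite_dimension Qbar
           (generate_field Qbar (\<rat> \<union> saturation (Multiplicative_Group.mult_of Qbar) \<Gamma>)) L"
  shows "free_abelian (Multiplicative_Group.mult_of (Qbar\<lparr>carrier := L\<rparr>) Mod saturation (Multiplicative_Group.mult_of Qbar) \<Gamma>)"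
proof -
  interpret Qbar: field Qbar by (rule field_Qbar)
  define U where "U = Multiplicative_Group.mult_of Qbar"
  define M where "M = saturation U \<Gamma>"
  define G where "G = Multiplicative_Group.mult_of (Qbar\<lparr>carrier := L\<rparr>)"
  have "subfield (carrier Qbar) Qbar" by (rule Qbar.carrier_is_subfield)
  moreover have "Qbar\<lparr>carrier := carrier Qbar\<rparr> = Qbar" by (simp add: Qbar_def)
  ultimately have U: "complex_mult_group U" using complex_mult_group_subfield unfolding U_def by metis
  note u = complex_mult_group_simps[OF U]
  have \<Gamma>: "subgroup \<Gamma> U" using assms(1) by (simp add: U_def)
  have \<Gamma>sub: "\<Gamma> \<subseteq> carrier U" by (rule subgroup.subset[OF \<Gamma>])
  have "complex_mult_group (U\<lparr>carrier := \<Gamma>\<rparr>)"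
    unfolding complex_mult_group_def
    using group.group_comm_groupI[OF subgroup.subgroup_is_group[OF \<Gamma>]] u(1,2,3)
    by (simp add: comm_group_def mult.commute)
  then obtain \<Gamma>0 where \<Gamma>0: "finite \<Gamma>0" "\<Gamma>0 \<subseteq> \<Gamma>" "\<And>x. x \<in> \<Gamma> \<Longrightarrow> \<exists>n\<ge>1. x ^ n \<in> mult_gen \<Gamma>0"
    using finite_rank_generators[of "U\<lparr>carrier := \<Gamma>\<rparr>"] assms(2) by (auto simp: U_def)
  have carrU: "x \<in> carrier U \<longleftrightarrow> algebraic x \<and> x \<noteq> 0" for x by (simp add: U_def)
  have M_iff: "x \<in> M \<longleftrightarrow> algebraic x \<and> x \<noteq> 0 \<and> (\<exists>n\<ge>1. x ^ n \<in> \<Gamma>)" for x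
    by (auto simp: M_def saturation_def carrU u(6))
  have Msub: "subgroup M U" unfolding M_def by (rule comm_group.subgroup_saturation[OF u(1) \<Gamma>])
  have M_mult: "x * y \<in> M" if "x \<in> M" "y \<in> M" for x y
    using subgroup.m_closed[OF Msub that] u(2) by simp
  have M_inv: "inverse x \<in> M" if "x \<in> M" for x
    using subgroup.m_inv_closed[OF Msub that] u(5)[of x] subgroup.subset[OF Msub] that by auto
  have \<Gamma>one: "1 \<in> \<Gamma>" using subgroup.one_closed[OF \<Gamma>] u(3) by simp
  have M_unity: "unity_roots \<subseteq> M"
    using unity_roots_closed(4,5) \<Gamma>one by (fastforce simp: M_iff unity_roots_def)
  have M_rad: "\<exists>n\<ge>1. x ^ n \<in> mult_gen \<Gamma>0" if x: "x \<in> M" for x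
  proof -
    obtain n where n: "n \<ge> 1" "x ^ n \<in> \<Gamma>" using x M_iff by blast
    obtain k where k: "k \<ge> 1" "(x ^ n) ^ k \<in> mult_gen \<Gamma>0" using \<Gamma>0(3)[OF n(2)] by blast
    then show ?thesis using n by (intro exI[of _ "n * k"]) (auto simp: power_mult)
  qed
  have \<Gamma>0': "0 \<notin> \<Gamma>0" using \<Gamma>0(2) \<Gamma>sub carrU by auto
  \<comment> \<open>Needed so that the generators of \<open>\<Gamma>\<close> added to
    \<open>B\<close> become trivial again in the quotient.\<close>
  have genM: "mult_gen \<Gamma>0 \<subseteq> M"
  proof -
    have "mult_gen \<Gamma>0 = generate U \<Gamma>0" using generate_eq_mult_gen[OF U \<Gamma>0(1)] \<Gamma>0(2) \<Gamma>sub by auto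
    also have "\<dots> \<subseteq> \<Gamma>" using group.generate_subgroup_incl[OF _ \<Gamma>0(2) \<Gamma>] u(1) by (simp add: comm_group_def)
    also have "\<dots> \<subseteq> M" unfolding M_def by (rule comm_group.subgroup_subset_saturation[OF u(1) \<Gamma>])
    finally show ?thesis .
  qed
  have L: "complex_subfield L" "\<And>x. x \<in> L \<Longrightarrow> algebraic x" using subfield_Qbar[OF assms(3)] by auto
  define K where "K = generate_field Qbar (\<rat> \<union> M)"
  have KL: "K \<subseteq> L" using assms(4) by (simp add: K_def M_def U_def)
  have M_sub_L: "M \<subseteq> L" using KL generate_field.incl[of _ "\<rat> \<union> M" Qbar] by (auto simp: K_def)
  obtain A where A: "finite A" "\<And>x. x \<in> A \<Longrightarrow> algebraic x"
    "\<And>T. complex_subfield T \<Longrightarrow> K \<subseteq> T \<Longrightarrow> A \<subseteq> T \<Longrightarrow> L \<subseteq> T"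
    using finite_dimension_Qbar_generators[of K L] assms(5) by (auto simp: K_def M_def U_def)
  have G: "complex_mult_group G" unfolding G_def by (rule complex_mult_group_subfield[OF assms(3)])
  note g = complex_mult_group_simps[OF G]
  have carrG: "x \<in> carrier G \<longleftrightarrow> x \<in> L \<and> x \<noteq> 0" for x by (simp add: G_def)
  interpret G: comm_group G by (rule g(1))
  have MG: "subgroup M G"
  proof (rule G.subgroupI)
    show carr: "M \<subseteq> carrier G" using M_sub_L M_iff carrG by auto
    show "M \<noteq> {}" using M_unity unity_roots_closed(1) by blast
    show "inv\<^bsub>G\<^esub> x \<in> M" if "x \<in> M" for x
      using M_inv[OF that] g(5)[OF subsetD[OF carr that]] by simp
    show "x \<otimes>\<^bsub>G\<^esub> y \<in> M" if "x \<in> M" "y \<in> M" for x y using M_mult[OF that] g(2) by simp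
  qed
  define h where "h a = M #>\<^bsub>G\<^esub> a" for a
  interpret Q: comm_group "G Mod M" by (rule G.abelian_FactGroup[OF MG])
  have "normal M G" by (simp add: G.normal_iff_subgroup MG)
  then have h_hom: "h \<in> hom G (G Mod M)" unfolding h_def by (rule normal.r_coset_hom_Mod)
  interpret h: group_hom G "G Mod M" h
    by (simp add: group_hom_def group_hom_axioms_def h_hom)
  have carrQ: "carrier (G Mod M) = h ` carrier G" by (auto simp: carrier_FactGroup h_def)
  have hM: "h x = M \<longleftrightarrow> x \<in> M" if "x \<in> carrier G" for x
    unfolding h_def using G.coset_join1[OF _ that MG] G.coset_join2[OF that MG] by blast
  have h_pow: "h x [^]\<^bsub>G Mod M\<^esub> (n::nat) = h (x ^ n)" if "x \<in> carrier G" for x n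
    using h.hom_nat_pow[OF that, of n] g(6) by simp
  have "free_abelian (G Mod M)"
  proof (rule Q.free_if_bounded_saturation)
    have "carrier G \<subseteq> {x. algebraic x}" using carrG L(2) by auto
    then show "countable (carrier (G Mod M))"
      unfolding carrQ using countable_algebraic countable_subset by blast
  next
    fix y and n :: nat assume y: "y \<in> carrier (G Mod M)" "n \<ge> 1" "y [^]\<^bsub>G Mod M\<^esub> n = \<one>\<^bsub>G Mod M\<^esub>"
    then obtain x where x: "x \<in> carrier G" "y = h x" unfolding carrQ by blast
    have "x ^ n \<in> carrier G" using G.nat_pow_closed[OF x(1), of n] g(6) by simp
    then have "x ^ n \<in> M" using y(3) hM h_pow[OF x(1)] x(2) by simp
    then obtain k where "k \<ge> 1" "(x ^ n) ^ k \<in> \<Gamma>" using M_iff by blast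
    then have "x \<in> M" using x(1) carrG L(2) y(2) unfolding M_iff
      by (auto simp: power_mult[symmetric] intro!: exI[of _ "n * k"])
    then show "y = \<one>\<^bsub>G Mod M\<^esub>" using hM[OF x(1)] x(2) by simp
  next
    fix C assume C: "finite C" "C \<subseteq> carrier (G Mod M)"
    then obtain B where B: "finite B" "B \<subseteq> carrier G" "C = h ` B"
      unfolding carrQ by (meson finite_subset_image)
    have genC: "generate (G Mod M) C = h ` mult_gen B"
      unfolding B(3) using h.generate_img[OF B(2)] generate_eq_mult_gen[OF G B(1,2)] by simp
    have "finite (A \<union> \<Gamma>0 \<union> B)" using A(1) \<Gamma>0(1) B(1) by simp
    moreover have "algebraic x" if "x \<in> A \<union> \<Gamma>0 \<union> B" for x
    proof -
      have "x \<in> A \<or> x \<in> carrier U \<or> x \<in> carrier G" using that \<Gamma>0(2) \<Gamma>sub B(2) by blast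
      then show ?thesis using A(2) carrU carrG L(2) by blast
    qed
    \<comment> \<open>Each part has its purpose: \<open>A\<close> brings \<open>L\<close> into the
      span of \<open>M\<close> over \<open>F\<close>, \<open>\<Gamma>0\<close> makes the elements of
      \<open>M\<close> radicals over \<open>F\<close>, and \<open>B\<close> consists of lifts of the
      given generators.\<close>
    ultimately obtain F where F: "number_field F" "A \<union> \<Gamma>0 \<union> B \<subseteq> F"
      using number_field_containing[of "A \<union> \<Gamma>0 \<union> B"] by blast
    have B0: "0 \<notin> B" using B(2) carrG by auto
    have B': "finite (\<Gamma>0 \<union> B)" "\<Gamma>0 \<union> B \<subseteq> F" "0 \<notin> \<Gamma>0 \<union> B"
      using \<Gamma>0(1) B(1) F(2) \<Gamma>0' B0 by auto
    note mg = mult_gen_closed[OF B'(1,3)]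
    have gen0: "mult_gen \<Gamma>0 \<subseteq> mult_gen (\<Gamma>0 \<union> B)" "mult_gen B \<subseteq> mult_gen (\<Gamma>0 \<union> B)"
      using mult_gen_mono[OF _ B'(1), of \<Gamma>0] mult_gen_mono[OF _ B'(1), of B] by simp_all
    have M0: "x \<noteq> 0" if "x \<in> M" for x using that M_iff by blast
    have rad: "\<exists>n\<ge>1. x ^ n \<in> mult_gen (\<Gamma>0 \<union> B)" if "x \<in> M" for x using M_rad[OF that] gen0 by blast
    obtain N :: nat where N: "N \<ge> 1" "\<And>x n. x \<in> mspan F M \<Longrightarrow> n \<ge> 1 \<Longrightarrow> x ^ n \<in> mult_gen (\<Gamma>0 \<union> B)
        \<Longrightarrow> \<exists>m\<in>M. x ^ N / m \<in> mult_gen (\<Gamma>0 \<union> B)"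
      using radical_saturation_exponent[OF F(1) B' M_unity M_mult M0 rad] by blast
    have M_one: "1 \<in> M" using M_unity unity_roots_closed(1) by blast
    have M_alg: "algebraic x" if "x \<in> M" for x using that M_iff by blast
    note F_alg = number_field_algebraic[OF F(1)]
    note F_sub = number_field_subfield[OF F(1)]
    note span = mspan_complex_subfield[OF F_sub _ M_one, simplified F_alg M_mult M_alg]
    have "K \<subseteq> mspan F M"
      unfolding K_def using span Rats_subset_complex_subfield by (intro generate_field_Qbar_minimal) auto
    then have Lspan: "L \<subseteq> mspan F M" using A(3)[OF span(1)] F(2) span(3) by blast
    have "y [^]\<^bsub>G Mod M\<^esub> N \<in> generate (G Mod M) C" if "y \<in> saturation (G Mod M) (generate (G Mod M) C)" for y
    proof -
      obtain n where y: "y \<in> carrier (G Mod M)" "n \<ge> (1::nat)" "y [^]\<^bsub>G Mod M\<^esub> n \<in> h ` mult_gen B"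
        using \<open>y \<in> saturation (G Mod M) (generate (G Mod M) C)\<close> unfolding saturation_def genC by blast
      obtain x where x: "x \<in> carrier G" "y = h x" using y(1) unfolding carrQ by blast
      obtain v where v: "v \<in> mult_gen B" "h (x ^ n) = h v" using y(3) h_pow[OF x(1)] x(2) by auto
      have genG: "mult_gen B \<subseteq> carrier G"
        using generate_eq_mult_gen[OF G B(1,2)] G.generate_incl[OF B(2)] by simp
      have xn: "x ^ n \<in> carrier G" using G.nat_pow_closed[OF x(1), of n] g(6) by simp
      have "x ^ n \<in> h v" using v(2) G.rcos_self[OF xn MG] by (simp add: h_def)
      \<comment> \<open>In \<open>L\<close> the power of \<open>x\<close> lies in the group of
        \<open>B\<close> only up to a factor from \<open>M\<close>; a further power \<open>k\<close>
        moves this factor into the enlarged group.\<close>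
      then obtain m where m: "m \<in> M" "x ^ n = m * v" using g(2) by (auto simp: h_def r_coset_def)
      obtain k where k: "k \<ge> 1" "m ^ k \<in> mult_gen (\<Gamma>0 \<union> B)" using rad[OF m(1)] by blast
      have "x ^ (n * k) = m ^ k * v ^ k" by (simp add: power_mult m(2) power_mult_distrib)
      then have "x ^ (n * k) \<in> mult_gen (\<Gamma>0 \<union> B)" using mg(2,4) k(2) v(1) gen0 by auto
      moreover have "n * k \<ge> 1" using y(2) k(1) by simp
      moreover have "x \<in> mspan F M" using x(1) carrG Lspan by auto
      ultimately obtain l where l: "l \<in> M" "x ^ N / l \<in> mult_gen (\<Gamma>0 \<union> B)" using N(2) by blast
      \<comment> \<open>The exponent was obtained for the enlarged generating set; its part
        \<open>w\<close> lies in \<open>M\<close>, so modulo \<open>M\<close> only \<open>z\<close>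
        from the original group survives.\<close>
      obtain w z where wz: "x ^ N / l = w * z" "w \<in> mult_gen \<Gamma>0" "z \<in> mult_gen B"
        using mult_gen_Un[OF \<Gamma>0(1) B(1)] l(2) by blast
      have "x ^ N = l * w * z" using wz(1) M0[OF l(1)] by (simp add: field_simps)
      moreover have lw: "l * w \<in> M" using M_mult[OF l(1)] genM wz(2) by auto
      moreover have "l * w \<in> carrier G" "z \<in> carrier G" using lw subgroup.subset[OF MG] genG wz(3) by auto
      ultimately have "h (x ^ N) = h (l * w) \<otimes>\<^bsub>G Mod M\<^esub> h z" using h.hom_mult[of "l * w" z] g(2) by simp
      also have "h (l * w) = \<one>\<^bsub>G Mod M\<^esub>" using hM[OF \<open>l * w \<in> carrier G\<close>] lw by simp
      also have "\<one>\<^bsub>G Mod M\<^esub> \<otimes>\<^bsub>G Mod M\<^esub> h z = h z" using \<open>z \<in> carrier G\<close> by (intro Q.l_one h.hom_closed)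
      finally show ?thesis using h_pow[OF x(1), of N] x(2) wz(3) genC by auto
    qed
    then show "\<exists>N\<ge>1. \<forall>y\<in>saturation (G Mod M) (generate (G Mod M) C). y [^]\<^bsub>G Mod M\<^esub> (N::nat) \<in> generate (G Mod M) C"
      using N(1) by blast
  qed
  then show ?thesis by (simp add: G_def M_def U_def)
qed

end
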